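(* Let $G$ be a hyperrigid subset of a unital $C^*$-algebra $\mathcal{A}$, and let $\chi$ be a character of $\mathcal{A}$ such that $G\subseteq\ker\chi$. Suppose that $\pi\colon\mathcal{A}\to B(\mathcal{H})$ and $\rho\colon\mathcal{A}\to B(\mathcal{K})$ are representations of $\mathcal{A}$ on separable Hilbert spaces $\mathcal{H}$ and $\mathcal{K}$, respectively, and $R\in B(\mathcal{H},\mathcal{K})$ is a contraction such that $\pi(g)=R^*\rho(g)R$ for every $g\in G$, and $\mathcal{K}=\bigvee_{a\in\mathcal{A}}\rho(a)R(\mathcal{H})$. Set $\mathcal{L}_\chi:=\bigvee_{a\in\mathcal{A}}\rho(a)R(\mathcal{M}_\chi(\pi))$. Then (i) $\mathcal{H}=\mathcal{H}_I\oplus\mathcal{H}_{PC}$ and $\mathcal{H}_I=\mathcal{H}_U\oplus\mathcal{H}_S$, where $\mathcal{H}_I=\ker(\triangle_R)$, $\mathcal{H}_U=\mathcal{M}_\chi(\pi)^\perp$, $\mathcal{H}_S=\ker(\triangle_R)\cap\mathcal{M}_\chi(\pi)$, $\mathcal{H}_{PC}=\overline{\operatorname{ran}(\triangle_R)}$; (ii) $\mathcal{K}=\mathcal{K}_I\oplus\mathcal{K}_{PC}$ and $\mathcal{K}_I=\mathcal{K}_U\oplus\mathcal{K}_S$, where $\mathcal{K}_I=\overline{\operatorname{ran}(R\triangle_R)}^{\perp}$, $\mathcal{K}_U=\mathcal{L}_\chi^\perp$, $\mathcal{K}_S=\overline{\operatorname{ran}(R\triangle_R)}^{\perp}\cap\mathcal{L}_\chi$,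 $\mathcal{K}_{PC}=\overline{\operatorname{ran}(R\triangle_R)}$; (iii) the spaces $\mathcal{H}_U$, $\mathcal{H}_S$ and $\mathcal{H}_{PC}$ reduce $\pi$, and $\pi(a)|_{\mathcal{H}_U^\perp}=\chi(a)I_{\mathcal{H}_U^\perp}$ for all $a\in\mathcal{A}$; (iv) the spaces $\mathcal{K}_U$, $\mathcal{K}_S$ and $\mathcal{K}_{PC}$ reduce $\rho$, and $\rho(a)|_{\mathcal{K}_U^\perp}=\chi(a)I_{\mathcal{K}_U^\perp}$ for all $a\in\mathcal{A}$; (v) $R=R_I\oplus R_{PC}$ and $R_I=R_U\oplus R_S$, where $R_I\in B(\mathcal{H}_I,\mathcal{K}_I)$, $R_U\in B(\mathcal{H}_U,\mathcal{K}_U)$, $R_S\in B(\mathcal{H}_S,\mathcal{K}_S)$ and $R_{PC}\in B(\mathcal{H}_{PC},\mathcal{K}_{PC})$; (vi) $R_U$ is unitary, $R_S$ is an isometry and $R_{PC}$ is a pure contraction; (vii) $\pi(a)|_{\mathcal{H}_U}=R_U^*\rho(a)|_{\mathcal{K}_U}R_U$ for every $a\in\mathcal{A}$; (viii) $\mathscr{D}(R_I)=\mathscr{D}(R_S)=\ker(R^* )$.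
   Context: All Hilbert spaces are complex. $B(\mathcal{H},\mathcal{K})$ is the space of bounded linear operators from $\mathcal{H}$ to $\mathcal{K}$, $B(\mathcal{H})=B(\mathcal{H},\mathcal{H})$, and $I$ is the identity operator. $\bigvee$ denotes closed linear span. A representation of a unital $C^*$-algebra $\mathcal{A}$ is a unital $*$-homomorphism $\mathcal{A}\to B(\mathcal{H})$; a character is a one-dimensional representation $\chi\colon\mathcal{A}\to\mathbb{C}$. For a representation $\pi\colon\mathcal{A}\to B(\mathcal{H})$ and a character $\chi$, $\mathcal{M}_\chi(\pi):=\bigcap_{a\in\mathcal{A}}\ker(\pi(a)-\chi(a)I)$. A contraction is an operator $R$ with $\|R\|\le 1$; $\triangle_R:=I-R^*R$. $R$ is a pure contraction if $\|Rh\|<\|h\|$ for every nonzero $h$. For an isometry $V\in B(\mathcal{H},\mathcal{K})$, its defect space is $\mathscr{D}(V)=\operatorname{ran}(V)^\perp=\ker(V^* )\subseteq\mathcal{K}$ (the complement taken in the target space of $V$; the target spaces $\mathcal{K}_I,\mathcal{K}_S$ are viewed as subspaces of $\mathcal{K}$). All direct sums are orthogonal. A closed subspace reduces $\pi$ if it reduces every $\pi(a)$. UCP means unital completely positive. A set $G$ generates the unital $C^*$-algebra $\mathcal{A}$ if $\mathcal{A}$ is the smallest $C^*$-subalgebra of $\mathcal{A}$ containing $G$ and the unit. A finite or countably infinite set $G$ of generators of $\mathcal{A}$ is hyperrigid if for every faithful representation $\pi\colon\mathcal{A}\to B(\mathcal{H})$ on a separable Hilbert space $\mathcal{H}$ and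 every sequence of UCP maps $\Phi_k\colon B(\mathcal{H})\to B(\mathcal{H})$ ($k\in\mathbb{N}$): if $\lim_{k}\|\Phi_k(\pi(g))-\pi(g)\|=0$ for all $g\in G$, then $\lim_k\|\Phi_k(\pi(a))-\pi(a)\|=0$ for all $a\in\mathcal{A}$. A "hyperrigid subset" is always a finite or countably infinite generating set. *)

theory Defs
  imports "HOL-Analysis.Analysis"
begin

section \<open>Complex inner product spaces and unital C*-algebras\<close>

class scaleC =
  fixes scaleC :: "complex \<Rightarrow> 'a \<Rightarrow> 'a"  (infixr \<open>*\<^sub>C\<close> 75)

class complex_vector = real_vector + scaleC +
  assumes scaleC_add_right: "c *\<^sub>C (x + y) = c *\<^sub>C x + c *\<^sub>C y"
    and scaleC_add_left: "(c + d) *\<^sub>C x = c *\<^sub>C x + d *\<^sub>C x"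
    and scaleC_scaleC: "c *\<^sub>C d *\<^sub>C x = (c * d) *\<^sub>C x"
    and scaleC_one: "1 *\<^sub>C x = x"
    and scaleR_scaleC: "r *\<^sub>R x = complex_of_real r *\<^sub>C x"

class complex_normed_vector = real_normed_vector + complex_vector +
  assumes norm_scaleC: "norm (c *\<^sub>C x) = cmod c * norm x"

text \<open>The inner product is linear in the first argument.\<close>

class complex_inner = complex_normed_vector +
  fixes cinner :: "'a \<Rightarrow> 'a \<Rightarrow> complex"
  assumes cinner_commute: "cinner x y = cnj (cinner y x)"
    and cinner_add_left: "cinner (x + y) z = cinner x z + cinner y z"
    and cinner_scaleC_left: "cinner (c *\<^sub>C x) y = c * cinner x y"
    and cinner_self: "cinner x x = complex_of_real ((norm x)\<^sup>2)"

class chilbert_space = complex_inner + complete_space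

text \<open>The norm of the unit is 1 (this is part of \<open>real_normed_algebra_1\<close>), so the zero
  algebra, which has no characters, is excluded.\<close>

class unital_cstar_algebra = real_normed_algebra_1 + complex_normed_vector + complete_space +
  fixes star :: "'a \<Rightarrow> 'a"
  assumes scaleC_mult_left: "(c *\<^sub>C a) * b = c *\<^sub>C (a * b)"
    and scaleC_mult_right: "a * (c *\<^sub>C b) = c *\<^sub>C (a * b)"
    and star_star: "star (star a) = a"
    and star_add: "star (a + b) = star a + star b"
    and star_scaleC: "star (c *\<^sub>C a) = cnj c *\<^sub>C star a"
    and star_mult: "star (a * b) = star b * star a"
    and norm_star_mult: "norm (star a * a) = (norm a)\<^sup>2"

definition csubspace :: "'a::complex_vector set \<Rightarrow> bool" where
  "csubspace M \<longleftrightarrow> 0 \<in> M \<and> (\<forall>x\<in>M. \<forall>y\<in>M. x + y \<in> M) \<and> (\<forall>c. \<forall>x\<in>M. c *\<^sub>C x \<in> M)"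

definition closed_cspan :: "'a::complex_normed_vector set \<Rightarrow> 'a set" where
  "closed_cspan S = closure (csubspace hull S)"

definition cstar_subalgebra :: "'a::unital_cstar_algebra set \<Rightarrow> bool" where
  "cstar_subalgebra S \<longleftrightarrow>
     csubspace S \<and> closed S \<and> (\<forall>a\<in>S. \<forall>b\<in>S. a * b \<in> S) \<and> (\<forall>a\<in>S. star a \<in> S)"

definition generates :: "'a::unital_cstar_algebra set \<Rightarrow> bool" where
  "generates G \<longleftrightarrow> cstar_subalgebra hull (insert 1 G) = UNIV"

definition character :: "('a::unital_cstar_algebra \<Rightarrow> complex) \<Rightarrow> bool" where
  "character chi \<longleftrightarrow>
     (\<forall>a b. chi (a + b) = chi a + chi b) \<and> (\<forall>c a. chi (c *\<^sub>C a) = c * chi a) \<and>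
     (\<forall>a b. chi (a * b) = chi a * chi b) \<and> chi 1 = 1 \<and> (\<forall>a. chi (star a) = cnj (chi a))"


section \<open>Hilbert spaces and bounded operators\<close>

text \<open>A Hilbert space is given by a closed subspace of a type of class \<open>chilbert_space\<close>
  (possibly the whole type). Thus a Hilbert space and its closed subspaces are treated on the
  same footing, and closures, which are taken in the ambient type, agree with closures in the
  Hilbert space.\<close>

definition hilbert :: "'h::chilbert_space set \<Rightarrow> bool" where
  "hilbert H \<longleftrightarrow> csubspace H \<and> closed H"

definition separable_hilbert :: "'h::chilbert_space set \<Rightarrow> bool" where
  "separable_hilbert H \<longleftrightarrow> hilbert H \<and> separable_space (top_of_set H)"

text \<open>The elements of \<open>B(H, K)\<close> are \<^emph>\<open>extensional\<close> functions: their value outside of \<open>H\<close> is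
  \<open>undefined\<close>, so that two of them are equal iff they agree on \<open>H\<close>.\<close>

definition bounded_ops :: "'h::chilbert_space set \<Rightarrow> 'k::chilbert_space set \<Rightarrow> ('h \<Rightarrow> 'k) set" where
  "bounded_ops H K =
     {T \<in> H \<rightarrow>\<^sub>E K. (\<forall>x\<in>H. \<forall>y\<in>H. T (x + y) = T x + T y) \<and> (\<forall>c. \<forall>x\<in>H. T (c *\<^sub>C x) = c *\<^sub>C T x) \<and>
        (\<exists>C. \<forall>x\<in>H. norm (T x) \<le> C * norm x)}"

definition opnorm :: "'h::chilbert_space set \<Rightarrow> ('h \<Rightarrow> 'k::chilbert_space) \<Rightarrow> real" where
  "opnorm H T = (SUP x\<in>{x \<in> H. norm x \<le> 1}. norm (T x))"

definition id_op :: "'h::chilbert_space set \<Rightarrow> 'h \<Rightarrow> 'h" where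
  "id_op H = (\<lambda>x\<in>H. x)"

definition adjoint_op ::
  "'h::chilbert_space set \<Rightarrow> 'k::chilbert_space set \<Rightarrow> ('h \<Rightarrow> 'k) \<Rightarrow> 'k \<Rightarrow> 'h" where
  "adjoint_op H K T =
     (THE S. S \<in> bounded_ops K H \<and> (\<forall>x\<in>H. \<forall>y\<in>K. cinner (T x) y = cinner x (S y)))"

definition op_ker :: "'h::chilbert_space set \<Rightarrow> ('h \<Rightarrow> 'k::chilbert_space) \<Rightarrow> 'h set" where
  "op_ker H T = {x \<in> H. T x = 0}"

definition ortho_compl :: "'h::chilbert_space set \<Rightarrow> 'h set \<Rightarrow> 'h set" where
  "ortho_compl H M = {x \<in> H. \<forall>y\<in>M. cinner x y = 0}"

definition ortho_sum :: "'h::chilbert_space set \<Rightarrow> 'h set \<Rightarrow> 'h set \<Rightarrow> bool" where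
  "ortho_sum H M N \<longleftrightarrow>
     hilbert M \<and> hilbert N \<and> (\<forall>x\<in>M. \<forall>y\<in>N. cinner x y = 0) \<and> H = {x + y | x y. x \<in> M \<and> y \<in> N}"

text \<open>\<open>op_ortho_sum M\<^sub>1 M\<^sub>2 N\<^sub>1 N\<^sub>2 T T\<^sub>1 T\<^sub>2\<close> expresses \<open>T = T\<^sub>1 \<oplus> T\<^sub>2\<close>, where \<open>T\<^sub>i \<in> B(M\<^sub>i, N\<^sub>i)\<close>.\<close>

definition op_ortho_sum ::
  "'h::chilbert_space set \<Rightarrow> 'h set \<Rightarrow> 'k::chilbert_space set \<Rightarrow> 'k set \<Rightarrow>
   ('h \<Rightarrow> 'k) \<Rightarrow> ('h \<Rightarrow> 'k) \<Rightarrow> ('h \<Rightarrow> 'k) \<Rightarrow> bool" where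
  "op_ortho_sum M1 M2 N1 N2 T T1 T2 \<longleftrightarrow>
     T1 \<in> bounded_ops M1 N1 \<and> T2 \<in> bounded_ops M2 N2 \<and>
     (\<forall>x\<in>M1. \<forall>y\<in>M2. T (x + y) = T1 x + T2 y)"

definition contraction ::
  "'h::chilbert_space set \<Rightarrow> 'k::chilbert_space set \<Rightarrow> ('h \<Rightarrow> 'k) \<Rightarrow> bool" where
  "contraction H K R \<longleftrightarrow> R \<in> bounded_ops H K \<and> opnorm H R \<le> 1"

definition pure_contraction ::
  "'h::chilbert_space set \<Rightarrow> 'k::chilbert_space set \<Rightarrow> ('h \<Rightarrow> 'k) \<Rightarrow> bool" where
  "pure_contraction H K R \<longleftrightarrow>
     R \<in> bounded_ops H K \<and> (\<forall>h\<in>H. h \<noteq> 0 \<longrightarrow> norm (R h) < norm h)"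

definition isometry_op ::
  "'h::chilbert_space set \<Rightarrow> 'k::chilbert_space set \<Rightarrow> ('h \<Rightarrow> 'k) \<Rightarrow> bool" where
  "isometry_op H K V \<longleftrightarrow> V \<in> bounded_ops H K \<and> (\<forall>x\<in>H. adjoint_op H K V (V x) = x)"

definition unitary_op ::
  "'h::chilbert_space set \<Rightarrow> 'k::chilbert_space set \<Rightarrow> ('h \<Rightarrow> 'k) \<Rightarrow> bool" where
  "unitary_op H K U \<longleftrightarrow> U \<in> bounded_ops H K \<and>
     (\<forall>x\<in>H. adjoint_op H K U (U x) = x) \<and> (\<forall>y\<in>K. U (adjoint_op H K U y) = y)"

text \<open>The operator \<open>\<triangle>\<^sub>R = I - R\<^sup>*R\<close>.\<close>

definition defect_op ::
  "'h::chilbert_space set \<Rightarrow> 'k::chilbert_space set \<Rightarrow> ('h \<Rightarrow> 'k) \<Rightarrow> 'h \<Rightarrow> 'h" where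
  "defect_op H K R = (\<lambda>x\<in>H. x - adjoint_op H K R (R x))"

text \<open>The space \<open>\<D>(V) = ran(V)\<^sup>\<bottom>\<close>, with the complement taken in the target space \<open>K\<close> of \<open>V\<close>.\<close>

definition defect_space ::
  "'h::chilbert_space set \<Rightarrow> 'k::chilbert_space set \<Rightarrow> ('h \<Rightarrow> 'k) \<Rightarrow> 'k set" where
  "defect_space H K V = ortho_compl K (V ` H)"


section \<open>Representations and unital completely positive maps\<close>

definition star_rep ::
  "'h::chilbert_space set \<Rightarrow> ('a::unital_cstar_algebra \<Rightarrow> 'h \<Rightarrow> 'h) \<Rightarrow> bool" where
  "star_rep H \<pi> \<longleftrightarrow>
     (\<forall>a. \<pi> a \<in> bounded_ops H H) \<and> \<pi> 1 = id_op H \<and>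
     (\<forall>a b. \<forall>x\<in>H. \<pi> (a + b) x = \<pi> a x + \<pi> b x) \<and>
     (\<forall>c a. \<forall>x\<in>H. \<pi> (c *\<^sub>C a) x = c *\<^sub>C \<pi> a x) \<and>
     (\<forall>a b. \<forall>x\<in>H. \<pi> (a * b) x = \<pi> a (\<pi> b x)) \<and>
     (\<forall>a. \<pi> (star a) = adjoint_op H H (\<pi> a))"

definition faithful_rep ::
  "'h::chilbert_space set \<Rightarrow> ('a::unital_cstar_algebra \<Rightarrow> 'h \<Rightarrow> 'h) \<Rightarrow> bool" where
  "faithful_rep H \<pi> \<longleftrightarrow> star_rep H \<pi> \<and> inj \<pi>"

definition reduces_op :: "'h::chilbert_space set \<Rightarrow> 'h set \<Rightarrow> ('h \<Rightarrow> 'h) \<Rightarrow> bool" where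
  "reduces_op H M T \<longleftrightarrow>
     hilbert M \<and> M \<subseteq> H \<and> T ` M \<subseteq> M \<and> T ` ortho_compl H M \<subseteq> ortho_compl H M"

definition reduces_rep ::
  "'h::chilbert_space set \<Rightarrow> 'h set \<Rightarrow> ('a::unital_cstar_algebra \<Rightarrow> 'h \<Rightarrow> 'h) \<Rightarrow> bool" where
  "reduces_rep H M \<pi> \<longleftrightarrow> (\<forall>a. reduces_op H M (\<pi> a))"

text \<open>The space \<open>M_chi(\<pi>) = \<Inter>\<^sub>a ker(\<pi>(a) - chi(a)I)\<close>.\<close>

definition char_space ::
  "'h::chilbert_space set \<Rightarrow> ('a::unital_cstar_algebra \<Rightarrow> complex) \<Rightarrow> ('a \<Rightarrow> 'h \<Rightarrow> 'h) \<Rightarrow> 'h set" where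
  "char_space H chi \<pi> = (\<Inter>a. op_ker H (\<lambda>x. \<pi> a x - chi a *\<^sub>C x))"

text \<open>Positivity of an element of \<open>M\<^sub>n(B(H)) = B(H\<^sup>n)\<close>.\<close>

definition positive_matrix :: "'h::chilbert_space set \<Rightarrow> nat \<Rightarrow> (nat \<Rightarrow> nat \<Rightarrow> 'h \<Rightarrow> 'h) \<Rightarrow> bool" where
  "positive_matrix H n T \<longleftrightarrow>
     (\<forall>i<n. \<forall>j<n. T i j \<in> bounded_ops H H) \<and>
     (\<forall>x. (\<forall>i<n. x i \<in> H) \<longrightarrow> (\<Sum>i<n. \<Sum>j<n. cinner (T i j (x j)) (x i)) \<in> \<real>\<^sub>\<ge>\<^sub>0)"

definition ucp_map :: "'h::chilbert_space set \<Rightarrow> (('h \<Rightarrow> 'h) \<Rightarrow> ('h \<Rightarrow> 'h)) \<Rightarrow> bool" where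
  "ucp_map H \<Phi> \<longleftrightarrow>
     (\<forall>T\<in>bounded_ops H H. \<Phi> T \<in> bounded_ops H H) \<and>
     (\<forall>S\<in>bounded_ops H H. \<forall>T\<in>bounded_ops H H. \<forall>x\<in>H. \<Phi> (\<lambda>y\<in>H. S y + T y) x = \<Phi> S x + \<Phi> T x) \<and>
     (\<forall>c. \<forall>T\<in>bounded_ops H H. \<forall>x\<in>H. \<Phi> (\<lambda>y\<in>H. c *\<^sub>C T y) x = c *\<^sub>C \<Phi> T x) \<and>
     \<Phi> (id_op H) = id_op H \<and>
     (\<forall>n T. positive_matrix H n T \<longrightarrow> positive_matrix H n (\<lambda>i j. \<Phi> (T i j)))"


section \<open>The Hilbert space of square-summable sequences\<close>

typedef ell2 = "{x :: nat \<Rightarrow> complex. summable (\<lambda>n. (cmod (x n))\<^sup>2)}"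
  by (rule exI[of _ "\<lambda>_. 0"]) simp

lemma ell2_summable: "summable (\<lambda>n. (cmod (Rep_ell2 x n))\<^sup>2)"
  using Rep_ell2[of x] by simp

lemma ell2_Abs_inverse: "summable (\<lambda>n. (cmod (f n))\<^sup>2) \<Longrightarrow> Rep_ell2 (Abs_ell2 f) = f"
  by (simp add: Abs_ell2_inverse)

lemma ell2_eqI: "(\<And>n. Rep_ell2 x n = Rep_ell2 y n) \<Longrightarrow> x = y"
  by (meson Rep_ell2_inject ext)

lemma ell2_summable_add:
  assumes "summable (\<lambda>n. (cmod (f n))\<^sup>2)" "summable (\<lambda>n. (cmod (g n))\<^sup>2)"
  shows "summable (\<lambda>n. (cmod (f n + g n))\<^sup>2)"
proof (rule summable_comparison_test')
  show "summable (\<lambda>n. 2 * (cmod (f n))\<^sup>2 + 2 * (cmod (g n))\<^sup>2)"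
    using assms by (intro summable_add summable_mult)
  fix n
  have "(cmod (f n + g n))\<^sup>2 \<le> (cmod (f n) + cmod (g n))\<^sup>2"
    by (intro power_mono norm_triangle_ineq) auto
  also have "\<dots> \<le> 2 * (cmod (f n))\<^sup>2 + 2 * (cmod (g n))\<^sup>2"
    using zero_le_power2[of "cmod (f n) - cmod (g n)"]
    by (simp add: power2_eq_square algebra_simps)
  finally show "norm ((cmod (f n + g n))\<^sup>2) \<le> 2 * (cmod (f n))\<^sup>2 + 2 * (cmod (g n))\<^sup>2"
    by simp
qed

lemma ell2_summable_scale:
  assumes "summable (\<lambda>n. (cmod (f n))\<^sup>2)"
  shows "summable (\<lambda>n. (cmod (c * f n))\<^sup>2)"
  using summable_mult[OF assms, of "(cmod c)\<^sup>2"] by (simp add: norm_mult power_mult_distrib)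

lemma ell2_summable_inner:
  assumes "summable (\<lambda>n. (cmod (f n))\<^sup>2)" "summable (\<lambda>n. (cmod (g n))\<^sup>2)"
  shows "summable (\<lambda>n. f n * cnj (g n))"
proof (rule summable_comparison_test')
  show "summable (\<lambda>n. (cmod (f n))\<^sup>2 + (cmod (g n))\<^sup>2)"
    using assms by (intro summable_add)
  fix n
  have "0 \<le> cmod (f n) * cmod (g n)" by simp
  then have "cmod (f n) * cmod (g n) \<le> (cmod (f n))\<^sup>2 + (cmod (g n))\<^sup>2"
    using sum_squares_bound[of "cmod (f n)" "cmod (g n)"] by linarith
  then show "norm (f n * cnj (g n)) \<le> (cmod (f n))\<^sup>2 + (cmod (g n))\<^sup>2"
    by (simp add: norm_mult)
qed

instantiation ell2 :: complex_vector
begin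

definition "0 = Abs_ell2 (\<lambda>_. 0)"
definition "x + y = Abs_ell2 (\<lambda>n. Rep_ell2 x n + Rep_ell2 y n)"
definition "- x = Abs_ell2 (\<lambda>n. - Rep_ell2 x n)"
definition "x - y = Abs_ell2 (\<lambda>n. Rep_ell2 x n - Rep_ell2 y n)"
definition "r *\<^sub>R x = Abs_ell2 (\<lambda>n. complex_of_real r * Rep_ell2 x n)"
definition "c *\<^sub>C x = Abs_ell2 (\<lambda>n. c * Rep_ell2 x n)"

lemma Rep_ell2_zero: "Rep_ell2 0 n = 0"
  by (simp add: zero_ell2_def ell2_Abs_inverse)

lemma Rep_ell2_add: "Rep_ell2 (x + y) n = Rep_ell2 x n + Rep_ell2 y n"
  by (simp add: plus_ell2_def ell2_Abs_inverse ell2_summable_add ell2_summable)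

lemma Rep_ell2_uminus: "Rep_ell2 (- x) n = - Rep_ell2 x n"
  by (simp add: uminus_ell2_def ell2_Abs_inverse ell2_summable)

lemma Rep_ell2_diff: "Rep_ell2 (x - y) n = Rep_ell2 x n - Rep_ell2 y n"
  using ell2_summable_add[OF ell2_summable[of x] ell2_summable[of "- y"]]
  by (simp add: minus_ell2_def ell2_Abs_inverse Rep_ell2_uminus)

lemma Rep_ell2_scaleR: "Rep_ell2 (r *\<^sub>R x) n = complex_of_real r * Rep_ell2 x n"
  by (simp add: scaleR_ell2_def ell2_Abs_inverse ell2_summable_scale ell2_summable)

lemma Rep_ell2_scaleC: "Rep_ell2 (c *\<^sub>C x) n = c * Rep_ell2 x n"
  by (simp add: scaleC_ell2_def ell2_Abs_inverse ell2_summable_scale ell2_summable)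

lemmas Rep_ell2_simps =
  Rep_ell2_zero Rep_ell2_add Rep_ell2_uminus Rep_ell2_diff Rep_ell2_scaleR Rep_ell2_scaleC

instance
  by standard (rule ell2_eqI; simp add: Rep_ell2_simps algebra_simps)+

end

instantiation ell2 :: complex_inner
begin

definition "norm x = sqrt (\<Sum>n. (cmod (Rep_ell2 x n))\<^sup>2)"
definition "cinner x y = (\<Sum>n. Rep_ell2 x n * cnj (Rep_ell2 y n))"
definition "dist x y = norm (x - y)" for x y :: ell2
definition "sgn x = x /\<^sub>R norm x" for x :: ell2
definition [code del]:
  "(uniformity :: (ell2 \<times> ell2) filter) = (INF e\<in>{0<..}. principal {(x, y). dist x y < e})"
definition [code del]:
  "open (U :: ell2 set) \<longleftrightarrow> (\<forall>x\<in>U. eventually (\<lambda>(x', y). x' = x \<longrightarrow> y \<in> U) uniformity)"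

lemma ell2_norm_squared: "(norm x)\<^sup>2 = (\<Sum>n. (cmod (Rep_ell2 x n))\<^sup>2)" for x :: ell2
  by (simp add: norm_ell2_def suminf_nonneg ell2_summable)

lemma ell2_L2_set_le: "L2_set (\<lambda>n. cmod (Rep_ell2 x n)) {..<N} \<le> norm x"
  unfolding norm_ell2_def L2_set_def
  by (intro real_sqrt_le_mono sum_le_suminf ell2_summable) auto

lemma ell2_norm_leI:
  fixes x :: ell2
  assumes "\<And>N. L2_set (\<lambda>n. cmod (Rep_ell2 x n)) {..<N} \<le> C"
  shows "norm x \<le> C"
proof -
  have C: "0 \<le> C" using assms[of 0] by simp
  have "(\<Sum>n. (cmod (Rep_ell2 x n))\<^sup>2) \<le> C\<^sup>2"
    using assms by (intro suminf_le_const ell2_summable) (auto simp: L2_set_def intro: sqrt_le_D)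
  then have "sqrt (\<Sum>n. (cmod (Rep_ell2 x n))\<^sup>2) \<le> sqrt (C\<^sup>2)"
    by (rule real_sqrt_le_mono)
  then show ?thesis using C by (simp add: norm_ell2_def)
qed

instance
proof
  fix x y z :: ell2 and r :: real and c :: complex
  show "dist x y = norm (x - y)" by (rule dist_ell2_def)
  show "sgn x = x /\<^sub>R norm x" by (rule sgn_ell2_def)
  show "(uniformity :: (ell2 \<times> ell2) filter) = (INF e\<in>{0<..}. principal {(x, y). dist x y < e})"
    by (rule uniformity_ell2_def)
  show "open U \<longleftrightarrow> (\<forall>x\<in>U. eventually (\<lambda>(x', y). x' = x \<longrightarrow> y \<in> U) uniformity)" for U :: "ell2 set"
    by (rule open_ell2_def)
  show "norm x = 0 \<longleftrightarrow> x = 0"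
  proof
    assume "norm x = 0"
    then have "\<forall>n. (cmod (Rep_ell2 x n))\<^sup>2 = 0"
      by (simp add: norm_ell2_def suminf_eq_zero_iff[OF ell2_summable])
    then show "x = 0" by (intro ell2_eqI) (simp add: Rep_ell2_zero)
  qed (simp add: norm_ell2_def Rep_ell2_zero)
  show "norm (x + y) \<le> norm x + norm y"
  proof (rule ell2_norm_leI)
    fix N
    have "L2_set (\<lambda>n. cmod (Rep_ell2 (x + y) n)) {..<N}
        \<le> L2_set (\<lambda>n. cmod (Rep_ell2 x n) + cmod (Rep_ell2 y n)) {..<N}"
      by (intro L2_set_mono) (auto simp: Rep_ell2_add norm_triangle_ineq)
    also have "\<dots> \<le> L2_set (\<lambda>n. cmod (Rep_ell2 x n)) {..<N} + L2_set (\<lambda>n. cmod (Rep_ell2 y n)) {..<N}"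
      by (rule L2_set_triangle_ineq)
    also have "\<dots> \<le> norm x + norm y"
      by (intro add_mono ell2_L2_set_le)
    finally show "L2_set (\<lambda>n. cmod (Rep_ell2 (x + y) n)) {..<N} \<le> norm x + norm y" .
  qed
  show nC: "norm (c *\<^sub>C x) = cmod c * norm x" for c
    by (simp add: norm_ell2_def Rep_ell2_scaleC norm_mult power_mult_distrib
        suminf_mult ell2_summable real_sqrt_mult)
  show "norm (r *\<^sub>R x) = \<bar>r\<bar> * norm x"
    by (simp add: scaleR_scaleC nC)
  have s: "summable (\<lambda>n. Rep_ell2 x n * cnj (Rep_ell2 y n))" for x y
    by (intro ell2_summable_inner ell2_summable)
  show "cinner x y = cnj (cinner y x)"
  proof -
    have "(\<lambda>n. cnj (Rep_ell2 y n * cnj (Rep_ell2 x n))) sums cnj (cinner y x)"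
      unfolding cinner_ell2_def using summable_sums[OF s[of y x]] by (simp only: sums_cnj)
    then show ?thesis
      unfolding cinner_ell2_def[of x y] by (simp add: mult.commute sums_unique[symmetric])
  qed
  show "cinner (x + y) z = cinner x z + cinner y z"
    unfolding cinner_ell2_def by (simp add: Rep_ell2_add distrib_right suminf_add[OF s s])
  show "cinner (c *\<^sub>C x) y = c * cinner x y"
    unfolding cinner_ell2_def by (simp add: Rep_ell2_scaleC mult.assoc suminf_mult[OF s])
  show "cinner x x = complex_of_real ((norm x)\<^sup>2)"
    unfolding cinner_ell2_def ell2_norm_squared
    by (simp add: suminf_of_real[OF ell2_summable] complex_norm_square[symmetric])
qed

end

instance ell2 :: chilbert_space
proof
  fix X :: "nat \<Rightarrow> ell2"
  assume X: "Cauchy X"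
  have coord: "cmod (Rep_ell2 x n) \<le> norm x" for x n
    using member_le_L2_set[of "{..<Suc n}" n "\<lambda>n. cmod (Rep_ell2 x n)"] ell2_L2_set_le[of x "Suc n"]
    by simp
  have "Cauchy (\<lambda>m. Rep_ell2 (X m) n)" for n
  proof (rule metric_CauchyI)
    fix e :: real assume "0 < e"
    then obtain M where M: "\<forall>m\<ge>M. \<forall>k\<ge>M. dist (X m) (X k) < e"
      using metric_CauchyD[OF X] by blast
    have "dist (Rep_ell2 (X m) n) (Rep_ell2 (X k) n) < e" if "m \<ge> M" "k \<ge> M" for m k
      using M[rule_format, OF that] coord[of "X m - X k" n]
      by (simp add: dist_norm Rep_ell2_diff)
    then show "\<exists>M. \<forall>m\<ge>M. \<forall>k\<ge>M. dist (Rep_ell2 (X m) n) (Rep_ell2 (X k) n) < e" by blast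
  qed
  then have "\<forall>n. \<exists>l. (\<lambda>m. Rep_ell2 (X m) n) \<longlonglongrightarrow> l"
    by (simp add: Cauchy_convergent_iff convergent_def)
  then obtain f where f: "\<And>n. (\<lambda>m. Rep_ell2 (X m) n) \<longlonglongrightarrow> f n" by metis
  have bound: "L2_set (\<lambda>n. cmod (Rep_ell2 (X m) n - f n)) {..<N} \<le> e"
    if "\<forall>k\<ge>M. dist (X m) (X k) < e" for m M e N
  proof (rule LIMSEQ_le_const2)
    show "(\<lambda>k. L2_set (\<lambda>n. cmod (Rep_ell2 (X m) n - Rep_ell2 (X k) n)) {..<N})
        \<longlonglongrightarrow> L2_set (\<lambda>n. cmod (Rep_ell2 (X m) n - f n)) {..<N}"
      unfolding L2_set_def by (intro tendsto_intros f)
    show "\<exists>M. \<forall>k\<ge>M. L2_set (\<lambda>n. cmod (Rep_ell2 (X m) n - Rep_ell2 (X k) n)) {..<N} \<le> e"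
    proof (intro exI[of _ M] allI impI)
      fix k assume "k \<ge> M"
      then have "norm (X m - X k) < e" using that by (simp add: dist_norm)
      then show "L2_set (\<lambda>n. cmod (Rep_ell2 (X m) n - Rep_ell2 (X k) n)) {..<N} \<le> e"
        using ell2_L2_set_le[of "X m - X k" N] by (simp add: Rep_ell2_diff)
    qed
  qed
  have "summable (\<lambda>n. (cmod (f n))\<^sup>2)"
  proof -
    obtain M where M: "\<forall>m\<ge>M. \<forall>k\<ge>M. dist (X m) (X k) < 1"
      using metric_CauchyD[OF X, of 1] by auto
    have "(\<Sum>n<N. (cmod (Rep_ell2 (X M) n - f n))\<^sup>2) \<le> 1" for N
      using bound[of M M 1 N] M sqrt_le_D by (fastforce simp: L2_set_def)
    then have "summable (\<lambda>n. (cmod (Rep_ell2 (X M) n - f n))\<^sup>2)"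
      by (intro summableI_nonneg_bounded) auto
    from ell2_summable_add[OF ell2_summable_scale[OF this, of "-1"] ell2_summable[of "X M"]]
    show ?thesis by simp
  qed
  then have Rf: "Rep_ell2 (Abs_ell2 f) = f" by (rule ell2_Abs_inverse)
  have "X \<longlonglongrightarrow> Abs_ell2 f"
  proof (rule metric_LIMSEQ_I)
    fix e :: real assume "0 < e"
    then obtain M where M: "\<forall>m\<ge>M. \<forall>k\<ge>M. dist (X m) (X k) < e / 2"
      using metric_CauchyD[OF X, of "e / 2"] by auto
    have "dist (X m) (Abs_ell2 f) < e" if "m \<ge> M" for m
    proof -
      have "norm (X m - Abs_ell2 f) \<le> e / 2"
        using bound[of M m "e / 2"] M that by (intro ell2_norm_leI) (simp add: Rep_ell2_diff Rf)
      then show ?thesis using \<open>0 < e\<close> by (simp add: dist_norm)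
    qed
    then show "\<exists>M. \<forall>m\<ge>M. dist (X m) (Abs_ell2 f) < e" by blast
  qed
  then show "convergent X" by (rule convergentI)
qed


section \<open>Hyperrigidity\<close>

text \<open>The quantification over all separable Hilbert spaces is expressed by letting \<open>H\<close> range over
  the closed subspaces of \<open>\<ell>\<^sup>2\<close>: all of these are separable, every separable Hilbert space (of
  finite or infinite dimension) is unitarily equivalent to one of them, and the condition on \<open>H\<close>
  is invariant under unitary equivalence.\<close>

definition hyperrigid :: "'a::unital_cstar_algebra set \<Rightarrow> bool" where
  "hyperrigid G \<longleftrightarrow> countable G \<and> generates G \<and>
     (\<forall>(H :: ell2 set) \<pi> \<Phi>.
        separable_hilbert H \<and> faithful_rep H \<pi> \<and> (\<forall>k::nat. ucp_map H (\<Phi> k)) \<and>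
        (\<forall>g\<in>G. (\<lambda>k. opnorm H (\<lambda>x. \<Phi> k (\<pi> g) x - \<pi> g x)) \<longlonglongrightarrow> 0) \<longrightarrow>
        (\<forall>a. (\<lambda>k. opnorm H (\<lambda>x. \<Phi> k (\<pi> a) x - \<pi> a x)) \<longlonglongrightarrow> 0))"

end

theory Submission
  imports Defs
begin

text \<open>
  Write \<open>\<triangle> = I - R\<^sup>*R\<close>. Since \<open>chi\<close> vanishes on \<open>G\<close>, the unital completely positive map
  \<open>a \<mapsto> R\<^sup>*\<rho>(a)R + chi(a)\<triangle>\<close> agrees with \<open>\<pi>\<close> on \<open>G\<close>, and hyperrigidity forces it to agree with \<open>\<pi>\<close>
  everywhere. With \<open>J\<^sup>*J = \<triangle>\<close> the operator \<open>V = (R, J)\<close> is an isometry for which this map is the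
  compression of the representation \<open>\<rho> \<oplus> chi\<close> to the range of \<open>V\<close>. A compression that is multiplicative
  comes from an intertwining isometry, so one obtains (\<open>contraction_intertwines\<close>)

    \<open>\<rho>(a)R = R\<pi>(a)\<close> and \<open>\<triangle>\<pi>(a) = chi(a)\<triangle>\<close>.

  Taking adjoints in the second relation shows that the range of \<open>\<triangle>\<close> lies in the character space
  \<open>M\<close> of \<open>\<pi>\<close>; hence \<open>\<triangle>\<close> vanishes on the complement of \<open>M\<close>, where \<open>R\<close> is therefore isometric. The
  first relation shows that the closed spans over \<open>\<rho>(a)\<close> in the statement are the closures of \<open>R(H)\<close> and
  of \<open>R(M)\<close>. In particular \<open>R\<close> has dense range, which makes \<open>R\<close> unitary between the complements of \<open>M\<close>
  and of \<open>R(M)\<close> and makes all three defect spaces zero. On \<open>M\<close> and on the closure of \<open>R(M)\<close> the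
  representations act by scalars, so all closed subspaces of these spaces reduce them. What remains is
  the geometry of orthogonal complements.

  Hyperrigidity speaks of completely positive maps on the operators of a Hilbert space inside \<open>\<ell>\<^sup>2\<close> that
  carries a faithful representation. The unique extension property is deduced from it in
  \<open>hyperrigid_unique_extension\<close>, by an explicit map of the form \<open>T \<mapsto> A\<^sup>*TA + B\<^sup>*TB\<close>, after a transport
  to \<open>\<ell>\<^sup>2\<close>. This uses that a faithful representation on a separable Hilbert space exists at all
  (\<open>faithful_representation_exists\<close>), the Gelfand-Naimark theorem for separable algebras. Its core is
  that \<open>a\<^sup>*a\<close> is positive (\<open>positive_star_mult\<close>). Positivity of a self-adjoint \<open>h\<close> is expressed by
  \<open>norm (t - h) \<le> t\<close> for some \<open>t \<ge> 0\<close>, and its square root is the limit of an iteration and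
  therefore commutes with everything that commutes with \<open>h\<close>. The Hahn-Banach theorem then yields a
  faithful positive functional, and the GNS construction the representation.

  All Hilbert spaces are embedded into \<open>\<ell>\<^sup>2\<close> by one and the same tool, the Gram-Schmidt process for
  a semidefinite form (\<open>embedding_of_bounded_form\<close>). It gives the GNS space, the transport of
  separable Hilbert spaces, and the operator \<open>J\<close>, which replaces the square root of \<open>\<triangle>\<close>.
\<close>

section \<open>Complex vector spaces and inner products\<close>

lemma scaleC_zero_left [simp]: "0 *\<^sub>C (x::'a::complex_vector) = 0"
  using scaleR_scaleC[of 0 x] by simp

lemma scaleC_zero_right [simp]: "c *\<^sub>C (0::'a::complex_vector) = 0"
  using scaleC_add_right[of c "0::'a" 0] by simp

lemma scaleC_minus1_left: "(-1) *\<^sub>C (x::'a::complex_vector) = - x"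
  using scaleR_scaleC[of "-1" x] by simp

lemma scaleC_minus_right: "c *\<^sub>C (- (x::'a::complex_vector)) = - (c *\<^sub>C x)"
  using scaleC_add_right[of c x "- x"] by (simp add: eq_neg_iff_add_eq_0 add.commute)

lemma scaleC_minus_left: "(- c) *\<^sub>C (x::'a::complex_vector) = - (c *\<^sub>C x)"
  using scaleC_add_left[of c "- c" x] by (simp add: eq_neg_iff_add_eq_0 add.commute)

lemma scaleC_diff_right: "c *\<^sub>C (x - (y::'a::complex_vector)) = c *\<^sub>C x - c *\<^sub>C y"
  using scaleC_add_right[of c x "- y"] by (simp add: scaleC_minus_right)

lemma scaleR_scaleC_commute: "r *\<^sub>R c *\<^sub>C (x::'a::complex_vector) = c *\<^sub>C r *\<^sub>R x"
  by (simp add: scaleR_scaleC scaleC_scaleC mult.commute)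

lemma bounded_bilinear_scaleC:
  "bounded_bilinear (\<lambda>c x. c *\<^sub>C (x::'a::complex_normed_vector))"
proof
  show "\<exists>K. \<forall>(a::complex) b::'a. norm (a *\<^sub>C b) \<le> norm a * norm b * K"
    by (rule exI[of _ 1]) (simp add: norm_scaleC)
qed (auto simp: scaleC_add_right scaleC_add_left scaleR_scaleC scaleC_scaleC mult.commute
    scaleR_conv_of_real)

lemmas continuous_on_scaleC [continuous_intros] =
  bounded_bilinear.continuous_on[OF bounded_bilinear_scaleC]

lemma cinner_add_right: "cinner (x::'a::complex_inner) (y + z) = cinner x y + cinner x z"
  by (metis cinner_add_left cinner_commute complex_cnj_add)

lemma cinner_scaleC_right: "cinner (x::'a::complex_inner) (c *\<^sub>C y) = cnj c * cinner x y"
  by (metis cinner_commute cinner_scaleC_left complex_cnj_mult)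

lemma cinner_zero_left [simp]: "cinner 0 (x::'a::complex_inner) = 0"
  using cinner_scaleC_left[of 0 0 x] by simp

lemma cinner_zero_right [simp]: "cinner (x::'a::complex_inner) 0 = 0"
  using cinner_scaleC_right[of x 0 0] by simp

lemma cinner_minus_left: "cinner (- x) (y::'a::complex_inner) = - cinner x y"
  using cinner_scaleC_left[of "-1" x y] by (simp add: scaleC_minus1_left)

lemma cinner_minus_right: "cinner x (- (y::'a::complex_inner)) = - cinner x y"
  using cinner_scaleC_right[of x "-1" y] by (simp add: scaleC_minus1_left)

lemma cinner_diff_left: "cinner (x - y) (z::'a::complex_inner) = cinner x z - cinner y z"
  using cinner_add_left[of x "- y" z] by (simp add: cinner_minus_left)

lemma cinner_diff_right: "cinner (x::'a::complex_inner) (y - z) = cinner x y - cinner x z"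
  using cinner_add_right[of x y "- z"] by (simp add: cinner_minus_right)

lemma cinner_scaleR_left: "cinner (r *\<^sub>R x) (y::'a::complex_inner) = r *\<^sub>R cinner x y"
  by (simp add: scaleR_scaleC cinner_scaleC_left scaleR_conv_of_real)

lemma cinner_scaleR_right: "cinner (x::'a::complex_inner) (r *\<^sub>R y) = r *\<^sub>R cinner x y"
  by (simp add: scaleR_scaleC cinner_scaleC_right scaleR_conv_of_real)

lemma cinner_eq_zero_commute: "cinner x (y::'a::complex_inner) = 0 \<longleftrightarrow> cinner y x = 0"
  by (metis cinner_commute complex_cnj_zero_iff)

lemma cinner_self_eq_zero [simp]: "cinner x x = 0 \<longleftrightarrow> (x::'a::complex_inner) = 0"
  by (simp add: cinner_self)

lemma norm_add_squared:
  "(norm (x + (y::'a::complex_inner)))\<^sup>2 = (norm x)\<^sup>2 + 2 * Re (cinner x y) + (norm y)\<^sup>2"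
proof -
  have "complex_of_real ((norm (x + y))\<^sup>2)
      = complex_of_real ((norm x)\<^sup>2) + (cinner x y + cnj (cinner x y)) + complex_of_real ((norm y)\<^sup>2)"
    using cinner_commute[of y x] by (simp only: cinner_self[symmetric] cinner_add_left cinner_add_right ac_simps)
  then have "Re (complex_of_real ((norm (x + y))\<^sup>2))
      = Re (complex_of_real ((norm x)\<^sup>2) + (cinner x y + cnj (cinner x y)) + complex_of_real ((norm y)\<^sup>2))"
    by (rule arg_cong)
  then show ?thesis by simp
qed

lemma norm_diff_squared:
  "(norm (x - (y::'a::complex_inner)))\<^sup>2 = (norm x)\<^sup>2 - 2 * Re (cinner x y) + (norm y)\<^sup>2"
  using norm_add_squared[of x "- y"] by (simp add: cinner_minus_right)

lemma complex_cauchy_schwarz: "cmod (cinner x (y::'a::complex_inner)) \<le> norm x * norm y"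
proof -
  have re: "Re (cinner u y) \<le> norm u * norm y" for u
  proof -
    have "(norm (u + y))\<^sup>2 \<le> (norm u + norm y)\<^sup>2"
      by (intro power_mono norm_triangle_ineq) auto
    then show ?thesis by (simp add: norm_add_squared power2_sum)
  qed
  \<comment> \<open>Rotate \<open>x\<close> so that the inner product becomes a nonnegative real.\<close>
  obtain c where c: "cmod c = 1" "c * cinner x y = complex_of_real (cmod (cinner x y))"
  proof (cases "cinner x y = 0")
    case True
    then show ?thesis using that[of 1] by simp
  next
    case False
    let ?z = "cinner x y"
    have "cmod (cnj ?z / cmod ?z) = 1" using False by (simp add: norm_divide)
    moreover have "cnj ?z / cmod ?z * ?z = complex_of_real (cmod ?z)"
      using False complex_norm_square[of ?z] by (simp add: field_simps power2_eq_square)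
    ultimately show ?thesis by (rule that)
  qed
  have "cmod (cinner x y) = Re (cinner (c *\<^sub>C x) y)"
    using c(2) by (simp add: cinner_scaleC_left)
  also have "\<dots> \<le> norm (c *\<^sub>C x) * norm y" by (rule re)
  finally show ?thesis using c(1) by (simp add: norm_scaleC)
qed

lemma bounded_bilinear_cinner:
  "bounded_bilinear (cinner :: 'a::complex_inner \<Rightarrow> 'a \<Rightarrow> complex)"
proof
  show "\<exists>K. \<forall>a b::'a. norm (cinner a b) \<le> norm a * norm b * K"
    by (rule exI[of _ 1]) (simp add: complex_cauchy_schwarz)
qed (auto simp: cinner_add_left cinner_add_right cinner_scaleR_left cinner_scaleR_right)

lemmas continuous_on_cinner [continuous_intros] =
  bounded_bilinear.continuous_on[OF bounded_bilinear_cinner]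


section \<open>Subspaces, orthogonal complements and projections\<close>

lemma csubspace_zero: "csubspace M \<Longrightarrow> 0 \<in> M"
  and csubspace_add: "csubspace M \<Longrightarrow> x \<in> M \<Longrightarrow> y \<in> M \<Longrightarrow> x + y \<in> M"
  and csubspace_scaleC: "csubspace M \<Longrightarrow> x \<in> M \<Longrightarrow> c *\<^sub>C x \<in> M"
  by (auto simp: csubspace_def)

lemma csubspace_minus: "csubspace M \<Longrightarrow> x \<in> M \<Longrightarrow> - x \<in> M"
  using csubspace_scaleC[of M x "-1"] by (simp add: scaleC_minus1_left)

lemma csubspace_diff: "csubspace M \<Longrightarrow> x \<in> M \<Longrightarrow> y \<in> M \<Longrightarrow> x - y \<in> M"
  using csubspace_add[of M x "- y"] csubspace_minus[of M y] by simp

lemma csubspace_scaleR: "csubspace M \<Longrightarrow> x \<in> M \<Longrightarrow> r *\<^sub>R x \<in> M"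
  by (simp add: scaleR_scaleC csubspace_scaleC)

lemma csubspace_sum: "csubspace M \<Longrightarrow> (\<And>i. i \<in> I \<Longrightarrow> f i \<in> M) \<Longrightarrow> (\<Sum>i\<in>I. f i) \<in> M"
  by (induction I rule: infinite_finite_induct) (auto simp: csubspace_zero csubspace_add)

lemma csubspace_UNIV: "csubspace UNIV"
  by (simp add: csubspace_def)

lemma csubspace_Int: "csubspace M \<Longrightarrow> csubspace N \<Longrightarrow> csubspace (M \<inter> N)"
  by (simp add: csubspace_def)

lemma csubspace_linear_image:
  assumes M: "csubspace M" and add: "\<And>x y. x \<in> M \<Longrightarrow> y \<in> M \<Longrightarrow> T (x + y) = T x + T y"
    and scale: "\<And>c x. x \<in> M \<Longrightarrow> T (c *\<^sub>C x) = c *\<^sub>C T x"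
  shows "csubspace (T ` M)"
  unfolding csubspace_def
proof (intro conjI ballI allI)
  have "T 0 = 0" using scale[of 0 0] csubspace_zero[OF M] by simp
  then show "0 \<in> T ` M" using csubspace_zero[OF M] by (metis imageI)
qed (auto simp: add[symmetric] scale[symmetric] csubspace_add[OF M] csubspace_scaleC[OF M])

lemma csubspace_closure:
  assumes "csubspace (M :: 'a::complex_normed_vector set)"
  shows "csubspace (closure M)"
  unfolding csubspace_def
proof (intro conjI ballI allI)
  show "0 \<in> closure M" using assms closure_subset csubspace_zero by blast
next
  fix x y assume "x \<in> closure M" "y \<in> closure M"
  then have "(x, y) \<in> closure (M \<times> M)" by (simp add: closure_Times)
  moreover have "(\<lambda>(x, y). x + y) ` closure (M \<times> M) \<subseteq> closure M"
    using subsetD[OF closure_subset csubspace_add[OF assms]]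
    by (intro image_closure_subset) (auto intro!: continuous_intros simp: case_prod_unfold)
  ultimately show "x + y \<in> closure M" by auto
next
  fix c x assume x: "x \<in> closure M"
  have "(\<lambda>x. c *\<^sub>C x) ` closure M \<subseteq> closure M"
    using subsetD[OF closure_subset csubspace_scaleC[OF assms]]
    by (intro image_closure_subset) (auto intro!: continuous_intros)
  then show "c *\<^sub>C x \<in> closure M" using x by blast
qed

lemma hilbert_csubspace: "hilbert H \<Longrightarrow> csubspace H"
  and hilbert_closed: "hilbert H \<Longrightarrow> closed H"
  by (simp_all add: hilbert_def)

lemma hilbert_closure: "csubspace M \<Longrightarrow> hilbert (closure M)"
  by (simp add: hilbert_def csubspace_closure)

lemma hilbert_Int: "hilbert M \<Longrightarrow> hilbert N \<Longrightarrow> hilbert (M \<inter> N)"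
  by (simp add: hilbert_def csubspace_Int closed_Int)

lemma closed_cspan_least: "S \<subseteq> M \<Longrightarrow> hilbert M \<Longrightarrow> closed_cspan S \<subseteq> M"
  unfolding closed_cspan_def by (intro closure_minimal hull_minimal) (auto simp: hilbert_def)

lemma csubspace_cspan: "csubspace (csubspace hull S)"
  by (rule hull_in) (auto simp: csubspace_def)

lemma hilbert_closed_cspan: "hilbert (closed_cspan S)"
  unfolding closed_cspan_def by (rule hilbert_closure[OF csubspace_cspan])

lemma subset_closed_cspan: "S \<subseteq> closed_cspan S"
  unfolding closed_cspan_def using hull_subset closure_subset by fast

lemma hilbert_ortho_compl:
  assumes "hilbert H"
  shows "hilbert (ortho_compl H M)"
proof -
  have "ortho_compl H M = H \<inter> (\<Inter>y\<in>M. {x. cinner x y = 0})"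
    by (auto simp: ortho_compl_def)
  moreover have "closed {x. cinner x y = 0}" for y :: 'a
    by (intro closed_Collect_eq continuous_intros)
  ultimately have "closed (ortho_compl H M)"
    using assms by (auto simp: hilbert_def intro!: closed_Int closed_INT)
  moreover have "csubspace (ortho_compl H M)"
    using assms
    by (auto simp: csubspace_def ortho_compl_def hilbert_def cinner_add_left cinner_scaleC_left)
  ultimately show ?thesis by (simp add: hilbert_def)
qed

lemma ortho_compl_closure: "ortho_compl H (closure M) = ortho_compl H M"
proof -
  have "cinner x y = 0" if "\<forall>y\<in>M. cinner x y = 0" "y \<in> closure M" for x y
  proof -
    have "closed {y. cinner x y = 0}" by (intro closed_Collect_eq continuous_intros)
    then have "closure M \<subseteq> {y. cinner x y = 0}"
      using that(1) by (intro closure_minimal) auto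
    then show ?thesis using that(2) by auto
  qed
  then show ?thesis unfolding ortho_compl_def using closure_subset by fast
qed

text \<open>The orthogonal projection onto a complete subspace exists: by the parallelogram law,
  a sequence whose distances to \<open>x\<close> tend to the infimum is Cauchy.\<close>

lemma projection_exists:
  fixes x :: "'a::chilbert_space"
  assumes N: "hilbert N"
  obtains p where "p \<in> N" "\<And>y. y \<in> N \<Longrightarrow> cinner (x - p) y = 0"
proof -
  have sub: "csubspace N" and cl: "closed N" using N by (auto simp: hilbert_def)
  have ne: "N \<noteq> {}" using csubspace_zero[OF sub] by auto
  define d where "d = infdist x N"
  have d0: "0 \<le> d" by (simp add: d_def infdist_nonneg)
  have dle: "d \<le> norm (x - p)" if "p \<in> N" for p
    unfolding d_def dist_norm[symmetric] using that by (rule infdist_le)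
  have "\<exists>p\<in>N. norm (x - p) < d + inverse (real (Suc n))" for n
  proof -
    have "infdist x N < d + inverse (real (Suc n))" by (simp add: d_def)
    then show ?thesis
      using ne unfolding infdist_notempty[OF ne]
      by (subst (asm) cINF_less_iff) (auto simp: dist_norm intro: bdd_belowI[of _ 0])
  qed
  then obtain p where p: "\<And>n. p n \<in> N" "\<And>n. norm (x - p n) < d + inverse (real (Suc n))"
    by metis
  have lim: "(\<lambda>n. norm (x - p n)) \<longlonglongrightarrow> d"
  proof (rule tendsto_sandwich[of "\<lambda>_. d" _ _ "\<lambda>n. d + inverse (real (Suc n))"])
    show "(\<lambda>n. d + inverse (real (Suc n))) \<longlonglongrightarrow> d"
      using tendsto_add[OF tendsto_const LIMSEQ_inverse_real_of_nat] by simp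
  qed (use p dle in \<open>auto intro: less_imp_le always_eventually\<close>)
  have par: "(norm (p m - p n))\<^sup>2 \<le> 2 * (norm (x - p m))\<^sup>2 + 2 * (norm (x - p n))\<^sup>2 - 4 * d\<^sup>2" for m n
  proof -
    have "(1/2) *\<^sub>R (p m + p n) \<in> N"
      using p(1) sub by (intro csubspace_scaleR csubspace_add) auto
    then have "d \<le> norm (x - (1/2) *\<^sub>R (p m + p n))" by (rule dle)
    then have "2 * d \<le> norm (2 *\<^sub>R (x - (1/2) *\<^sub>R (p m + p n)))" by simp
    also have "2 *\<^sub>R (x - (1/2) *\<^sub>R (p m + p n)) = (x - p m) + (x - p n)"
      by (simp add: algebra_simps scaleR_2)
    finally have "(2 * d)\<^sup>2 \<le> (norm ((x - p m) + (x - p n)))\<^sup>2"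
      using d0 by (intro power_mono) auto
    moreover have "(norm (p m - p n))\<^sup>2 = (norm ((x - p n) - (x - p m)))\<^sup>2" by simp
    moreover have "Re (cinner (x - p n) (x - p m)) = Re (cinner (x - p m) (x - p n))"
      by (subst cinner_commute) simp
    ultimately show ?thesis
      unfolding norm_add_squared norm_diff_squared[of "x - p n"] by (simp add: power_mult_distrib)
  qed
  have "Cauchy p"
  proof (rule metric_CauchyI)
    fix e :: real assume e: "0 < e"
    have "(\<lambda>n. (norm (x - p n))\<^sup>2) \<longlonglongrightarrow> d\<^sup>2" by (intro tendsto_power lim)
    then have "eventually (\<lambda>n. (norm (x - p n))\<^sup>2 < d\<^sup>2 + e\<^sup>2 / 4) sequentially"
      by (rule order_tendstoD(2)) (use e in simp)
    then obtain M where M: "\<And>n. n \<ge> M \<Longrightarrow> (norm (x - p n))\<^sup>2 < d\<^sup>2 + e\<^sup>2 / 4"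
      by (auto simp: eventually_sequentially)
    have "dist (p m) (p n) < e" if "m \<ge> M" "n \<ge> M" for m n
    proof -
      have "(norm (p m - p n))\<^sup>2 < e\<^sup>2"
        using par[of m n] M[OF that(1)] M[OF that(2)] by linarith
      then show ?thesis using e by (simp add: dist_norm power2_less_imp_less)
    qed
    then show "\<exists>M. \<forall>m\<ge>M. \<forall>n\<ge>M. dist (p m) (p n) < e" by blast
  qed
  then obtain q where q: "p \<longlonglongrightarrow> q" by (auto simp: Cauchy_convergent_iff convergent_def)
  have qN: "q \<in> N" using cl p(1) q by (rule closed_sequentially)
  have qd: "norm (x - q) = d"
  proof (rule LIMSEQ_unique[OF _ lim])
    show "(\<lambda>n. norm (x - p n)) \<longlonglongrightarrow> norm (x - q)" by (intro tendsto_intros q)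
  qed
  have "cinner (x - q) y = 0" if y: "y \<in> N" for y
  proof (cases "y = 0")
    case False
    define c where "c = cinner (x - q) y / complex_of_real ((norm y)\<^sup>2)"
    have "q + c *\<^sub>C y \<in> N" using sub qN y by (intro csubspace_add csubspace_scaleC)
    then have "(norm (x - q))\<^sup>2 \<le> (norm ((x - q) - c *\<^sub>C y))\<^sup>2"
      using dle[of "q + c *\<^sub>C y"] d0 by (intro power_mono) (auto simp: qd algebra_simps)
    moreover have "Re (cnj c * cinner (x - q) y) = (cmod (cinner (x - q) y))\<^sup>2 / (norm y)\<^sup>2"
    proof -
      have "cnj c * cinner (x - q) y = complex_of_real ((cmod (cinner (x - q) y))\<^sup>2 / (norm y)\<^sup>2)"
        unfolding c_def using complex_norm_square[of "cinner (x - q) y"]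
        by (simp add: mult.commute)
      then show ?thesis by simp
    qed
    moreover have "(norm (c *\<^sub>C y))\<^sup>2 = (cmod (cinner (x - q) y))\<^sup>2 / (norm y)\<^sup>2"
      using False by (simp add: c_def norm_scaleC norm_divide norm_mult field_simps power2_eq_square)
    ultimately have "(cmod (cinner (x - q) y))\<^sup>2 / (norm y)\<^sup>2 \<le> 0"
      unfolding norm_diff_squared[of "x - q"] cinner_scaleC_right by linarith
    then show ?thesis using False by (simp add: divide_le_0_iff)
  qed simp
  then show ?thesis using that qN by blast
qed

lemma ortho_sum_ortho_compl:
  assumes H: "hilbert H" and N: "hilbert N" "N \<subseteq> H"
  shows "ortho_sum H (ortho_compl H N) N"
  unfolding ortho_sum_def
proof (intro conjI)
  show "H = {x + y |x y. x \<in> ortho_compl H N \<and> y \<in> N}"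
  proof (intro equalityI subsetI)
    fix x assume x: "x \<in> H"
    obtain p where p: "p \<in> N" "\<And>y. y \<in> N \<Longrightarrow> cinner (x - p) y = 0"
      using projection_exists[OF N(1)] by blast
    then have "x - p \<in> ortho_compl H N"
      using x N(2) csubspace_diff[OF hilbert_csubspace[OF H]] by (auto simp: ortho_compl_def)
    then show "x \<in> {x + y |x y. x \<in> ortho_compl H N \<and> y \<in> N}"
      using p(1) by (intro CollectI exI[of _ "x - p"] exI[of _ p]) auto
  qed (use N(2) csubspace_add[OF hilbert_csubspace[OF H]] in \<open>auto simp: ortho_compl_def\<close>)
qed (use assms hilbert_ortho_compl in \<open>auto simp: ortho_compl_def\<close>)

lemma ortho_compl_ortho_compl:
  assumes H: "hilbert H" and N: "hilbert N" "N \<subseteq> H"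
  shows "ortho_compl H (ortho_compl H N) = N"
proof
  show "N \<subseteq> ortho_compl H (ortho_compl H N)"
    using N(2) by (auto simp: ortho_compl_def cinner_eq_zero_commute)
  show "ortho_compl H (ortho_compl H N) \<subseteq> N"
  proof
    fix x assume x: "x \<in> ortho_compl H (ortho_compl H N)"
    then have "x \<in> H" by (simp add: ortho_compl_def)
    then obtain u p where up: "x = u + p" "u \<in> ortho_compl H N" "p \<in> N"
      using ortho_sum_ortho_compl[OF assms] unfolding ortho_sum_def by blast
    have "cinner u u = cinner x u - cinner p u" by (simp add: up(1) cinner_diff_left[symmetric])
    also have "\<dots> = 0"
      using x up by (auto simp: ortho_compl_def cinner_eq_zero_commute[of p u])
    finally show "x \<in> N" using up by simp
  qed
qed

lemma ortho_compl_trivial_imp_eq: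
  assumes "hilbert H" "hilbert N" "N \<subseteq> H" "ortho_compl H N \<subseteq> {0}"
  shows "N = H"
  using ortho_sum_ortho_compl[OF assms(1-3)] assms(3,4) unfolding ortho_sum_def by force


section \<open>Bounded operators and adjoints\<close>

lemma bounded_ops_maps: "T \<in> bounded_ops H K \<Longrightarrow> x \<in> H \<Longrightarrow> T x \<in> K"
  and bounded_ops_add: "T \<in> bounded_ops H K \<Longrightarrow> x \<in> H \<Longrightarrow> y \<in> H \<Longrightarrow> T (x + y) = T x + T y"
  and bounded_ops_scaleC: "T \<in> bounded_ops H K \<Longrightarrow> x \<in> H \<Longrightarrow> T (c *\<^sub>C x) = c *\<^sub>C T x"
  and bounded_ops_undefined: "T \<in> bounded_ops H K \<Longrightarrow> x \<notin> H \<Longrightarrow> T x = undefined"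
  by (auto simp: bounded_ops_def)

lemma bounded_ops_zero: "T \<in> bounded_ops H K \<Longrightarrow> 0 \<in> H \<Longrightarrow> T 0 = 0"
  using bounded_ops_scaleC[of T H K 0 0] by simp

lemma bounded_ops_diff:
  assumes "T \<in> bounded_ops H K" "csubspace H" "x \<in> H" "y \<in> H"
  shows "T (x - y) = T x - T y"
  using bounded_ops_add[OF assms(1,3) csubspace_minus[OF assms(2,4)]]
    bounded_ops_scaleC[OF assms(1,4), of "-1"] by (simp add: scaleC_minus1_left)

lemma bounded_ops_bound:
  assumes "T \<in> bounded_ops H K"
  obtains C where "C \<ge> 0" "\<And>x. x \<in> H \<Longrightarrow> norm (T x) \<le> C * norm x"
proof -
  obtain C where C: "\<forall>x\<in>H. norm (T x) \<le> C * norm x"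
    using assms by (auto simp: bounded_ops_def)
  have "norm (T x) \<le> max C 0 * norm x" if "x \<in> H" for x
    using C that mult_right_mono[of C "max C 0" "norm x"] by fastforce
  then show ?thesis using that[of "max C 0"] by auto
qed

lemma bounded_opsI:
  assumes "T \<in> extensional H" "\<And>x. x \<in> H \<Longrightarrow> T x \<in> K"
    "\<And>x y. x \<in> H \<Longrightarrow> y \<in> H \<Longrightarrow> T (x + y) = T x + T y"
    "\<And>c x. x \<in> H \<Longrightarrow> T (c *\<^sub>C x) = c *\<^sub>C T x"
    "\<And>x. x \<in> H \<Longrightarrow> norm (T x) \<le> C * norm x"
  shows "T \<in> bounded_ops H K"
  using assms unfolding bounded_ops_def PiE_def by blast

lemma bounded_ops_eqI:
  assumes "S \<in> bounded_ops H K" "T \<in> bounded_ops H K'" "\<And>x. x \<in> H \<Longrightarrow> S x = T x"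
  shows "S = T"
  using assms by (intro ext) (metis bounded_ops_undefined)

lemma bounded_ops_continuous:
  assumes T: "T \<in> bounded_ops H K" and H: "csubspace H"
  shows "continuous_on H T"
proof -
  obtain C where C: "C \<ge> 0" "\<And>x. x \<in> H \<Longrightarrow> norm (T x) \<le> C * norm x"
    using bounded_ops_bound[OF T] by blast
  have "C-lipschitz_on H T"
  proof (rule lipschitz_onI)
    fix x y assume "x \<in> H" "y \<in> H"
    then show "dist (T x) (T y) \<le> C * dist x y"
      using C(2)[of "x - y"] csubspace_diff[OF H] bounded_ops_diff[OF T H]
      by (simp add: dist_norm)
  qed (rule C(1))
  then show ?thesis by (rule lipschitz_on_continuous_on)
qed

lemma norm_le_opnorm:
  assumes H: "csubspace H" and scale: "\<And>c x. x \<in> H \<Longrightarrow> T (c *\<^sub>C x) = c *\<^sub>C T x"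
    and bound: "\<And>x. x \<in> H \<Longrightarrow> norm (T x) \<le> C * norm x" and x: "x \<in> H"
  shows "norm (T x) \<le> opnorm H T * norm x"
proof (cases "x = 0")
  case False
  have "bdd_above ((\<lambda>x. norm (T x)) ` {x \<in> H. norm x \<le> 1})"
  proof (rule bdd_aboveI2)
    fix y assume "y \<in> {x \<in> H. norm x \<le> 1}"
    then have "norm (T y) \<le> \<bar>C\<bar> * norm y" "norm y \<le> 1"
      using bound[of y] mult_right_mono[OF abs_ge_self[of C], of "norm y"] by auto
    then show "norm (T y) \<le> \<bar>C\<bar> * 1" by (metis abs_ge_zero mult_left_mono order_trans)
  qed
  then have "norm (T (complex_of_real (1 / norm x) *\<^sub>C x)) \<le> opnorm H T"
    unfolding opnorm_def
    by (rule cSUP_upper[rotated])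
      (use False csubspace_scaleC[OF H x] in \<open>simp add: norm_scaleC norm_divide\<close>)
  then show ?thesis using False by (simp add: scale[OF x] norm_scaleC norm_divide field_simps)
qed (use bound[OF x] in simp)

lemma restrict_bounded_ops:
  assumes "T \<in> bounded_ops H K" "csubspace M" "M \<subseteq> H" "T ` M \<subseteq> N"
  shows "restrict T M \<in> bounded_ops M N"
proof -
  obtain C where C: "C \<ge> 0" "\<And>x. x \<in> H \<Longrightarrow> norm (T x) \<le> C * norm x"
    using bounded_ops_bound[OF assms(1)] by blast
  show ?thesis
    using assms C(2) by (intro bounded_opsI[where C = C])
      (auto simp: csubspace_add csubspace_scaleC subset_iff bounded_ops_add bounded_ops_scaleC)
qed

lemma id_op_bounded_ops: "csubspace H \<Longrightarrow> id_op H \<in> bounded_ops H H"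
  by (rule bounded_opsI[where C = 1]) (auto simp: id_op_def csubspace_add csubspace_scaleC)

lemma comp_bounded_ops:
  assumes S: "S \<in> bounded_ops K L" and T: "T \<in> bounded_ops H K" and H: "csubspace H"
  shows "(\<lambda>x\<in>H. S (T x)) \<in> bounded_ops H L"
proof -
  obtain C where C: "C \<ge> 0" "\<And>x. x \<in> K \<Longrightarrow> norm (S x) \<le> C * norm x"
    using bounded_ops_bound[OF S] by blast
  obtain D where D: "D \<ge> 0" "\<And>x. x \<in> H \<Longrightarrow> norm (T x) \<le> D * norm x"
    using bounded_ops_bound[OF T] by blast
  have "norm (S (T x)) \<le> (C * D) * norm x" if "x \<in> H" for x
    using C(2)[OF bounded_ops_maps[OF T that]] mult_left_mono[OF D(2)[OF that] C(1)] by (simp add: mult.assoc)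
  then show ?thesis
    using assms by (intro bounded_opsI[where C = "C * D"])
      (auto simp: bounded_ops_maps csubspace_add csubspace_scaleC
        bounded_ops_add[OF T] bounded_ops_scaleC[OF T] bounded_ops_add[OF S] bounded_ops_scaleC[OF S])
qed

lemma add_bounded_ops:
  assumes S: "S \<in> bounded_ops H K" and T: "T \<in> bounded_ops H K" and H: "csubspace H" "csubspace K"
  shows "(\<lambda>x\<in>H. S x + T x) \<in> bounded_ops H K"
proof -
  obtain C where C: "C \<ge> 0" "\<And>x. x \<in> H \<Longrightarrow> norm (S x) \<le> C * norm x"
    using bounded_ops_bound[OF S] by blast
  obtain D where D: "D \<ge> 0" "\<And>x. x \<in> H \<Longrightarrow> norm (T x) \<le> D * norm x"
    using bounded_ops_bound[OF T] by blast
  have "norm (S x + T x) \<le> (C + D) * norm x" if "x \<in> H" for x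
    using norm_triangle_ineq[of "S x" "T x"] C(2)[OF that] D(2)[OF that] by (simp add: algebra_simps)
  then show ?thesis
    using assms by (intro bounded_opsI[where C = "C + D"])
      (auto simp: bounded_ops_maps csubspace_add csubspace_scaleC scaleC_add_right
        bounded_ops_add[OF T] bounded_ops_scaleC[OF T] bounded_ops_add[OF S] bounded_ops_scaleC[OF S])
qed

lemma scaleC_bounded_ops:
  assumes T: "T \<in> bounded_ops H K" and H: "csubspace H" "csubspace K"
  shows "(\<lambda>x\<in>H. c *\<^sub>C T x) \<in> bounded_ops H K"
proof -
  obtain D where D: "D \<ge> 0" "\<And>x. x \<in> H \<Longrightarrow> norm (T x) \<le> D * norm x"
    using bounded_ops_bound[OF T] by blast
  have "norm (c *\<^sub>C T x) \<le> (cmod c * D) * norm x" if "x \<in> H" for x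
    using mult_left_mono[OF D(2)[OF that], of "cmod c"] by (simp add: norm_scaleC mult.assoc)
  then show ?thesis
    using assms by (intro bounded_opsI[where C = "cmod c * D"])
      (auto simp: bounded_ops_maps csubspace_add csubspace_scaleC scaleC_add_right scaleC_scaleC mult.commute
        bounded_ops_add[OF T] bounded_ops_scaleC[OF T])
qed

text \<open>If \<open>\<phi> x0 \<noteq> 0\<close>, the component of \<open>x0\<close> orthogonal to the kernel of \<open>\<phi>\<close> is, up to a scalar, the
  representing vector.\<close>

lemma riesz_representation:
  fixes \<phi> :: "'h::chilbert_space \<Rightarrow> complex"
  assumes H: "hilbert H"
    and add: "\<And>x y. x \<in> H \<Longrightarrow> y \<in> H \<Longrightarrow> \<phi> (x + y) = \<phi> x + \<phi> y"
    and scale: "\<And>c x. x \<in> H \<Longrightarrow> \<phi> (c *\<^sub>C x) = c * \<phi> x"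
    and cont: "continuous_on H \<phi>"
  obtains z where "z \<in> H" "\<And>x. x \<in> H \<Longrightarrow> \<phi> x = cinner x z"
proof (cases "\<forall>x\<in>H. \<phi> x = 0")
  case True
  then show ?thesis using that[of 0] csubspace_zero[OF hilbert_csubspace[OF H]] by simp
next
  case False
  then obtain x0 where x0: "x0 \<in> H" "\<phi> x0 \<noteq> 0" by blast
  have sub: "csubspace H" using H by (rule hilbert_csubspace)
  have diff: "\<phi> (x - y) = \<phi> x - \<phi> y" if "x \<in> H" "y \<in> H" for x y
    using add[OF that(1) csubspace_minus[OF sub that(2)]] scale[OF that(2), of "-1"]
    by (simp add: scaleC_minus1_left)
  define N where "N = {x \<in> H. \<phi> x = 0}"
  have "closed N"
    unfolding N_def by (rule continuous_closed_preimage_constant[OF cont hilbert_closed[OF H]])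
  moreover have "csubspace N"
    unfolding csubspace_def N_def
    using add scale scale[of 0 0] csubspace_zero[OF sub] csubspace_add[OF sub] csubspace_scaleC[OF sub]
    by auto
  ultimately have "hilbert N" by (simp add: hilbert_def)
  then obtain p where p: "p \<in> N" "\<And>y. y \<in> N \<Longrightarrow> cinner (x0 - p) y = 0"
    using projection_exists by blast
  define e where "e = x0 - p"
  have e: "e \<in> H" "\<phi> e = \<phi> x0"
    using p(1) x0(1) csubspace_diff[OF sub] diff by (auto simp: e_def N_def)
  then have "e \<noteq> 0" using x0(2) scale[of 0 0] csubspace_zero[OF sub] by force
  define z where "z = (cnj (\<phi> e) / complex_of_real ((norm e)\<^sup>2)) *\<^sub>C e"
  have "\<phi> x = cinner x z" if x: "x \<in> H" for x
  proof -
    have "x - (\<phi> x / \<phi> e) *\<^sub>C e \<in> N"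
      using x e x0(2) csubspace_diff[OF sub] csubspace_scaleC[OF sub] diff scale
      by (auto simp: N_def)
    then have "cinner (x - (\<phi> x / \<phi> e) *\<^sub>C e) e = 0"
      using p(2) by (simp add: e_def[symmetric] cinner_eq_zero_commute)
    then have "cinner x e = \<phi> x / \<phi> e * complex_of_real ((norm e)\<^sup>2)"
      by (simp add: cinner_diff_left cinner_scaleC_left cinner_self)
    then show ?thesis using \<open>e \<noteq> 0\<close> e(2) x0(2) by (simp add: z_def cinner_scaleC_right)
  qed
  moreover have "z \<in> H" unfolding z_def using e(1) by (rule csubspace_scaleC[OF sub])
  ultimately show ?thesis using that by blast
qed

lemma cinner_right_eqI:
  assumes "csubspace H" "u \<in> H" "v \<in> H" "\<And>x. x \<in> H \<Longrightarrow> cinner x u = cinner x v"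
  shows "u = v"
  using assms(4)[OF csubspace_diff[OF assms(1-3)]] cinner_self_eq_zero[of "u - v"]
  by (simp add: cinner_diff_right)

lemma cinner_left_eqI:
  assumes "csubspace H" "u \<in> H" "v \<in> H" "\<And>x. x \<in> H \<Longrightarrow> cinner u x = cinner v x"
  shows "u = v"
  using assms(4)[OF csubspace_diff[OF assms(1-3)]] cinner_self_eq_zero[of "u - v"]
  by (simp add: cinner_diff_left)

lemma cinner_left_eqI_closure:
  fixes D :: "'h::chilbert_space set"
  assumes D: "csubspace D" and "u \<in> closure D" "v \<in> closure D"
    and "\<And>x. x \<in> D \<Longrightarrow> cinner u x = cinner v x"
  shows "u = v"
proof -
  have "u - v \<in> ortho_compl (closure D) D"
    using assms csubspace_diff[OF csubspace_closure[OF D]] by (simp add: ortho_compl_def cinner_diff_left)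
  then have "u - v \<in> ortho_compl (closure D) (closure D)" by (simp only: ortho_compl_closure)
  then have "cinner (u - v) (u - v) = 0" by (simp add: ortho_compl_def)
  then show ?thesis by simp
qed

lemma adjoint_exists:
  assumes H: "hilbert H" and K: "hilbert K" and T: "T \<in> bounded_ops H K"
  obtains S where "S \<in> bounded_ops K H" "\<And>x y. x \<in> H \<Longrightarrow> y \<in> K \<Longrightarrow> cinner (T x) y = cinner x (S y)"
proof -
  have sub: "csubspace H" "csubspace K" using H K by (auto intro: hilbert_csubspace)
  have "\<exists>z\<in>H. \<forall>x\<in>H. cinner (T x) y = cinner x z" for y
  proof -
    have "continuous_on H (\<lambda>x. cinner (T x) y)"
      using bounded_ops_continuous[OF T sub(1)] by (intro continuous_intros)
    then obtain z where "z \<in> H" "\<And>x. x \<in> H \<Longrightarrow> cinner (T x) y = cinner x z"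
      using riesz_representation[OF H, of "\<lambda>x. cinner (T x) y"]
      by (auto simp: bounded_ops_add[OF T] bounded_ops_scaleC[OF T] cinner_add_left cinner_scaleC_left)
    then show ?thesis by blast
  qed
  then obtain S where S: "\<And>y. S y \<in> H" "\<And>x y. x \<in> H \<Longrightarrow> cinner (T x) y = cinner x (S y)"
    by metis
  obtain C where C: "C \<ge> 0" "\<And>x. x \<in> H \<Longrightarrow> norm (T x) \<le> C * norm x"
    using bounded_ops_bound[OF T] by blast
  have "restrict S K \<in> bounded_ops K H"
  proof (rule bounded_opsI[where C = C])
    fix y assume "y \<in> K"
    have "(norm (S y))\<^sup>2 = cmod (cinner (T (S y)) y)"
      using S(2)[OF S(1), of y y] by (simp add: cinner_self norm_power)
    also have "\<dots> \<le> norm (T (S y)) * norm y" by (rule complex_cauchy_schwarz)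
    also have "\<dots> \<le> C * norm (S y) * norm y" using C(2)[OF S(1)] by (intro mult_right_mono) auto
    finally have "norm (S y) * norm (S y) \<le> norm (S y) * (C * norm y)"
      by (simp add: power2_eq_square mult_ac)
    then show "norm (restrict S K y) \<le> C * norm y"
      using C(1) \<open>y \<in> K\<close> by (cases "S y = 0") auto
  next
    fix x y assume "x \<in> K" "y \<in> K"
    moreover have "S (x + y) = S x + S y"
      using S csubspace_add[OF sub(1)]
      by (intro cinner_right_eqI[OF sub(1)]) (auto simp: cinner_add_right S(2)[symmetric])
    ultimately show "restrict S K (x + y) = restrict S K x + restrict S K y"
      by (simp add: csubspace_add[OF sub(2)])
  next
    fix c x assume "x \<in> K"
    moreover have "S (c *\<^sub>C x) = c *\<^sub>C S x"
      using S csubspace_scaleC[OF sub(1)]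
      by (intro cinner_right_eqI[OF sub(1)]) (auto simp: cinner_scaleC_right S(2)[symmetric])
    ultimately show "restrict S K (c *\<^sub>C x) = c *\<^sub>C restrict S K x"
      by (simp add: csubspace_scaleC[OF sub(2)])
  qed (use S(1) in auto)
  then show ?thesis using that[of "restrict S K"] S(2) by auto
qed

lemma adjoint_op_eqI:
  assumes H: "csubspace H" and S: "S \<in> bounded_ops K H"
    and adj: "\<And>x y. x \<in> H \<Longrightarrow> y \<in> K \<Longrightarrow> cinner (T x) y = cinner x (S y)"
  shows "adjoint_op H K T = S"
  unfolding adjoint_op_def
proof (rule the_equality)
  fix S' assume S': "S' \<in> bounded_ops K H \<and> (\<forall>x\<in>H. \<forall>y\<in>K. cinner (T x) y = cinner x (S' y))"
  then show "S' = S"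
    using adj S by (intro bounded_ops_eqI[of S' K H S H] cinner_right_eqI[OF H])
      (auto simp: bounded_ops_maps)
qed (use S adj in auto)

lemma adjoint_op_bounded_ops:
  assumes "hilbert H" "hilbert K" "T \<in> bounded_ops H K"
  shows "adjoint_op H K T \<in> bounded_ops K H"
  using adjoint_exists[OF assms] adjoint_op_eqI[OF hilbert_csubspace[OF assms(1)]] by metis

lemma cinner_adjoint_op:
  assumes "hilbert H" "hilbert K" "T \<in> bounded_ops H K" "x \<in> H" "y \<in> K"
  shows "cinner (T x) y = cinner x (adjoint_op H K T y)"
  using adjoint_exists[OF assms(1-3)] adjoint_op_eqI[OF hilbert_csubspace[OF assms(1)]] assms(4,5)
  by metis

lemma cinner_adjoint_op':
  assumes "hilbert H" "hilbert K" "T \<in> bounded_ops H K" "x \<in> H" "y \<in> K"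
  shows "cinner (adjoint_op H K T y) x = cinner y (T x)"
  by (metis cinner_adjoint_op[OF assms] cinner_commute)

text \<open>A bounded operator is Lipschitz, hence uniformly continuous, so it extends to the closure;
  linearity and the bound survive by continuity.\<close>

lemma extend_bounded_op:
  fixes T :: "'h::chilbert_space \<Rightarrow> 'k::chilbert_space"
  assumes D: "csubspace D" and K: "hilbert K"
    and maps: "\<And>x. x \<in> D \<Longrightarrow> T x \<in> K"
    and add: "\<And>x y. x \<in> D \<Longrightarrow> y \<in> D \<Longrightarrow> T (x + y) = T x + T y"
    and scale: "\<And>c x. x \<in> D \<Longrightarrow> T (c *\<^sub>C x) = c *\<^sub>C T x"
    and bound: "\<And>x. x \<in> D \<Longrightarrow> norm (T x) \<le> C * norm x"
  obtains S where "S \<in> bounded_ops (closure D) K" "\<And>x. x \<in> D \<Longrightarrow> S x = T x"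
proof -
  have diff: "T (x - y) = T x - T y" if "x \<in> D" "y \<in> D" for x y
    using add[OF that(1) csubspace_minus[OF D that(2)]] scale[OF that(2), of "-1"]
    by (simp add: scaleC_minus1_left)
  have "\<bar>C\<bar>-lipschitz_on D T"
  proof (rule lipschitz_onI)
    fix x y assume xy: "x \<in> D" "y \<in> D"
    have "norm (T (x - y)) \<le> C * norm (x - y)" by (rule bound[OF csubspace_diff[OF D xy]])
    also have "\<dots> \<le> \<bar>C\<bar> * norm (x - y)" by (intro mult_right_mono) auto
    finally show "dist (T x) (T y) \<le> \<bar>C\<bar> * dist x y" by (simp add: dist_norm diff[OF xy])
  qed simp
  then have "uniformly_continuous_on D T" by (rule lipschitz_on_uniformly_continuous)
  then obtain g where g: "uniformly_continuous_on (closure D) g" "\<And>x. x \<in> D \<Longrightarrow> T x = g x"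
    using uniformly_continuous_on_extension_on_closure by metis
  have cont: "continuous_on (closure D) g" using g(1) by (rule uniformly_continuous_imp_continuous)
  have clD: "csubspace (closure D)" by (rule csubspace_closure[OF D])
  have cont': "continuous_on A (\<lambda>x. g (f x))" if "continuous_on A f" "f ` A \<subseteq> closure D"
    for f :: "'z::topological_space \<Rightarrow> 'h" and A
    using continuous_on_compose2[OF cont that] .
  have "restrict g (closure D) \<in> bounded_ops (closure D) K"
  proof (rule bounded_opsI[where C = C])
    fix x assume x: "x \<in> closure D"
    have "g ` closure D \<subseteq> K"
      using cont maps g(2) hilbert_closed[OF K] by (intro image_closure_subset) auto
    then show "restrict g (closure D) x \<in> K" using x by auto
    have "norm (g x) - C * norm x \<le> 0"
    proof (rule continuous_le_on_closure[OF _ x])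
      show "continuous_on (closure D) (\<lambda>x. norm (g x) - C * norm x)"
        using cont by (intro continuous_intros)
    qed (use bound g(2) in auto)
    then show "norm (restrict g (closure D) x) \<le> C * norm x" using x by simp
  next
    fix x y assume "x \<in> closure D" "y \<in> closure D"
    then have xy: "(x, y) \<in> closure (D \<times> D)" by (simp add: closure_Times)
    have "g (fst (x, y) + snd (x, y)) - g (fst (x, y)) - g (snd (x, y)) = 0"
    proof (rule continuous_constant_on_closure[OF _ _ xy])
      show "continuous_on (closure (D \<times> D)) (\<lambda>p. g (fst p + snd p) - g (fst p) - g (snd p))"
        by (intro continuous_intros cont') (auto simp: closure_Times csubspace_add[OF clD])
      show "g (fst p + snd p) - g (fst p) - g (snd p) = 0" if "p \<in> D \<times> D" for p
        using that add[of "fst p" "snd p"] g(2) csubspace_add[OF D] by auto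
    qed
    then show "restrict g (closure D) (x + y) = restrict g (closure D) x + restrict g (closure D) y"
      using \<open>x \<in> closure D\<close> \<open>y \<in> closure D\<close> csubspace_add[OF clD] by (simp add: algebra_simps)
  next
    fix c x assume x: "x \<in> closure D"
    have "g (c *\<^sub>C x) - c *\<^sub>C g x = 0"
    proof (rule continuous_constant_on_closure[OF _ _ x])
      show "continuous_on (closure D) (\<lambda>x. g (c *\<^sub>C x) - c *\<^sub>C g x)"
        by (intro continuous_intros cont' cont) (auto simp: csubspace_scaleC[OF clD])
      show "g (c *\<^sub>C x) - c *\<^sub>C g x = 0" if "x \<in> D" for x
        using that scale g(2) csubspace_scaleC[OF D] by auto
    qed
    then show "restrict g (closure D) (c *\<^sub>C x) = c *\<^sub>C restrict g (closure D) x"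
      using x csubspace_scaleC[OF clD] by simp
  qed auto
  then show ?thesis using that[of "restrict g (closure D)"] g(2) closure_subset by fastforce
qed

section \<open>Embedding separable inner product spaces into the sequence space\<close>

text \<open>A positive semidefinite hermitian form on a subspace. Null vectors are permitted because the
  form \<open>\<langle>(I - R\<^sup>*R)x, y\<rangle>\<close> of a contraction is in general degenerate.\<close>

locale semi_inner =
  fixes E :: "'v::complex_vector set" and s :: "'v \<Rightarrow> 'v \<Rightarrow> complex"
  assumes E: "csubspace E"
    and s_add: "x \<in> E \<Longrightarrow> y \<in> E \<Longrightarrow> z \<in> E \<Longrightarrow> s (x + y) z = s x z + s y z"
    and s_scale: "x \<in> E \<Longrightarrow> y \<in> E \<Longrightarrow> s (c *\<^sub>C x) y = c * s x y"
    and s_commute: "x \<in> E \<Longrightarrow> y \<in> E \<Longrightarrow> s x y = cnj (s y x)"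
    and s_nonneg: "x \<in> E \<Longrightarrow> 0 \<le> Re (s x x)"
begin

definition sqnorm :: "'v \<Rightarrow> real" where "sqnorm x = Re (s x x)"

lemma s_add_right: "x \<in> E \<Longrightarrow> y \<in> E \<Longrightarrow> z \<in> E \<Longrightarrow> s x (y + z) = s x y + s x z"
  using s_add[of y z x] s_commute[of x "y + z"] s_commute[of x y] s_commute[of x z] csubspace_add[OF E]
  by simp

lemma s_scale_right: "x \<in> E \<Longrightarrow> y \<in> E \<Longrightarrow> s x (c *\<^sub>C y) = cnj c * s x y"
  using s_scale[of y x c] s_commute[of x "c *\<^sub>C y"] s_commute[of x y] csubspace_scaleC[OF E]
  by simp

lemma s_zero: "x \<in> E \<Longrightarrow> s 0 x = 0"
  using s_scale[of 0 x 0] csubspace_zero[OF E] by simp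

lemma s_zero_right: "x \<in> E \<Longrightarrow> s x 0 = 0"
  using s_commute[of x 0] s_zero csubspace_zero[OF E] by simp

lemma s_diff: "x \<in> E \<Longrightarrow> y \<in> E \<Longrightarrow> z \<in> E \<Longrightarrow> s (x - y) z = s x z - s y z"
  using s_add[of x "- y" z] s_scale[of y z "-1"] csubspace_minus[OF E]
  by (simp add: scaleC_minus1_left)

lemma s_sum: "(\<And>i. i \<in> I \<Longrightarrow> f i \<in> E) \<Longrightarrow> x \<in> E \<Longrightarrow> s (\<Sum>i\<in>I. f i) x = (\<Sum>i\<in>I. s (f i) x)"
  by (induction I rule: infinite_finite_induct) (auto simp: s_zero s_add csubspace_sum[OF E])

lemma s_self: "x \<in> E \<Longrightarrow> s x x = complex_of_real (sqnorm x)"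
  using s_commute[of x x] by (simp add: sqnorm_def complex_eq_iff)

lemma sqnorm_nonneg: "x \<in> E \<Longrightarrow> 0 \<le> sqnorm x"
  by (simp add: sqnorm_def s_nonneg)

lemma sqnorm_add: "x \<in> E \<Longrightarrow> y \<in> E \<Longrightarrow> sqnorm (x + y) = sqnorm x + 2 * Re (s x y) + sqnorm y"
  using s_commute[of x y] by (simp add: sqnorm_def s_add s_add_right csubspace_add[OF E])

lemma sqnorm_scale: "x \<in> E \<Longrightarrow> sqnorm (c *\<^sub>C x) = (cmod c)\<^sup>2 * sqnorm x"
proof -
  assume x: "x \<in> E"
  have "s (c *\<^sub>C x) (c *\<^sub>C x) = (c * cnj c) * s x x"
    using x by (simp add: s_scale s_scale_right csubspace_scaleC[OF E])
  also have "\<dots> = complex_of_real ((cmod c)\<^sup>2 * sqnorm x)"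
    using x by (simp add: complex_norm_square[symmetric] s_self)
  finally show ?thesis by (simp add: sqnorm_def)
qed

lemma sqnorm_minus: "x \<in> E \<Longrightarrow> sqnorm (- x) = sqnorm x"
  using sqnorm_scale[of x "-1"] by (simp add: scaleC_minus1_left)

lemma sqnorm_add_le: "x \<in> E \<Longrightarrow> y \<in> E \<Longrightarrow> sqnorm (x + y) \<le> 2 * sqnorm x + 2 * sqnorm y"
proof -
  assume xy: "x \<in> E" "y \<in> E"
  have "s x (- y) = - s x y" using xy s_scale_right[of x y "-1"] by (simp add: scaleC_minus1_left)
  then show ?thesis
    using sqnorm_add[OF xy] sqnorm_add[OF xy(1) csubspace_minus[OF E xy(2)]] sqnorm_minus[OF xy(2)]
      sqnorm_nonneg[OF csubspace_add[OF E xy(1) csubspace_minus[OF E xy(2)]]]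
    by simp
qed

text \<open>The form is determined by its diagonal, so a linear map that preserves the diagonal
  preserves the form.\<close>

lemma polarization:
  assumes "x \<in> E" "y \<in> E"
    and J: "\<And>x y. x \<in> E \<Longrightarrow> y \<in> E \<Longrightarrow> J (x + y) = J x + (J y :: 'w::complex_inner)"
      "\<And>c x. x \<in> E \<Longrightarrow> J (c *\<^sub>C x) = c *\<^sub>C J x"
      "\<And>x. x \<in> E \<Longrightarrow> (norm (J x))\<^sup>2 = sqnorm x"
  shows "cinner (J x) (J y) = s x y"
proof -
  have re: "Re (cinner (J x) (J y)) = Re (s x y)" if "y \<in> E" for y
    using J(3)[OF csubspace_add[OF E assms(1) that]] sqnorm_add[OF assms(1) that]
      norm_add_squared[of "J x" "J y"]
    by (simp add: J(1)[OF assms(1) that] J(3)[OF assms(1)] J(3)[OF that])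
  have "Re (cinner (J x) (J (\<i> *\<^sub>C y))) = Re (s x (\<i> *\<^sub>C y))"
    by (rule re[OF csubspace_scaleC[OF E assms(2)]])
  then have "Im (cinner (J x) (J y)) = Im (s x y)"
    using assms(1,2) by (simp add: J(2) cinner_scaleC_right s_scale_right)
  with re[OF assms(2)] show ?thesis by (simp add: complex_eq_iff)
qed

context
  fixes a :: "nat \<Rightarrow> 'v"
  assumes a: "\<And>n. a n \<in> E"
begin

text \<open>The Gram-Schmidt process; a vector that depends on its predecessors modulo null vectors
  contributes \<open>0\<close>.\<close>

function gs :: "nat \<Rightarrow> 'v" where
  "gs n = (let u = a n - (\<Sum>k<n. s (a n) (gs k) *\<^sub>C gs k) in
     if sqnorm u = 0 then 0 else complex_of_real (1 / sqrt (sqnorm u)) *\<^sub>C u)"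
  by auto
termination by (relation "Wellfounded.measure id") auto

declare gs.simps [simp del]

definition proj :: "nat \<Rightarrow> 'v \<Rightarrow> 'v" where
  "proj n x = (\<Sum>k<n. s x (gs k) *\<^sub>C gs k)"

lemma gs_unfold:
  "gs n = (if sqnorm (a n - proj n (a n)) = 0 then 0
     else complex_of_real (1 / sqrt (sqnorm (a n - proj n (a n)))) *\<^sub>C (a n - proj n (a n)))"
  unfolding proj_def by (subst gs.simps) (simp add: Let_def)

lemma gs_mem: "gs n \<in> E"
proof (induction n rule: less_induct)
  case (less n)
  then have "proj n (a n) \<in> E" unfolding proj_def by (auto intro!: csubspace_sum[OF E] csubspace_scaleC[OF E])
  then have "a n - proj n (a n) \<in> E" by (rule csubspace_diff[OF E a])
  then show ?case
    by (subst gs_unfold) (simp add: csubspace_zero[OF E] csubspace_scaleC[OF E])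
qed

lemma proj_mem: "proj n x \<in> E"
  unfolding proj_def by (auto intro!: csubspace_sum[OF E] csubspace_scaleC[OF E] gs_mem)

lemma gs_self: "gs n = 0 \<or> s (gs n) (gs n) = 1"
proof (cases "sqnorm (a n - proj n (a n)) = 0")
  case False
  let ?u = "a n - proj n (a n)"
  have u: "?u \<in> E" by (rule csubspace_diff[OF E a proj_mem])
  have pos: "0 < sqnorm ?u" using False sqnorm_nonneg[OF u] by simp
  have "sqnorm (gs n) = (cmod (complex_of_real (1 / sqrt (sqnorm ?u))))\<^sup>2 * sqnorm ?u"
    using False sqnorm_scale[OF u] by (subst gs_unfold) simp
  also have "\<dots> = (1 / sqrt (sqnorm ?u))\<^sup>2 * sqnorm ?u" by (simp only: norm_of_real power2_abs)
  also have "\<dots> = 1" using pos by (simp add: power_divide)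
  finally show ?thesis using s_self[OF gs_mem] by simp
qed (subst gs_unfold, simp)

lemma proj_gs:
  assumes ortho: "\<And>k. k < n \<Longrightarrow> k \<noteq> i \<Longrightarrow> s (gs k) (gs i) = 0" and "i < n" "x \<in> E"
  shows "s (proj n x) (gs i) = s x (gs i)"
proof -
  have "s (proj n x) (gs i) = (\<Sum>k<n. s x (gs k) * s (gs k) (gs i))"
    unfolding proj_def using gs_mem
    by (subst s_sum) (auto simp: s_scale csubspace_scaleC[OF E] assms)
  also have "\<dots> = s x (gs i) * s (gs i) (gs i)"
    using assms(2) ortho by (subst sum.remove[of _ i]) auto
  also have "\<dots> = s x (gs i)"
    using gs_self[of i] s_zero_right[OF assms(3)] by auto
  finally show ?thesis .
qed

lemma gs_ortho_less: "i < n \<Longrightarrow> s (gs n) (gs i) = 0"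
proof (induction n arbitrary: i rule: less_induct)
  case (less n)
  have o: "s (gs k) (gs j) = 0" if "k < n" "j < n" "k \<noteq> j" for k j
    using less.IH[of k j] less.IH[of j k] that s_commute[OF gs_mem gs_mem, of k j]
    by (cases "j < k") auto
  have "s (a n - proj n (a n)) (gs i) = 0"
    using proj_gs[of n i "a n"] less.prems o a by (simp add: s_diff proj_mem gs_mem)
  then show ?case
    by (subst gs_unfold) (simp add: s_zero gs_mem s_scale csubspace_diff[OF E a proj_mem])
qed

lemma gs_ortho: "i \<noteq> j \<Longrightarrow> s (gs i) (gs j) = 0"
  using gs_ortho_less[of i j] gs_ortho_less[of j i] s_commute[OF gs_mem gs_mem, of i j]
  by (cases "i < j") auto

lemma sqnorm_minus_proj: "x \<in> E \<Longrightarrow> sqnorm (x - proj n x) = sqnorm x - (\<Sum>k<n. (cmod (s x (gs k)))\<^sup>2)"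
proof -
  assume x: "x \<in> E"
  let ?u = "x - proj n x"
  have u: "?u \<in> E" by (rule csubspace_diff[OF E x proj_mem])
  have "s ?u (gs k) = 0" if "k < n" for k
    using proj_gs[OF gs_ortho that x] x by (simp add: s_diff proj_mem gs_mem)
  then have gu: "s (gs k) ?u = 0" if "k < n" for k
    using s_commute[OF gs_mem u, of k] that by simp
  have "s (proj n x) v = 0" if "v \<in> E" "\<And>k. k < n \<Longrightarrow> s (gs k) v = 0" for v
    unfolding proj_def using that
    by (subst s_sum) (auto simp: s_scale csubspace_scaleC[OF E] gs_mem)
  then have pu: "s (proj n x) ?u = 0" using u gu by blast
  have "s x (proj n x) = cnj (s (proj n x) x)" by (rule s_commute[OF x proj_mem])
  also have "\<dots> = (\<Sum>k<n. cnj (s (s x (gs k) *\<^sub>C gs k) x))"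
    using x by (simp add: proj_def s_sum csubspace_scaleC[OF E] gs_mem)
  also have "\<dots> = (\<Sum>k<n. complex_of_real ((cmod (s x (gs k)))\<^sup>2))"
    using x s_commute[OF gs_mem x]
    by (intro sum.cong) (auto simp: s_scale gs_mem complex_norm_square mult.commute
        simp del: of_real_power)
  finally have xp: "Re (s x (proj n x)) = (\<Sum>k<n. (cmod (s x (gs k)))\<^sup>2)" by simp
  have "sqnorm ?u = Re (s x ?u) - Re (s (proj n x) ?u)"
    using x u by (simp add: sqnorm_def s_diff proj_mem)
  also have "s x ?u = s x x - s x (proj n x)"
    using x s_diff[OF x proj_mem x] s_commute[OF x u] s_commute[OF x x] s_commute[OF x proj_mem] by simp
  finally show ?thesis using pu xp by (simp add: sqnorm_def)
qed

lemma a_minus_proj: "sqnorm (a n - proj (Suc n) (a n)) = 0"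
proof -
  let ?u = "a n - proj n (a n)"
  have u: "?u \<in> E" by (rule csubspace_diff[OF E a proj_mem])
  have eq: "a n - proj (Suc n) (a n) = ?u - s (a n) (gs n) *\<^sub>C gs n"
    by (simp add: proj_def algebra_simps)
  show ?thesis
  proof (cases "sqnorm ?u = 0")
    case True
    then have "gs n = 0" by (subst gs_unfold) simp
    then show ?thesis using True by (simp add: eq)
  next
    case False
    then have pos: "0 < sqnorm ?u" using sqnorm_nonneg[OF u] by simp
    define t where "t = 1 / sqrt (sqnorm ?u)"
    let ?c = "complex_of_real t"
    have t: "t * t * sqnorm ?u = 1" using pos by (simp add: t_def)
    have g: "gs n = ?c *\<^sub>C ?u" using False by (subst gs_unfold) (simp add: t_def)
    have "s (gs k) (gs n) = 0" if "k < n" for k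
      using that by (intro gs_ortho) simp
    then have "s (proj n (a n)) (gs n) = 0"
      unfolding proj_def by (subst s_sum) (auto simp: s_scale csubspace_scaleC[OF E] gs_mem)
    then have "s (a n) (gs n) = s ?u (gs n)" by (simp add: s_diff a proj_mem gs_mem)
    also have "\<dots> = ?c * complex_of_real (sqnorm ?u)" using u by (simp add: g s_scale_right s_self)
    finally have "s (a n) (gs n) * ?c = complex_of_real (t * t * sqnorm ?u)" by simp
    then have "s (a n) (gs n) *\<^sub>C gs n = ?u"
      by (subst (2) g) (simp add: scaleC_scaleC scaleC_one t)
    then show ?thesis by (simp add: eq sqnorm_def s_zero csubspace_zero[OF E])
  qed
qed

text \<open>Parseval's identity: \<open>x\<close> is close to some \<open>a n\<close>, which differs from its projection to the
  first \<open>n + 1\<close> vectors by a null vector only.\<close>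

lemma parseval:
  assumes dense: "\<And>x \<epsilon>. x \<in> E \<Longrightarrow> 0 < \<epsilon> \<Longrightarrow> \<exists>n. sqnorm (x - a n) < \<epsilon>" and x: "x \<in> E"
  shows "(\<lambda>k. (cmod (s x (gs k)))\<^sup>2) sums sqnorm x"
proof -
  have bessel: "(\<Sum>k<n. (cmod (s x (gs k)))\<^sup>2) \<le> sqnorm x" if "x \<in> E" for x n
    using sqnorm_minus_proj[OF that, of n] sqnorm_nonneg[OF csubspace_diff[OF E that proj_mem]] by (metis diff_ge_0_iff_ge)
  have summ: "summable (\<lambda>k. (cmod (s x (gs k)))\<^sup>2)"
    by (rule summableI_nonneg_bounded[OF _ bessel[OF x]]) auto
  have "sqnorm x \<le> (\<Sum>k. (cmod (s x (gs k)))\<^sup>2) + \<epsilon>" if \<epsilon>: "\<epsilon> > 0" for \<epsilon>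
  proof -
    obtain n where n: "sqnorm (x - a n) < \<epsilon> / 2" using dense[OF x, of "\<epsilon> / 2"] \<epsilon> by auto
    let ?P = "proj (Suc n)"
    have m: "x - a n \<in> E" "a n - ?P (a n) \<in> E" "(x - a n) - ?P (x - a n) \<in> E"
      using csubspace_diff[OF E] x a proj_mem by blast+
    have lin: "?P x = ?P (x - a n) + ?P (a n)"
      unfolding proj_def sum.distrib[symmetric] using x a
      by (intro sum.cong) (auto simp: s_diff gs_mem scaleC_add_left[symmetric])
    have "sqnorm (x - ?P x) = sqnorm (((x - a n) - ?P (x - a n)) + (a n - ?P (a n)))"
      by (simp add: lin algebra_simps)
    also have "\<dots> \<le> 2 * sqnorm ((x - a n) - ?P (x - a n)) + 2 * sqnorm (a n - ?P (a n))"
      by (rule sqnorm_add_le[OF m(3,2)])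
    also have "\<dots> \<le> 2 * sqnorm (x - a n)"
      using sqnorm_minus_proj[OF m(1), of "Suc n"] a_minus_proj[of n]
        sum_nonneg[of "{..<Suc n}" "\<lambda>k. (cmod (s (x - a n) (gs k)))\<^sup>2"] by simp
    finally have "sqnorm x - (\<Sum>k<Suc n. (cmod (s x (gs k)))\<^sup>2) \<le> \<epsilon>"
      using n sqnorm_minus_proj[OF x, of "Suc n"] by linarith
    moreover have "(\<Sum>k<Suc n. (cmod (s x (gs k)))\<^sup>2) \<le> (\<Sum>k. (cmod (s x (gs k)))\<^sup>2)"
      by (rule sum_le_suminf[OF summ]) auto
    ultimately show ?thesis by linarith
  qed
  then have "sqnorm x \<le> (\<Sum>k. (cmod (s x (gs k)))\<^sup>2)" by (rule field_le_epsilon)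
  moreover have "(\<Sum>k. (cmod (s x (gs k)))\<^sup>2) \<le> sqnorm x" by (rule suminf_le_const[OF summ bessel[OF x]])
  ultimately show ?thesis using summ by (simp add: sums_iff)
qed

text \<open>The coefficients with respect to the Gram-Schmidt sequence: Parseval's identity says that they
  preserve the diagonal of the form.\<close>

lemma embedding_into_ell2:
  assumes dense: "\<And>x \<epsilon>. x \<in> E \<Longrightarrow> 0 < \<epsilon> \<Longrightarrow> \<exists>n. sqnorm (x - a n) < \<epsilon>"
  obtains J :: "'v \<Rightarrow> ell2"
  where "\<And>x y. x \<in> E \<Longrightarrow> y \<in> E \<Longrightarrow> J (x + y) = J x + J y"
    and "\<And>c x. x \<in> E \<Longrightarrow> J (c *\<^sub>C x) = c *\<^sub>C J x"
    and "\<And>x y. x \<in> E \<Longrightarrow> y \<in> E \<Longrightarrow> cinner (J x) (J y) = s x y"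
proof -
  define J where "J x = Abs_ell2 (\<lambda>k. s x (gs k))" for x
  have rep: "Rep_ell2 (J x) = (\<lambda>k. s x (gs k))" if "x \<in> E" for x
    unfolding J_def by (rule ell2_Abs_inverse[OF sums_summable[OF parseval[OF dense that]]])
  have add: "J (x + y) = J x + J y" if "x \<in> E" "y \<in> E" for x y
    using that
    by (intro ell2_eqI) (simp add: rep Rep_ell2_add csubspace_add[OF E] s_add gs_mem)
  have scale: "J (c *\<^sub>C x) = c *\<^sub>C J x" if "x \<in> E" for c x
    using that
    by (intro ell2_eqI) (simp add: rep Rep_ell2_scaleC csubspace_scaleC[OF E] s_scale gs_mem)
  have nrm: "(norm (J x))\<^sup>2 = sqnorm x" if "x \<in> E" for x
    using sums_unique[OF parseval[OF dense that]] by (simp add: ell2_norm_squared rep[OF that])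
  show ?thesis by (rule that[OF add scale polarization[OF _ _ add scale nrm]])
qed

end

end

section \<open>Positive elements of a C*-algebra\<close>

instance unital_cstar_algebra \<subseteq> banach ..

lemma star_zero [simp]: "star (0::'a::unital_cstar_algebra) = 0"
  using star_scaleC[of 0 "0::'a"] by simp

lemma star_one [simp]: "star (1::'a::unital_cstar_algebra) = 1"
  by (metis mult.right_neutral mult.left_neutral star_mult star_star)

lemma star_minus: "star (- a) = - star (a::'a::unital_cstar_algebra)"
  using star_scaleC[of "-1" a] by (simp add: scaleC_minus1_left)

lemma star_diff: "star (a - b) = star a - star (b::'a::unital_cstar_algebra)"
  using star_add[of a "- b"] by (simp add: star_minus)

lemma star_scaleR: "star (r *\<^sub>R a) = r *\<^sub>R star (a::'a::unital_cstar_algebra)"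
  by (simp add: scaleR_scaleC star_scaleC)

lemma star_of_real [simp]: "star (of_real r :: 'a::unital_cstar_algebra) = of_real r"
  by (simp add: of_real_def star_scaleR)

lemma norm_star [simp]: "norm (star a) = norm (a::'a::unital_cstar_algebra)"
proof -
  have le: "norm b \<le> norm (star b)" for b :: 'a
  proof (cases "b = 0")
    case False
    have "norm b * norm b \<le> norm (star b) * norm b"
      using norm_mult_ineq[of "star b" b] by (simp add: norm_star_mult power2_eq_square)
    then show ?thesis using False by simp
  qed simp
  show ?thesis using le[of a] le[of "star a"] by (simp add: star_star)
qed

lemma bounded_linear_star: "bounded_linear (star :: 'a::unital_cstar_algebra \<Rightarrow> 'a)"
  by (rule bounded_linear_intro[where K = 1]) (auto simp: star_add star_scaleR)

lemmas continuous_on_star [continuous_intros] = bounded_linear.continuous_on[OF bounded_linear_star]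

lemma star_mult_eq_zero: "star a * a = 0 \<longleftrightarrow> a = (0::'a::unital_cstar_algebra)"
  using norm_star_mult[of a] by auto

lemma norm_square_selfadjoint:
  "star (b::'a::unital_cstar_algebra) = b \<Longrightarrow> norm (b * b) = (norm b)\<^sup>2"
  using norm_star_mult[of b] by simp

text \<open>With \<open>n = b + ic\<close> the hypotheses give \<open>n\<^sup>*n = b\<^sup>2 + c\<^sup>2\<close>, and \<open>b\<close> is the real part of \<open>n\<close>.\<close>

lemma norm_le_norm_sum_of_squares:
  fixes b c :: "'a::unital_cstar_algebra"
  assumes sa: "star b = b" "star c = c" and comm: "b * c = c * b"
  shows "(norm b)\<^sup>2 \<le> norm (b * b + c * c)"
proof -
  define n where "n = b + \<i> *\<^sub>C c"
  have sn: "star n = b - \<i> *\<^sub>C c"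
    by (simp add: n_def star_add star_scaleC sa scaleC_minus_left)
  have "star n * n = b * b + c * c"
    by (simp add: sn, simp add: n_def algebra_simps scaleC_mult_left scaleC_mult_right comm
        scaleC_scaleC scaleC_minus1_left scaleC_add_right scaleC_diff_right)
  then have n2: "(norm n)\<^sup>2 = norm (b * b + c * c)" using norm_star_mult[of n] by simp
  have "2 *\<^sub>R b = n + star n" by (simp add: sn, simp add: n_def scaleR_2)
  then have "norm (2 *\<^sub>R b) \<le> norm n + norm (star n)" by (metis norm_triangle_ineq)
  then have "norm b \<le> norm n" by simp
  then show ?thesis using n2 by (metis norm_ge_zero power_mono)
qed


text \<open>A limit \<open>y\<close> solves \<open>y = (x + y\<^sup>2)/2\<close>, so that \<open>1 - y\<close> is a square root of \<open>1 - x\<close>.\<close>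

fun sqrt_iter :: "'a::real_normed_algebra_1 \<Rightarrow> nat \<Rightarrow> 'a" where
  "sqrt_iter x 0 = 0"
| "sqrt_iter x (Suc n) = (1/2) *\<^sub>R (x + sqrt_iter x n * sqrt_iter x n)"

lemma sqrt_iter_commute: "z * x = x * z \<Longrightarrow> z * sqrt_iter x n = sqrt_iter x n * z"
proof (induction n)
  case (Suc n)
  then have "z * (sqrt_iter x n * sqrt_iter x n) = sqrt_iter x n * sqrt_iter x n * z"
    by (metis mult.assoc)
  then show ?case using Suc by (simp add: distrib_left distrib_right)
qed simp

lemma sqrt_iter_real_le:
  "0 \<le> sqrt_iter (1::real) n \<and> sqrt_iter 1 n \<le> (1::real) \<and> sqrt_iter 1 n \<le> sqrt_iter (1::real) (Suc n)"
proof (induction n)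
  case (Suc n)
  have "sqrt_iter 1 n * sqrt_iter 1 n \<le> sqrt_iter 1 (Suc n) * sqrt_iter (1::real) (Suc n)"
    using Suc by (intro mult_mono) auto
  moreover have "sqrt_iter 1 n * sqrt_iter 1 n \<le> (1::real) * 1"
    using Suc by (intro mult_mono) auto
  ultimately show ?case using Suc by auto
qed simp

lemma norm_sqrt_iter_le:
  assumes "norm x \<le> 1"
  shows "norm (sqrt_iter x n) \<le> sqrt_iter 1 n"
proof (induction n)
  case (Suc n)
  have "norm (x + sqrt_iter x n * sqrt_iter x n) \<le> norm x + norm (sqrt_iter x n) * norm (sqrt_iter x n)"
    by (intro order_trans[OF norm_triangle_ineq] add_left_mono norm_mult_ineq)
  also have "\<dots> \<le> 1 + sqrt_iter 1 n * sqrt_iter 1 n"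
    using Suc assms by (intro add_mono mult_mono) (auto intro: order_trans[OF norm_ge_zero])
  finally show ?case by simp
qed simp

text \<open>The differences are dominated by those of the scalar iteration with \<open>x = 1\<close>, which is
  monotone and bounded; this covers the boundary case \<open>norm x = 1\<close>.\<close>

lemma norm_sqrt_iter_step:
  assumes "norm x \<le> 1"
  shows "norm (sqrt_iter x (Suc n) - sqrt_iter x n) \<le> sqrt_iter 1 (Suc n) - sqrt_iter 1 n"
proof (induction n)
  case (Suc n)
  let ?y = "sqrt_iter x" and ?r = "sqrt_iter (1::real)"
  have "?y (Suc n) * ?y n = ?y n * ?y (Suc n)"
    by (intro sqrt_iter_commute sqrt_iter_commute[symmetric] refl)
  then have "?y (Suc n) * ?y (Suc n) - ?y n * ?y n = (?y (Suc n) + ?y n) * (?y (Suc n) - ?y n)"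
    by (simp add: ring_distribs del: sqrt_iter.simps)
  then have "?y (Suc (Suc n)) - ?y (Suc n) = (1/2) *\<^sub>R ((?y (Suc n) + ?y n) * (?y (Suc n) - ?y n))"
    by (simp only: sqrt_iter.simps(2)[of x "Suc n"] sqrt_iter.simps(2)[of x n]
        scaleR_diff_right[symmetric]) (simp add: algebra_simps)
  then have "norm (?y (Suc (Suc n)) - ?y (Suc n))
      = (1/2) * norm ((?y (Suc n) + ?y n) * (?y (Suc n) - ?y n))" by simp
  also have "\<dots> \<le> (1/2) * ((?r (Suc n) + ?r n) * (?r (Suc n) - ?r n))"
    using Suc order_trans[OF norm_triangle_ineq add_mono[OF norm_sqrt_iter_le[OF assms] norm_sqrt_iter_le[OF assms]], of "Suc n" n]
      sqrt_iter_real_le[of n] sqrt_iter_real_le[of "Suc n"]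
    by (intro mult_left_mono order_trans[OF norm_mult_ineq] mult_mono) (auto simp del: sqrt_iter.simps)
  also have "\<dots> = ?r (Suc (Suc n)) - ?r (Suc n)" by (simp add: algebra_simps)
  finally show ?case .
qed (use assms in simp)

lemma sqrt_one_minus:
  fixes x :: "'a::unital_cstar_algebra"
  assumes x: "norm x \<le> 1"
  obtains y where "norm y \<le> 1" "(1 - y) * (1 - y) = 1 - x" "star x = x \<Longrightarrow> star y = y"
    "\<And>z. z * x = x * z \<Longrightarrow> z * y = y * z"
proof -
  let ?y = "sqrt_iter x" and ?r = "sqrt_iter (1::real)"
  have "incseq ?r" using sqrt_iter_real_le by (intro incseq_SucI) blast
  then have "convergent ?r"
    using sqrt_iter_real_le by (intro Bseq_mono_convergent BseqI'[of _ 1]) (auto simp: incseq_def)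
  then have "summable (\<lambda>n. ?r (Suc n) - ?r n)"
    using telescope_sums unfolding convergent_def summable_def by blast
  then have "summable (\<lambda>n. ?y (Suc n) - ?y n)"
    by (rule summable_comparison_test'[where N = 0]) (rule norm_sqrt_iter_step[OF x])
  then have "convergent (\<lambda>n. \<Sum>k<n. ?y (Suc k) - ?y k)" by (simp add: summable_iff_convergent)
  then have "convergent ?y" by (simp add: sum_lessThan_telescope del: sqrt_iter.simps(2))
  then obtain y where y: "?y \<longlonglongrightarrow> y" by (auto simp: convergent_def)
  have ny: "norm y \<le> 1"
    using norm_sqrt_iter_le[OF x] sqrt_iter_real_le
    by (intro Lim_bounded[OF tendsto_norm[OF y], of 0]) (meson order_trans)
  have "(\<lambda>n. ?y (Suc n)) \<longlonglongrightarrow> (1/2) *\<^sub>R (x + y * y)"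
    unfolding sqrt_iter.simps by (intro tendsto_intros y)
  then have "y = (1/2) *\<^sub>R (x + y * y)" using LIMSEQ_unique LIMSEQ_Suc[OF y] by blast
  then have "2 *\<^sub>R y = x + y * y" by (metis scaleR_scaleR scaleR_one mult_numeral_1_right
      nonzero_mult_div_cancel_left times_divide_eq_right zero_neq_numeral)
  then have "(1 - y) * (1 - y) = 1 - x" by (simp add: algebra_simps scaleR_2)
  moreover have "star y = y" if "star x = x"
  proof -
    have "star (?y n) = ?y n" for n
      by (induction n) (auto simp: star_scaleR star_add star_mult that)
    then have "?y \<longlonglongrightarrow> star y" using bounded_linear.tendsto[OF bounded_linear_star y] by simp
    then show ?thesis using LIMSEQ_unique y by blast
  qed
  moreover have "z * y = y * z" if "z * x = x * z" for z
  proof -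
    have "(\<lambda>n. z * ?y n) \<longlonglongrightarrow> z * y" "(\<lambda>n. ?y n * z) \<longlonglongrightarrow> y * z" by (intro tendsto_intros y)+
    then show ?thesis using LIMSEQ_unique by (simp add: sqrt_iter_commute[OF that])
  qed
  ultimately show ?thesis using that ny by blast
qed


text \<open>For self-adjoint \<open>h\<close> the norm condition says that the spectrum lies in \<open>[0, 2t]\<close>; in this form
  the positive elements visibly form a convex cone.\<close>

definition is_positive :: "'a::unital_cstar_algebra \<Rightarrow> bool" where
  "is_positive h \<longleftrightarrow> star h = h \<and> (\<exists>t\<ge>0. norm (of_real t - h) \<le> t)"

lemma positive_selfadjoint: "is_positive h \<Longrightarrow> star h = h"
  by (simp add: is_positive_def)

lemma positive_add:
  assumes "is_positive g" "is_positive h"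
  shows "is_positive (g + h)"
proof -
  obtain s t where "s \<ge> 0" "norm (of_real s - g) \<le> s" "t \<ge> 0" "norm (of_real t - h) \<le> t"
    using assms by (auto simp: is_positive_def)
  then have "s + t \<ge> 0" "norm (of_real (s + t) - (g + h)) \<le> s + t"
    using norm_triangle_ineq[of "of_real s - g" "of_real t - h"] by (auto simp: algebra_simps)
  then show ?thesis using assms unfolding is_positive_def by (metis star_add)
qed

lemma positive_scaleR:
  assumes "is_positive h" "r \<ge> 0"
  shows "is_positive (r *\<^sub>R h)"
proof -
  obtain t where t: "t \<ge> 0" "norm (of_real t - h) \<le> t" using assms by (auto simp: is_positive_def)
  have "of_real (r * t) - r *\<^sub>R h = r *\<^sub>R (of_real t - h)"
    by (simp add: algebra_simps scaleR_conv_of_real)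
  then have "norm (of_real (r * t) - r *\<^sub>R h) \<le> r * t"
    using t assms(2) by (simp add: mult_left_mono)
  then show ?thesis
    using t(1) assms unfolding is_positive_def by (metis star_scaleR mult_nonneg_nonneg)
qed

lemma positive_norm_minus:
  assumes "star h = h"
  shows "is_positive (of_real (norm h) - h)"
  unfolding is_positive_def using assms by (auto simp: star_diff intro!: exI[of _ "norm h"])

lemma positive_of_real: "is_positive (of_real r :: 'a::unital_cstar_algebra) \<longleftrightarrow> r \<ge> 0"
proof
  assume "is_positive (of_real r :: 'a)"
  then obtain t where "t \<ge> 0" "norm (of_real (t - r) :: 'a) \<le> t" by (auto simp: is_positive_def)
  then show "r \<ge> 0" unfolding norm_of_real by linarith
qed (auto simp: is_positive_def intro!: exI[of _ r])

text \<open>After rescaling, \<open>h = t(1 - x)\<close> with \<open>norm x \<le> 1\<close>, so that \<open>sqrt t (1 - y)\<close> is a root.\<close>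

lemma positive_sqrt:
  assumes "is_positive h"
  obtains b where "is_positive b" "b * b = h" "\<And>z. z * h = h * z \<Longrightarrow> z * b = b * z"
proof -
  obtain t where t: "t \<ge> 0" "norm (of_real t - h) \<le> t" using assms by (auto simp: is_positive_def)
  show ?thesis
  proof (cases "t = 0")
    case True
    then show ?thesis using t that[of 0] positive_of_real[of 0] by simp
  next
    case False
    then have pos: "t > 0" using t by simp
    define x where "x = 1 - (1/t) *\<^sub>R h"
    have "x = (1/t) *\<^sub>R (of_real t - h)"
      using pos by (simp add: x_def algebra_simps of_real_def)
    then have "norm x \<le> 1" using t pos by simp
    then obtain y where y: "norm y \<le> 1" "(1 - y) * (1 - y) = 1 - x" "star x = x \<Longrightarrow> star y = y"
      "\<And>z. z * x = x * z \<Longrightarrow> z * y = y * z"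
      by (rule sqrt_one_minus) blast
    have "star x = x" using positive_selfadjoint[OF assms] by (simp add: x_def star_diff star_scaleR)
    then have sy: "star y = y" by (rule y(3))
    have "norm (of_real (sqrt t) - sqrt t *\<^sub>R (1 - y)) \<le> sqrt t"
      using y(1) pos by (simp add: algebra_simps of_real_def)
    then have "is_positive (sqrt t *\<^sub>R (1 - y))"
      using t sy by (auto simp: is_positive_def star_scaleR star_diff intro!: exI[of _ "sqrt t"])
    moreover have "sqrt t *\<^sub>R (1 - y) * sqrt t *\<^sub>R (1 - y) = h"
      using pos y(2) by (simp add: x_def)
    moreover have "z * sqrt t *\<^sub>R (1 - y) = sqrt t *\<^sub>R (1 - y) * z" if "z * h = h * z" for z
      using y(4)[of z] that by (simp add: x_def algebra_simps)
    ultimately show ?thesis by (rule that)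
  qed
qed

text \<open>Rescaled to norm 1, \<open>b\<close> becomes \<open>h\<close> with a commuting root \<open>k = 1 - y\<close> of \<open>1 - h\<^sup>2\<close>. The elements
  \<open>h\<close> and \<open>k\<close> are the real and the imaginary part of a unitary, hence \<open>norm (1 - h\<^sup>2) = norm (k\<^sup>2) \<le> 1\<close>,
  which is the positivity of \<open>h\<^sup>2\<close>.\<close>

lemma positive_square:
  fixes b :: "'a::unital_cstar_algebra"
  assumes sa: "star b = b"
  shows "is_positive (b * b)"
proof (cases "b = 0")
  case False
  define h where "h = (1 / norm b) *\<^sub>R b"
  have sh: "star h = h" by (simp add: h_def star_scaleR sa)
  have nh: "norm h = 1" using False by (simp add: h_def)
  have "norm (h * h) \<le> 1" using norm_mult_ineq[of h h] nh by simp
  then obtain y where y: "norm y \<le> 1" "(1 - y) * (1 - y) = 1 - h * h"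
    "star (h * h) = h * h \<Longrightarrow> star y = y"
    "\<And>z. z * (h * h) = h * h * z \<Longrightarrow> z * y = y * z"
    by (rule sqrt_one_minus) blast
  have sy: "star y = y" using y(3) by (simp add: star_mult sh)
  have "h * y = y * h" by (rule y(4)) (simp add: mult.assoc)
  then have "(norm (1 - y))\<^sup>2 \<le> norm ((1 - y) * (1 - y) + h * h)"
    using sy sh by (intro norm_le_norm_sum_of_squares) (auto simp: star_diff algebra_simps)
  then have "(norm (1 - y))\<^sup>2 \<le> 1" by (simp add: y(2))
  then have "norm (1 - h * h) \<le> 1"
    using norm_square_selfadjoint[of "1 - y"] sy by (simp add: y(2) star_diff)
  then have "is_positive (h * h)"
    using sh by (auto simp: is_positive_def star_mult intro!: exI[of _ 1])
  then have "is_positive ((norm b)\<^sup>2 *\<^sub>R (h * h))" by (intro positive_scaleR) auto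
  then show ?thesis using False by (simp add: h_def power2_eq_square)
qed (use positive_of_real[of 0] in simp)

lemma positive_mult:
  assumes "is_positive g" "is_positive h" "g * h = h * g"
  shows "is_positive (g * h)"
proof -
  obtain b where b: "is_positive b" "b * b = g" "\<And>z. z * g = g * z \<Longrightarrow> z * b = b * z"
    using positive_sqrt[OF assms(1)] by blast
  obtain c where c: "is_positive c" "c * c = h" "\<And>z. z * h = h * z \<Longrightarrow> z * c = c * z"
    using positive_sqrt[OF assms(2)] by blast
  have "h * b = b * h" using b(3) assms(3) by simp
  then have bc: "b * c = c * b" using c(3) by simp
  then have "star (b * c) = b * c"
    using b(1) c(1) by (simp add: star_mult positive_selfadjoint)
  then have "is_positive ((b * c) * (b * c))" by (rule positive_square)
  moreover have "(b * c) * (b * c) = g * h" using bc b(2) c(2) by (metis mult.assoc)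
  ultimately show ?thesis by simp
qed

text \<open>Both \<open>h\<close> and \<open>t - h\<close> are squares of self-adjoint elements that commute with each other.\<close>

lemma norm_le_of_positive_minus:
  fixes h :: "'a::unital_cstar_algebra"
  assumes "is_positive h" "is_positive (of_real t - h)"
  shows "norm h \<le> t"
proof -
  obtain b where b: "is_positive b" "b * b = h" "\<And>z. z * h = h * z \<Longrightarrow> z * b = b * z"
    using positive_sqrt[OF assms(1)] by blast
  obtain c where c: "is_positive c" "c * c = of_real t - h"
    "\<And>z. z * (of_real t - h) = (of_real t - h) * z \<Longrightarrow> z * c = c * z"
    using positive_sqrt[OF assms(2)] by blast
  have t: "t \<ge> 0"
    using positive_add[OF assms] by (simp add: positive_of_real)
  have "b * h = h * b" by (metis b(2) mult.assoc)
  then have "b * c = c * b"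
    by (intro c(3)) (simp add: algebra_simps of_real_def)
  then have "(norm b)\<^sup>2 \<le> norm (b * b + c * c)"
    using b(1) c(1) by (intro norm_le_norm_sum_of_squares) (auto simp: positive_selfadjoint)
  then have "(norm b)\<^sup>2 \<le> t" using b(2) c(2) t by simp
  then show ?thesis using norm_square_selfadjoint[of b] b positive_selfadjoint by metis
qed

lemma norm_mono_positive:
  assumes "is_positive g" "is_positive (h - g)"
  shows "norm g \<le> norm h"
proof (rule norm_le_of_positive_minus[OF assms(1)])
  have "star h = h" using positive_selfadjoint[OF positive_add[OF assms]] by simp
  from positive_add[OF positive_norm_minus[OF this] assms(2)]
  show "is_positive (of_real (norm h) - g)" by simp
qed

lemma bernoulli_positive:
  assumes d: "is_positive (d::'a::unital_cstar_algebra)"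
  shows "is_positive ((1 + d) ^ n - 1 - of_nat n * d)"
proof (induction n)
  case 0
  then show ?case using positive_of_real[of 0] by simp
next
  case (Suc n)
  let ?r = "(1 + d) ^ n - 1 - of_nat n * d"
  have comm: "(1 + d) ^ n * d = d * (1 + d) ^ n"
    by (rule power_commuting_commutes) (simp add: algebra_simps)
  have nd: "d * of_nat n = of_nat n * d" by (rule mult_of_nat_commute[symmetric])
  have nd': "d * (of_nat n * y) = of_nat n * (d * y)" for y
    by (metis nd mult.assoc)
  have "is_positive (1 + d)" using positive_add[OF _ d] positive_of_real[of 1] by simp
  then have "is_positive ((1 + d) * ?r)"
    by (rule positive_mult[OF _ Suc])
      (simp add: distrib_left distrib_right right_diff_distrib left_diff_distrib comm mult.assoc nd nd')
  moreover have "is_positive (real n *\<^sub>R (d * d))"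
    by (intro positive_scaleR positive_square positive_selfadjoint[OF d]) simp
  ultimately have "is_positive ((1 + d) * ?r + real n *\<^sub>R (d * d))" by (rule positive_add)
  moreover have "(1 + d) * ?r + real n *\<^sub>R (d * d) = (1 + d) ^ Suc n - 1 - of_nat (Suc n) * d"
    by (simp add: distrib_right right_diff_distrib scaleR_conv_of_real mult.assoc[symmetric] nd)
  ultimately show ?case by simp
qed

text \<open>The sum is twice the sum of the squares of the real and the imaginary part of \<open>c\<close>.\<close>

lemma positive_star_mult_add:
  fixes c :: "'a::unital_cstar_algebra"
  shows "is_positive (star c * c + c * star c)"
proof -
  let ?x = "c + star c" and ?y = "\<i> *\<^sub>C (c - star c)"
  have "is_positive (?x * ?x)" by (rule positive_square) (simp add: star_add star_star)
  moreover have "is_positive (?y * ?y)"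
    by (rule positive_square)
      (simp add: star_diff star_star star_scaleC scaleC_minus_left scaleC_diff_right)
  ultimately have "is_positive ((1/2) *\<^sub>R (?x * ?x + ?y * ?y))"
    by (intro positive_scaleR positive_add) auto
  moreover have "(1/2) *\<^sub>R (?x * ?x + ?y * ?y) = star c * c + c * star c"
  proof -
    have "?x * ?x + ?y * ?y = 2 *\<^sub>R (star c * c + c * star c)"
      by (simp add: scaleC_mult_left scaleC_mult_right scaleC_scaleC scaleC_minus1_left algebra_simps
          scaleR_2 scaleC_add_right scaleC_diff_right)
    then show ?thesis by simp
  qed
  ultimately show ?thesis by simp
qed

text \<open>Put \<open>d = - c\<^sup>*c\<close> and \<open>q = cc\<^sup>*\<close>, both positive. From \<open>q c = - c d\<close> one gets
  \<open>c\<^sup>*(1 - q/t)\<^sup>nc = - d(1 + d/t)\<^sup>n\<close>. For large \<open>t\<close> the left side is bounded in \<open>n\<close>, while by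
  Bernoulli's inequality the right side grows unless \<open>d = 0\<close>.\<close>

lemma star_mult_negative_imp_zero:
  fixes c :: "'a::unital_cstar_algebra"
  assumes neg: "is_positive (- (star c * c))"
  shows "c = 0"
proof -
  define q where "q = c * star c"
  have "is_positive q"
    using positive_add[OF positive_star_mult_add[of c] neg] by (simp add: q_def)
  then obtain t0 where t0: "t0 \<ge> 0" "norm (of_real t0 - q) \<le> t0" by (auto simp: is_positive_def)
  define t where "t = t0 + 1"
  have t: "t > 0" using t0 by (simp add: t_def)
  have "norm (of_real t - q) \<le> norm (of_real t0 - q) + norm (1::'a)"
    using norm_triangle_ineq[of "of_real t0 - q" 1] by (simp add: t_def algebra_simps)
  then have nt: "norm (of_real t - q) \<le> t" using t0 by (simp add: t_def)
  define d where "d = (1/t) *\<^sub>R (- (star c * c))"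
  have d: "is_positive d" unfolding d_def using t by (intro positive_scaleR neg) simp
  define z where "z = (1/t) *\<^sub>R (of_real t - q)"
  have nz: "norm z \<le> 1" using nt t by (simp add: z_def)
  have z1: "z = 1 - (1/t) *\<^sub>R q" using t by (simp add: z_def algebra_simps of_real_def)
  have "z * c = c * (1 + d)" by (simp add: z1 d_def q_def algebra_simps)
  then have zc: "z ^ n * c = c * (1 + d) ^ n" for n
    by (induction n) (simp_all add: mult.assoc power_Suc2 del: power_Suc, metis mult.assoc power_Suc power_Suc2)
  have bound: "real n * (norm d)\<^sup>2 \<le> (norm c)\<^sup>2 / t" for n
  proof -
    let ?e = "d * (1 + d) ^ n"
    have comm: "(1 + d) ^ n * d = d * (1 + d) ^ n"
      by (rule power_commuting_commutes) (simp add: algebra_simps)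
    have sa: "star d = d" by (rule positive_selfadjoint[OF d])
    have dd: "is_positive (real n *\<^sub>R (d * d))" by (intro positive_scaleR positive_square sa) simp
    have "is_positive (d * ((1 + d) ^ n - 1 - of_nat n * d))"
      by (rule positive_mult[OF d bernoulli_positive[OF d]])
        (simp add: right_diff_distrib left_diff_distrib comm mult.assoc mult_of_nat_commute[of n d])
    then have "is_positive (d * ((1 + d) ^ n - 1 - of_nat n * d) + d)" by (rule positive_add[OF _ d])
    also have "d * ((1 + d) ^ n - 1 - of_nat n * d) + d = ?e - d * of_nat n * d"
      by (simp add: right_diff_distrib mult.assoc)
    also have "d * of_nat n * d = real n *\<^sub>R (d * d)"
      by (simp add: mult_of_nat_commute[of n d, symmetric] scaleR_conv_of_real mult.assoc)
    finally have "norm (real n *\<^sub>R (d * d)) \<le> norm ?e" by (rule norm_mono_positive[OF dd])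
    also have "?e = (- 1 / t) *\<^sub>R (star c * (c * (1 + d) ^ n))"
      by (subst (1) d_def) (simp add: mult.assoc)
    also have "norm \<dots> = norm (star c * (z ^ n * c)) / t" using t by (simp add: zc)
    also have "\<dots> \<le> (norm (star c) * (norm (z ^ n) * norm c)) / t"
      using t by (intro divide_right_mono order_trans[OF norm_mult_ineq] mult_left_mono norm_mult_ineq) auto
    also have "\<dots> \<le> (norm c)\<^sup>2 / t"
    proof -
      have "norm (z ^ n) \<le> 1"
        by (rule order_trans[OF norm_power_ineq power_le_one]) (use nz in auto)
      then have "norm c * (norm (z ^ n) * norm c) \<le> norm c * (1 * norm c)"
        by (intro mult_left_mono mult_right_mono) auto
      then show ?thesis using t by (intro divide_right_mono) (auto simp: power2_eq_square)
    qed
    finally show ?thesis using norm_square_selfadjoint[OF sa] by simp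
  qed
  have "norm d = 0"
  proof (rule ccontr)
    assume "norm d \<noteq> 0"
    then have "(norm d)\<^sup>2 > 0" by simp
    then obtain n where "real n * (norm d)\<^sup>2 > (norm c)\<^sup>2 / t" using reals_Archimedean3 by blast
    then show False using bound[of n] by simp
  qed
  then have "star c * c = 0" using t by (simp add: d_def)
  then show ?thesis by (simp add: star_mult_eq_zero)
qed

text \<open>Let \<open>h = a\<^sup>*a\<close>, let \<open>k\<close> be the positive square root of \<open>h\<^sup>2\<close> and \<open>m = k - h\<close>, twice the
  negative part of \<open>h\<close>. As \<open>(k - h)(k + h) = 0\<close>, the element \<open>c = am\<close> satisfies
  \<open>c\<^sup>*c = mhm = - m\<^sup>3/2\<close>, which is negative; hence \<open>m = 0\<close> and \<open>h = k\<close>.\<close>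

theorem positive_star_mult:
  fixes a :: "'a::unital_cstar_algebra"
  shows "is_positive (star a * a)"
proof -
  define h where "h = star a * a"
  have sh: "star h = h" by (simp add: h_def star_mult star_star)
  obtain k where k: "is_positive k" "k * k = h * h" "\<And>z. z * (h * h) = h * h * z \<Longrightarrow> z * k = k * z"
    using positive_sqrt[OF positive_square[OF sh]] by blast
  have hk: "h * k = k * h" by (rule k(3)) (simp add: mult.assoc)
  define m where "m = k - h"
  have sm: "star m = m" using k(1) sh by (simp add: m_def star_diff positive_selfadjoint)
  have mk: "m * k = k * m" by (simp add: m_def algebra_simps hk)
  have "m * (m + 2 *\<^sub>R h) = 0"
    by (simp add: m_def algebra_simps scaleR_2 k(2) hk)
  then have mh: "2 *\<^sub>R (m * h) = - (m * m)" by (simp add: algebra_simps eq_neg_iff_add_eq_0)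
  have "m * m = 2 *\<^sub>R (k * m)" by (simp add: m_def algebra_simps scaleR_2 k(2) hk)
  then have m3: "m * m * m = 2 *\<^sub>R (k * (m * m))" by (simp add: mult.assoc)
  have "k * (m * m) = m * m * k" using mk by (metis mult.assoc)
  then have "is_positive (k * (m * m))" by (rule positive_mult[OF k(1) positive_square[OF sm]])
  moreover have "- (star (a * m) * (a * m)) = k * (m * m)"
  proof -
    have "star (a * m) * (a * m) = m * h * m" by (simp add: star_mult sm h_def mult.assoc)
    then have "2 *\<^sub>R (star (a * m) * (a * m)) = 2 *\<^sub>R (m * h) * m" by simp
    also have "\<dots> = 2 *\<^sub>R (- (k * (m * m)))" by (simp only: mh m3 mult_minus_left scaleR_minus_right)
    finally show ?thesis by (simp only: scaleR_cancel_left) simp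
  qed
  ultimately have "a * m = 0" using star_mult_negative_imp_zero[of "a * m"] by simp
  then have "k * (m * m) = 0" using \<open>- (star (a * m) * (a * m)) = k * (m * m)\<close> by simp
  then have "(m * m) * (m * m) = 0" using m3 by (metis mult.assoc mult_zero_right scaleR_zero_right mult_zero_left)
  then have "m * m = 0" using norm_square_selfadjoint[of "m * m"] by (simp add: star_mult sm)
  then have "m = 0" using norm_square_selfadjoint[OF sm] by simp
  then show ?thesis using k(1) by (simp add: m_def h_def)
qed

section \<open>Faithful positive functionals\<close>

definition sublinear :: "('v::real_vector \<Rightarrow> real) \<Rightarrow> bool" where
  "sublinear p \<longleftrightarrow> (\<forall>x y. p (x + y) \<le> p x + p y) \<and> (\<forall>r\<ge>0. \<forall>x. p (r *\<^sub>R x) = r * p x)"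

lemma sublinearI:
  assumes add: "\<And>x y. p (x + y) \<le> p x + p y" and zero: "p 0 = 0"
    and scale: "\<And>r x. r > 0 \<Longrightarrow> p (r *\<^sub>R x) \<le> r * p x"
  shows "sublinear p"
proof -
  have "p (r *\<^sub>R x) = r * p x" if r: "r > 0" for r x
  proof (rule antisym[OF scale[OF r]])
    have "p ((1/r) *\<^sub>R (r *\<^sub>R x)) \<le> 1/r * p (r *\<^sub>R x)" by (rule scale) (use r in simp)
    then show "r * p x \<le> p (r *\<^sub>R x)" using r by (simp add: field_simps)
  qed
  then show ?thesis using add zero unfolding sublinear_def by (metis less_eq_real_def mult_zero_left scaleR_zero_left)
qed

lemma sublinear_add: "sublinear p \<Longrightarrow> p (x + y) \<le> p x + p y"
  and sublinear_scale: "sublinear p \<Longrightarrow> r \<ge> 0 \<Longrightarrow> p (r *\<^sub>R x) = r * p x"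
  by (auto simp: sublinear_def)

lemma sublinear_zero: "sublinear p \<Longrightarrow> p 0 = 0"
  using sublinear_scale[of p 0 0] by simp

lemma sublinear_minus: "sublinear p \<Longrightarrow> - p (- x) \<le> p x"
  using sublinear_add[of p x "- x"] sublinear_zero[of p] by simp

text \<open>The largest sublinear functional below \<open>q\<close> whose value at \<open>- x\<close> is \<open>- q x\<close>; it is linear on the
  line through \<open>x\<close>.\<close>

definition linearize :: "('v::real_vector \<Rightarrow> real) \<Rightarrow> 'v \<Rightarrow> 'v \<Rightarrow> real" where
  "linearize q x y = (INF t\<in>{0..}. q (y + t *\<^sub>R x) - t * q x)"

lemma linearize_lower_bound:
  assumes "sublinear q" "t \<ge> 0"
  shows "- q (- y) \<le> q (y + t *\<^sub>R x) - t * q x"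
  using sublinear_add[OF assms(1), of "y + t *\<^sub>R x" "- y"] sublinear_scale[OF assms, of x] by simp

lemma linearize_le:
  assumes "sublinear q" "t \<ge> 0"
  shows "linearize q x y \<le> q (y + t *\<^sub>R x) - t * q x"
  unfolding linearize_def
  by (rule cINF_lower[OF bdd_belowI2[of _ "- q (- y)"]]) (use assms linearize_lower_bound in auto)

lemma linearize_greatest:
  "(\<And>t. t \<ge> 0 \<Longrightarrow> c \<le> q (y + t *\<^sub>R x) - t * q x) \<Longrightarrow> c \<le> linearize q x y"
  unfolding linearize_def by (rule cINF_greatest) auto

lemma linearize_le_self: "sublinear q \<Longrightarrow> linearize q x y \<le> q y"
  using linearize_le[of q 0 x y] by simp

lemma linearize_minus: "sublinear q \<Longrightarrow> linearize q x (- x) \<le> - q x"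
  using linearize_le[of q 1 x "- x"] sublinear_zero[of q] by simp

lemma sublinear_linearize:
  assumes q: "sublinear q"
  shows "sublinear (linearize q x)"
proof (rule sublinearI)
  fix y z
  have "linearize q x (y + z) - (q (z + u *\<^sub>R x) - u * q x) \<le> linearize q x y" if u: "u \<ge> 0" for u
  proof (rule linearize_greatest)
    fix t :: real assume t: "t \<ge> 0"
    have "linearize q x (y + z) \<le> q ((y + t *\<^sub>R x) + (z + u *\<^sub>R x)) - (t + u) * q x"
      using linearize_le[OF q, of "t + u" x "y + z"] t u by (simp add: algebra_simps)
    then show "linearize q x (y + z) - (q (z + u *\<^sub>R x) - u * q x) \<le> q (y + t *\<^sub>R x) - t * q x"
      using sublinear_add[OF q, of "y + t *\<^sub>R x" "z + u *\<^sub>R x"] by (simp add: algebra_simps)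
  qed
  then have "linearize q x (y + z) - linearize q x y \<le> linearize q x z"
    by (intro linearize_greatest) (auto simp: algebra_simps)
  then show "linearize q x (y + z) \<le> linearize q x y + linearize q x z" by simp
next
  have "0 \<le> linearize q x 0"
    by (rule linearize_greatest) (simp add: sublinear_scale[OF q])
  then show "linearize q x 0 = 0" using linearize_le_self[OF q, of x 0] sublinear_zero[OF q] by simp
next
  fix r :: real and y assume r: "r > 0"
  have "linearize q x (r *\<^sub>R y) / r \<le> linearize q x y"
  proof (rule linearize_greatest)
    fix t :: real assume t: "t \<ge> 0"
    have "linearize q x (r *\<^sub>R y) \<le> q (r *\<^sub>R (y + t *\<^sub>R x)) - (r * t) * q x"
      using linearize_le[OF q, of "r * t" x "r *\<^sub>R y"] t r by (simp add: algebra_simps)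
    also have "\<dots> = r * (q (y + t *\<^sub>R x) - t * q x)"
      using r sublinear_scale[OF q, of r "y + t *\<^sub>R x"] by (simp add: right_diff_distrib mult.assoc)
    finally show "linearize q x (r *\<^sub>R y) / r \<le> q (y + t *\<^sub>R x) - t * q x"
      using r by (simp add: field_simps)
  qed
  then show "linearize q x (r *\<^sub>R y) \<le> r * linearize q x y" using r by (simp add: field_simps)
qed

text \<open>Linearize along \<open>x0\<close> and then along a dense sequence. The limit is odd on that sequence, hence
  everywhere by continuity, and an odd sublinear functional is linear.\<close>

theorem separable_hahn_banach:
  fixes p :: "'v::real_normed_vector \<Rightarrow> real" and d :: "nat \<Rightarrow> 'v"
  assumes p: "sublinear p" "\<And>x. p x \<le> norm x"
    and dense: "\<And>x \<epsilon>. \<epsilon> > 0 \<Longrightarrow> \<exists>n. norm (x - d n) < \<epsilon>"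
  obtains \<phi> where "linear \<phi>" "\<And>x. \<phi> x \<le> p x" "\<phi> x0 = p x0"
proof -
  define q where "q = rec_nat (linearize p x0) (\<lambda>n f. linearize f (d n))"
  have q0: "q 0 = linearize p x0" and qS: "q (Suc n) = linearize (q n) (d n)" for n
    by (simp_all add: q_def)
  have sub: "sublinear (q n)" for n
    by (induction n) (simp_all add: q0 qS sublinear_linearize p(1))
  have dec: "decseq (\<lambda>n. q n x)" for x
    by (rule decseq_SucI) (simp add: qS linearize_le_self sub)
  have qp: "q n x \<le> p x" for n x
    using decseqD[OF dec, of 0 n x] linearize_le_self[OF p(1), of x0 x] by (simp add: q0)
  have low: "- norm x \<le> q n x" for n x
    using sublinear_minus[OF sub, of n x] qp[of n "- x"] p(2)[of "- x"] by simp
  have "convergent (\<lambda>n. q n x)" for x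
  proof -
    obtain l where "(\<lambda>n. q n x) \<longlonglongrightarrow> l"
      using decseq_convergent[OF dec, of "- norm x" x] low by blast
    then show ?thesis by (auto simp: convergent_def)
  qed
  then obtain \<phi> where lim: "\<And>x. (\<lambda>n. q n x) \<longlonglongrightarrow> \<phi> x" unfolding convergent_def by metis
  have \<phi>q: "\<phi> x \<le> q n x" for x n by (rule decseq_ge[OF dec lim])
  have add: "\<phi> (x + y) \<le> \<phi> x + \<phi> y" for x y
    by (rule LIMSEQ_le[OF lim tendsto_add[OF lim lim]]) (auto intro: sublinear_add[OF sub])
  have scale: "\<phi> (r *\<^sub>R x) = r * \<phi> x" if "r \<ge> 0" for r x
  proof (rule LIMSEQ_unique[OF lim])
    show "(\<lambda>n. q n (r *\<^sub>R x)) \<longlonglongrightarrow> r * \<phi> x"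
      unfolding sublinear_scale[OF sub that] by (intro tendsto_intros lim)
  qed
  have s\<phi>: "sublinear \<phi>" using add scale by (simp add: sublinear_def)
  have \<phi>n: "\<phi> x \<le> norm x" for x using \<phi>q[of x 0] qp[of 0 x] p(2)[of x] by linarith
  have odd: "\<phi> (- x) = - \<phi> x" for x
  proof (rule antisym)
    show "\<phi> (- x) \<le> - \<phi> x"
    proof (rule field_le_epsilon)
      fix \<epsilon> :: real assume "\<epsilon> > 0"
      then obtain n where n: "norm (x - d n) < \<epsilon> / 2" using dense[of "\<epsilon> / 2" x] by auto
      have "\<phi> (- d n) \<le> - q n (d n)"
        using \<phi>q[of "- d n" "Suc n"] linearize_minus[OF sub, of n "d n"] by (simp add: qS)
      then have "\<phi> (- d n) \<le> - \<phi> (d n)" using \<phi>q[of "d n" n] by linarith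
      moreover have "\<phi> (- x) \<le> \<phi> (- d n) + \<phi> (d n - x)" using add[of "- d n" "d n - x"] by simp
      moreover have "\<phi> x \<le> \<phi> (d n) + \<phi> (x - d n)" using add[of "d n" "x - d n"] by simp
      ultimately show "\<phi> (- x) \<le> - \<phi> x + \<epsilon>"
        using n \<phi>n[of "d n - x"] \<phi>n[of "x - d n"] by (simp add: norm_minus_commute)
    qed
    show "- \<phi> x \<le> \<phi> (- x)" using sublinear_minus[OF s\<phi>, of "- x"] by simp
  qed
  have "linear \<phi>"
  proof (rule linearI)
    show "\<phi> (x + y) = \<phi> x + \<phi> y" for x y
      using add[of x y] add[of "- x" "- y"] odd[of "x + y"] odd[of x] odd[of y] by simp
    show "\<phi> (r *\<^sub>R x) = r *\<^sub>R \<phi> x" for r x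
      using scale[of r x] scale[of "- r" x] odd[of "r *\<^sub>R x"] by (cases "r \<ge> 0") auto
  qed
  moreover have "\<phi> x \<le> p x" for x using \<phi>q[of x 0] qp[of 0 x] by linarith
  moreover have "p x0 \<le> \<phi> x0"
    using \<phi>q[of "- x0" 0] linearize_minus[OF p(1), of x0] odd[of x0] by (simp add: q0)
  ultimately show ?thesis using that by (metis antisym)
qed


text \<open>The supremum of the spectrum of the real part of \<open>x\<close>.\<close>

definition spectral_bound :: "'a::unital_cstar_algebra \<Rightarrow> real" where
  "spectral_bound x = Inf {t. is_positive (of_real t - (1/2) *\<^sub>R (x + star x))}"

lemma spectral_bound_set_norm:
  fixes x :: "'a::unital_cstar_algebra"
  shows "is_positive (of_real (norm x) - (1/2) *\<^sub>R (x + star x))"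
proof -
  let ?h = "(1/2) *\<^sub>R (x + star x)"
  have "norm ?h \<le> norm x" using norm_triangle_ineq[of x "star x"] by simp
  then have "is_positive (of_real (norm x - norm ?h) :: 'a)" by (simp only: positive_of_real)
  moreover have "is_positive (of_real (norm ?h) - ?h)"
    by (rule positive_norm_minus) (simp add: star_scaleR star_add star_star add.commute)
  ultimately have "is_positive (of_real (norm x - norm ?h) + (of_real (norm ?h) - ?h))"
    by (rule positive_add)
  then show ?thesis by (simp add: of_real_diff)
qed

lemma spectral_bound_set_ge:
  fixes x :: "'a::unital_cstar_algebra"
  assumes "is_positive (of_real t - (1/2) *\<^sub>R (x + star x))"
  shows "- norm x \<le> t"
proof -
  have "is_positive ((of_real t - (1/2) *\<^sub>R (x + star x)) +
      (of_real (norm (- x)) - (1/2) *\<^sub>R (- x + star (- x))))"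
    by (rule positive_add[OF assms spectral_bound_set_norm])
  also have "(of_real t - (1/2) *\<^sub>R (x + star x)) +
      (of_real (norm (- x)) - (1/2) *\<^sub>R (- x + star (- x))) = (of_real (t + norm x) :: 'a)"
    by (simp add: algebra_simps star_minus)
  finally show ?thesis by (simp only: positive_of_real)
qed

lemma spectral_bound_le:
  "is_positive (of_real t - (1/2) *\<^sub>R (x + star x)) \<Longrightarrow> spectral_bound x \<le> t"
  unfolding spectral_bound_def
  by (rule cInf_lower) (auto intro!: bdd_belowI[of _ "- norm x"] spectral_bound_set_ge)

lemma spectral_bound_greatest:
  "(\<And>t. is_positive (of_real t - (1/2) *\<^sub>R (x + star x)) \<Longrightarrow> c \<le> t) \<Longrightarrow> c \<le> spectral_bound x"
  unfolding spectral_bound_def using spectral_bound_set_norm[of x] by (intro cInf_greatest) auto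

lemma spectral_bound_le_norm: "spectral_bound x \<le> norm x"
  by (rule spectral_bound_le[OF spectral_bound_set_norm])

lemma sublinear_spectral_bound: "sublinear (spectral_bound :: 'a::unital_cstar_algebra \<Rightarrow> real)"
proof (rule sublinearI)
  fix x y :: 'a
  have "spectral_bound (x + y) - t \<le> spectral_bound y"
    if t: "is_positive (of_real t - (1/2) *\<^sub>R (x + star x))" for t
  proof (rule spectral_bound_greatest)
    fix u assume "is_positive (of_real u - (1/2) *\<^sub>R (y + star y))"
    from positive_add[OF t this] have "spectral_bound (x + y) \<le> t + u"
      by (intro spectral_bound_le) (simp add: algebra_simps star_add)
    then show "spectral_bound (x + y) - t \<le> u" by simp
  qed
  then have "spectral_bound (x + y) - spectral_bound y \<le> spectral_bound x"
    by (intro spectral_bound_greatest) (auto simp: algebra_simps)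
  then show "spectral_bound (x + y) \<le> spectral_bound x + spectral_bound y" by simp
next
  have "0 \<le> spectral_bound (0::'a)"
    by (rule spectral_bound_greatest) (simp add: positive_of_real)
  then show "spectral_bound (0::'a) = 0" using spectral_bound_le_norm[of "0::'a"] by simp
next
  fix r :: real and x :: 'a assume r: "r > 0"
  have "spectral_bound (r *\<^sub>R x) / r \<le> spectral_bound x"
  proof (rule spectral_bound_greatest)
    fix t assume "is_positive (of_real t - (1/2) *\<^sub>R (x + star x))"
    then have "is_positive (r *\<^sub>R (of_real t - (1/2) *\<^sub>R (x + star x)))"
      using r by (intro positive_scaleR) auto
    then have "spectral_bound (r *\<^sub>R x) \<le> r * t"
      by (intro spectral_bound_le)
        (simp add: star_scaleR scaleR_diff_right scaleR_add_right of_real_def mult.commute)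
    then show "spectral_bound (r *\<^sub>R x) / r \<le> t" using r by (simp add: field_simps)
  qed
  then show "spectral_bound (r *\<^sub>R x) \<le> r * spectral_bound x" using r by (simp add: field_simps)
qed

lemma spectral_bound_negative: "is_positive (- x) \<Longrightarrow> spectral_bound x \<le> 0"
proof (rule spectral_bound_le)
  assume x: "is_positive (- x)"
  then have "star x = x" using positive_selfadjoint[OF x] by (simp add: star_minus)
  then show "is_positive (of_real 0 - (1/2) *\<^sub>R (x + star x))" using x by (simp add: scaleR_2[symmetric])
qed

lemma spectral_bound_star_mult: "(norm a)\<^sup>2 \<le> spectral_bound (star a * a)"
proof (rule spectral_bound_greatest)
  fix t assume "is_positive (of_real t - (1/2) *\<^sub>R (star a * a + star (star a * a)))"
  then have "is_positive (of_real t - star a * a)"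
    by (simp add: star_mult star_star scaleR_2[symmetric])
  then show "(norm a)\<^sup>2 \<le> t"
    using norm_le_of_positive_minus[OF positive_star_mult] by (simp add: norm_star_mult)
qed

lemma spectral_bound_antihermitian: "star x = - x \<Longrightarrow> spectral_bound x \<le> 0"
  by (rule spectral_bound_le) (use positive_of_real[of 0] in simp)

text \<open>For each member of a dense sequence take a functional that is dominated by the spectral bound
  and attains it there. Domination makes these functionals positive. At \<open>a\<^sup>*a\<close> the spectral bound is
  at least \<open>(norm a)\<^sup>2\<close>, so the functional of a nearby member is nonzero there, and a weighted sum
  of all of them is faithful.\<close>

theorem faithful_positive_functional:
  fixes d :: "nat \<Rightarrow> 'a::unital_cstar_algebra"
  assumes dense: "\<And>x \<epsilon>. \<epsilon> > 0 \<Longrightarrow> \<exists>n. norm (x - d n) < \<epsilon>"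
  obtains \<phi> :: "'a \<Rightarrow> real" where "linear \<phi>" "\<And>x. \<bar>\<phi> x\<bar> \<le> 2 * norm x" "\<And>h. is_positive h \<Longrightarrow> 0 \<le> \<phi> h"
    "\<And>x. \<phi> (star x) = \<phi> x" "\<And>a. a \<noteq> 0 \<Longrightarrow> 0 < \<phi> (star a * a)"
proof -
  have "\<exists>f. linear f \<and> (\<forall>x. f x \<le> spectral_bound x) \<and> f (d n) = spectral_bound (d n)" for n
    using separable_hahn_banach[OF sublinear_spectral_bound spectral_bound_le_norm dense, of "d n"]
    by metis
  then obtain f where f: "\<And>n. linear (f n)" "\<And>n x. f n x \<le> spectral_bound x"
    "\<And>n. f n (d n) = spectral_bound (d n)" by metis
  note lin = linear_add[OF f(1)] linear_diff[OF f(1)] linear_neg[OF f(1)] linear_scale[OF f(1)]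
  have fn: "f n x \<le> norm x" for n x
    using f(2)[of n x] spectral_bound_le_norm[of x] by linarith
  have absf: "\<bar>f n x\<bar> \<le> norm x" for n x
    using fn[of n x] fn[of n "- x"] by (simp add: lin)
  have fpos: "0 \<le> f n h" if "is_positive h" for n h
    using f(2)[of n "- h"] spectral_bound_negative[of "- h"] that by (simp add: lin)
  have fstar: "f n (star x) = f n x" for n x
  proof -
    have "star (star x - x) = - (star x - x)" "star (x - star x) = - (x - star x)"
      by (simp_all add: star_diff star_star)
    then show ?thesis
      using f(2)[of n "star x - x"] f(2)[of n "x - star x"]
        spectral_bound_antihermitian[of "star x - x"] spectral_bound_antihermitian[of "x - star x"]
      by (simp add: lin)
  qed
  have geo: "summable (\<lambda>n. (1/2) ^ n * c)" for c :: real by (intro summable_mult2 summable_geometric) simp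
  have summ: "summable (\<lambda>n. (1/2) ^ n * f n x)" for x
    by (rule summable_comparison_test'[OF geo[of "norm x"], of 0])
      (simp add: abs_mult power_abs absf mult_left_mono)
  define \<phi> where "\<phi> x = (\<Sum>n. (1/2) ^ n * f n x)" for x
  show ?thesis
  proof (rule that[of \<phi>])
    show "linear \<phi>"
    proof (rule linearI)
      show "\<phi> (x + y) = \<phi> x + \<phi> y" for x y
        unfolding \<phi>_def suminf_add[OF summ summ] by (simp add: lin algebra_simps)
      show "\<phi> (r *\<^sub>R x) = r *\<^sub>R \<phi> x" for r x
        unfolding \<phi>_def real_scaleR_def suminf_mult[OF summ, symmetric] by (simp add: lin mult_ac)
    qed
    show "\<bar>\<phi> x\<bar> \<le> 2 * norm x" for x
    proof -
      have "norm (\<phi> x) \<le> (\<Sum>n. (1/2) ^ n * norm x)"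
        unfolding \<phi>_def
        by (rule norm_suminf_le[OF _ geo]) (simp add: abs_mult power_abs absf mult_left_mono)
      also have "\<dots> = 2 * norm x"
        by (subst suminf_mult2[symmetric]) (simp_all add: suminf_geometric summable_geometric)
      finally show ?thesis by simp
    qed
    show "0 \<le> \<phi> h" if "is_positive h" for h
      unfolding \<phi>_def by (intro suminf_nonneg summ) (simp add: fpos[OF that])
    show "\<phi> (star x) = \<phi> x" for x by (simp add: \<phi>_def fstar)
    show "0 < \<phi> (star a * a)" if a: "a \<noteq> 0" for a
    proof -
      let ?h = "star a * a"
      have "(norm a)\<^sup>2 / 2 > 0" using a by simp
      then obtain n where n: "norm (?h - d n) < (norm a)\<^sup>2 / 2" using dense by blast
      have "spectral_bound ?h \<le> spectral_bound (d n) + spectral_bound (?h - d n)"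
        using sublinear_add[OF sublinear_spectral_bound, of "d n" "?h - d n"] by simp
      then have "(norm a)\<^sup>2 \<le> f n (d n) + norm (?h - d n)"
        using spectral_bound_star_mult[of a] spectral_bound_le_norm[of "?h - d n"] f(3)[of n] by linarith
      moreover have "f n (d n) \<le> f n ?h + norm (?h - d n)"
        using fn[of n "d n - ?h"] by (simp add: lin norm_minus_commute)
      ultimately have "0 < f n ?h" using n by linarith
      then have "0 < (1/2) ^ n * f n ?h" by simp
      then show ?thesis
        unfolding \<phi>_def by (intro suminf_pos2[OF summ, of _ n]) (simp_all add: fpos[OF positive_star_mult])
    qed
  qed
qed

section \<open>A faithful representation of a separable C*-algebra\<close>

lemma separable_hilbert_hilbert: "separable_hilbert H \<Longrightarrow> hilbert H"
  by (simp add: separable_hilbert_def)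

lemma separable_hilbertI:
  assumes H: "hilbert H" and C: "countable C" "C \<subseteq> H" "H \<subseteq> closure C"
  shows "separable_hilbert H"
  unfolding separable_hilbert_def separable_space_def
proof (intro conjI exI[of _ C])
  show "(top_of_set H) closure_of C = topspace (top_of_set H)"
    using C by (auto simp: closure_of_subtopology Int_absorb1)
qed (use assms in auto)

lemma separable_hilbertE:
  assumes "separable_hilbert H"
  obtains C where "countable C" "C \<subseteq> H" "H \<subseteq> closure C"
proof -
  obtain C where C: "countable C" "C \<subseteq> H" "(top_of_set H) closure_of C = H"
    using assms by (auto simp: separable_hilbert_def separable_space_def)
  have "H \<subseteq> closure C"
    using C(3) by (auto simp: closure_of_subtopology Int_absorb1[OF C(2)])
  then show ?thesis using that C by blast
qed

lemma separable_hilbert_sequence: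
  assumes "separable_hilbert H"
  obtains a :: "nat \<Rightarrow> 'h::chilbert_space"
  where "\<And>n. a n \<in> H" "\<And>x \<epsilon>. x \<in> H \<Longrightarrow> \<epsilon> > 0 \<Longrightarrow> \<exists>n. norm (x - a n) < \<epsilon>"
proof -
  obtain C where C: "countable C" "C \<subseteq> H" "H \<subseteq> closure C"
    using separable_hilbertE[OF assms] by blast
  have "0 \<in> H" using assms by (simp add: separable_hilbert_def hilbert_csubspace csubspace_zero)
  then have ne: "C \<noteq> {}" using C(3) by auto
  have "\<exists>n. norm (x - from_nat_into C n) < \<epsilon>" if "x \<in> H" "\<epsilon> > 0" for x \<epsilon>
  proof -
    have "x \<in> closure C" using C(3) that(1) by blast
    then obtain c where "c \<in> C" "dist c x < \<epsilon>"
      using \<open>\<epsilon> > 0\<close> by (auto simp: closure_approachable)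
    moreover obtain n where "from_nat_into C n = c"
      using from_nat_into_surj[OF C(1) \<open>c \<in> C\<close>] by blast
    ultimately show ?thesis by (metis dist_commute dist_norm)
  qed
  then show ?thesis using that[of "from_nat_into C"] from_nat_into[OF ne] C(2) by blast
qed

text \<open>With a countable dense set \<open>C\<close> of scalars the union of the stages is countable, and its closure
  is a C*-subalgebra.\<close>

fun stage :: "complex set \<Rightarrow> 'a::unital_cstar_algebra set \<Rightarrow> nat \<Rightarrow> 'a set" where
  "stage C G 0 = insert 0 (insert 1 G)"
| "stage C G (Suc n) = stage C G n \<union> (\<lambda>(x, y). x + y) ` (stage C G n \<times> stage C G n)
     \<union> (\<lambda>(x, y). x * y) ` (stage C G n \<times> stage C G n)
     \<union> star ` stage C G n \<union> (\<lambda>(c, x). c *\<^sub>C x) ` (C \<times> stage C G n)"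

lemma generates_dense_sequence:
  fixes G :: "'a::unital_cstar_algebra set"
  assumes G: "countable G" "generates G"
  obtains d :: "nat \<Rightarrow> 'a" where "\<And>x \<epsilon>. \<epsilon> > 0 \<Longrightarrow> \<exists>n. norm (x - d n) < \<epsilon>"
proof -
  obtain C :: "complex set" where C: "countable C" "\<And>X. open X \<Longrightarrow> X \<noteq> {} \<Longrightarrow> \<exists>c\<in>C. c \<in> X"
    using countable_dense_setE by blast
  have "c \<in> closure C" for c
    unfolding closure_approachable
  proof (intro allI impI)
    fix e :: real assume "e > 0"
    then show "\<exists>y\<in>C. dist y c < e" using C(2)[of "ball c e"] by (auto simp: dist_commute)
  qed
  then have clC: "closure C = UNIV" by blast
  let ?S = "stage C G"
  define D where "D = (\<Union>n. ?S n)"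
  have "countable (?S n)" for n
    by (induction n) (use G(1) C(1) in auto)
  then have cD: "countable D" by (simp add: D_def)
  have mono: "?S m \<subseteq> ?S n" if "m \<le> n" for m n
    using that by (induction rule: dec_induct) auto
  have two: "\<exists>n. x \<in> ?S n \<and> y \<in> ?S n" if "x \<in> D" "y \<in> D" for x y
  proof -
    obtain m n where "x \<in> ?S m" "y \<in> ?S n"
      using \<open>x \<in> D\<close> \<open>y \<in> D\<close> unfolding D_def by blast
    then have "x \<in> ?S (max m n)" "y \<in> ?S (max m n)"
      using mono[of m "max m n"] mono[of n "max m n"] by auto
    then show ?thesis by blast
  qed
  have step: "x \<in> D" if "x \<in> ?S (Suc n)" for x n using that unfolding D_def by blast
  have Dadd: "x + y \<in> D" and Dmult: "x * y \<in> D" if xy: "x \<in> D" "y \<in> D" for x y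
  proof -
    obtain n where n: "x \<in> ?S n" "y \<in> ?S n" using two[OF xy] by blast
    show "x + y \<in> D" by (rule step[of _ n]) (use n in force)
    show "x * y \<in> D" by (rule step[of _ n]) (use n in force)
  qed
  have Dstar: "star x \<in> D" and Dscale: "c \<in> C \<Longrightarrow> c *\<^sub>C x \<in> D" if x: "x \<in> D" for x c
  proof -
    obtain n where n: "x \<in> ?S n" using x by (auto simp: D_def)
    show "star x \<in> D" by (rule step[of _ n]) (use n in force)
    show "c *\<^sub>C x \<in> D" if "c \<in> C" by (rule step[of _ n]) (use n that in force)
  qed
  have DG: "insert 0 (insert 1 G) \<subseteq> D" unfolding D_def using stage.simps(1)[of C G] by blast
  have cl: "f x y \<in> closure D"
    if "continuous_on UNIV (\<lambda>(x, y). f x y)" "\<And>x y. x \<in> A \<Longrightarrow> y \<in> D \<Longrightarrow> f x y \<in> D"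
      "x \<in> closure A" "y \<in> closure D" for f :: "'z::topological_space \<Rightarrow> 'a \<Rightarrow> 'a" and A x y
  proof -
    have "(\<lambda>(x, y). f x y) ` closure (A \<times> D) \<subseteq> closure D"
      using continuous_on_subset[OF that(1)] that(2) closure_subset
      by (intro image_closure_subset) fastforce+
    then show ?thesis using that(3,4) by (auto simp: closure_Times)
  qed
  have "csubspace (closure D)"
    unfolding csubspace_def
  proof (intro conjI ballI allI)
    show "0 \<in> closure D" using DG closure_subset by blast
    show "x + y \<in> closure D" if "x \<in> closure D" "y \<in> closure D" for x y
      by (rule cl[OF _ Dadd that]) (auto simp: case_prod_unfold intro!: continuous_intros)
    show "c *\<^sub>C x \<in> closure D" if "x \<in> closure D" for c x
      using Dscale clC that
      by (intro cl[of "\<lambda>c x. c *\<^sub>C x" C]) (auto simp: case_prod_unfold intro!: continuous_intros)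
  qed
  moreover have "x * y \<in> closure D" if "x \<in> closure D" "y \<in> closure D" for x y
    by (rule cl[OF _ Dmult that]) (auto simp: case_prod_unfold intro!: continuous_intros)
  moreover have "star x \<in> closure D" if "x \<in> closure D" for x
    by (rule cl[of "\<lambda>x y. star y" D x x])
      (use that Dstar in \<open>auto simp: case_prod_unfold intro!: continuous_intros\<close>)
  ultimately have "cstar_subalgebra (closure D)" by (simp add: cstar_subalgebra_def)
  then have "cstar_subalgebra hull (insert 1 G) \<subseteq> closure D"
    using DG closure_subset[of D] by (intro hull_minimal) auto
  then have dense: "x \<in> closure D" for x using G(2) by (auto simp: generates_def)
  have ne: "D \<noteq> {}" using DG by auto
  have "\<exists>n. norm (x - from_nat_into D n) < \<epsilon>" if "\<epsilon> > 0" for x \<epsilon>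
  proof -
    obtain c where "c \<in> D" "dist c x < \<epsilon>"
      using dense[of x] \<open>\<epsilon> > 0\<close> by (auto simp: closure_approachable)
    moreover obtain n where "from_nat_into D n = c"
      using from_nat_into_surj[OF cD \<open>c \<in> D\<close>] by blast
    ultimately show ?thesis by (metis dist_commute dist_norm)
  qed
  then show ?thesis using that by blast
qed

lemma operators_eq_on_closure:
  assumes "S \<in> bounded_ops (closure D) K" "T \<in> bounded_ops (closure D) K'" "csubspace D"
    and "\<And>x. x \<in> D \<Longrightarrow> S x = T x" and "x \<in> closure D"
  shows "S x = T x"
proof -
  note cont = bounded_ops_continuous[OF assms(1) csubspace_closure[OF assms(3)]]
    bounded_ops_continuous[OF assms(2) csubspace_closure[OF assms(3)]]
  have "S x - T x = 0"
    by (rule continuous_constant_on_closure[OF continuous_on_diff[OF cont] _ assms(5)])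
      (simp add: assms(4))
  then show ?thesis by simp
qed

lemma embedding_of_bounded_form:
  fixes E :: "'v::complex_normed_vector set"
    and d :: "nat \<Rightarrow> 'v"
  assumes s: "semi_inner E s" and d: "\<And>n. d n \<in> E"
    and dense: "\<And>x \<epsilon>. x \<in> E \<Longrightarrow> \<epsilon> > 0 \<Longrightarrow> \<exists>n. norm (x - d n) < \<epsilon>"
    and bound: "\<And>x. x \<in> E \<Longrightarrow> Re (s x x) \<le> B * (norm x)\<^sup>2"
  obtains J :: "'v \<Rightarrow> ell2"
  where "\<And>x y. x \<in> E \<Longrightarrow> y \<in> E \<Longrightarrow> J (x + y) = J x + J y"
    and "\<And>c x. x \<in> E \<Longrightarrow> J (c *\<^sub>C x) = c *\<^sub>C J x"
    and "\<And>x y. x \<in> E \<Longrightarrow> y \<in> E \<Longrightarrow> cinner (J x) (J y) = s x y"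
    and "separable_hilbert (closure (J ` E))"
proof -
  interpret semi_inner E s by (rule s)
  have qdense: "\<exists>n. sqnorm (x - d n) < \<epsilon>" if x: "x \<in> E" and "\<epsilon> > 0" for x \<epsilon>
  proof -
    have "sqrt (\<epsilon> / (\<bar>B\<bar> + 1)) > 0" using that by simp
    then obtain n where "norm (x - d n) < sqrt (\<epsilon> / (\<bar>B\<bar> + 1))" using dense[OF x] by blast
    then have "(norm (x - d n))\<^sup>2 < (sqrt (\<epsilon> / (\<bar>B\<bar> + 1)))\<^sup>2" by (intro power_strict_mono) auto
    then have n: "(\<bar>B\<bar> + 1) * (norm (x - d n))\<^sup>2 < \<epsilon>" using that by (simp add: field_simps)
    have "sqnorm (x - d n) \<le> B * (norm (x - d n))\<^sup>2"
      unfolding sqnorm_def by (rule bound[OF csubspace_diff[OF E x d]])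
    also have "\<dots> \<le> (\<bar>B\<bar> + 1) * (norm (x - d n))\<^sup>2" by (intro mult_right_mono) auto
    finally show ?thesis using n by (intro exI[of _ n]) linarith
  qed
  obtain J :: "'v \<Rightarrow> ell2" where J: "\<And>x y. x \<in> E \<Longrightarrow> y \<in> E \<Longrightarrow> J (x + y) = J x + J y"
    "\<And>c x. x \<in> E \<Longrightarrow> J (c *\<^sub>C x) = c *\<^sub>C J x"
    "\<And>x y. x \<in> E \<Longrightarrow> y \<in> E \<Longrightarrow> cinner (J x) (J y) = s x y"
    using embedding_into_ell2[of d, OF d qdense] by blast
  have "separable_hilbert (closure (J ` E))"
  proof (rule separable_hilbertI[of _ "range (\<lambda>n. J (d n))"])
    show "hilbert (closure (J ` E))" by (rule hilbert_closure[OF csubspace_linear_image[OF E J(1,2)]])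
    show "range (\<lambda>n. J (d n)) \<subseteq> closure (J ` E)"
      by (rule subset_trans[OF _ closure_subset]) (use d in auto)
    have "J x \<in> closure (range (\<lambda>n. J (d n)))" if x: "x \<in> E" for x
      unfolding closure_approachable
    proof (intro allI impI)
      fix e :: real assume e: "e > 0"
      then obtain n where n: "sqnorm (x - d n) < e\<^sup>2" using qdense[OF x, of "e\<^sup>2"] by auto
      have m: "x - d n \<in> E" by (rule csubspace_diff[OF E x d])
      have "J x = J (x - d n) + J (d n)" using J(1)[OF m d, of n] by simp
      moreover have "(norm (J (x - d n)))\<^sup>2 = sqnorm (x - d n)"
        using J(3)[OF m m] by (metis cinner_self Re_complex_of_real sqnorm_def)
      ultimately have "dist (J (d n)) (J x) < e"
        using n e by (simp add: dist_norm power2_less_imp_less)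
      then show "\<exists>y\<in>range (\<lambda>n. J (d n)). dist y (J x) < e" by blast
    qed
    then show "closure (J ` E) \<subseteq> closure (range (\<lambda>n. J (d n)))" by (intro closure_minimal) auto
  qed simp
  with J show ?thesis by (rule that)
qed

lemma star_repD:
  assumes "star_rep H \<pi>"
  shows "\<pi> a \<in> bounded_ops H H" "\<pi> 1 = id_op H"
    "x \<in> H \<Longrightarrow> \<pi> (a + b) x = \<pi> a x + \<pi> b x" "x \<in> H \<Longrightarrow> \<pi> (c *\<^sub>C a) x = c *\<^sub>C \<pi> a x"
    "x \<in> H \<Longrightarrow> \<pi> (a * b) x = \<pi> a (\<pi> b x)" "\<pi> (star a) = adjoint_op H H (\<pi> a)"
  using assms by (auto simp: star_rep_def)

lemma star_rep_maps: "star_rep H \<pi> \<Longrightarrow> x \<in> H \<Longrightarrow> \<pi> a x \<in> H"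
  using star_repD(1) bounded_ops_maps by blast

lemma cinner_star_rep:
  assumes "star_rep H \<pi>" "hilbert H" "x \<in> H" "y \<in> H"
  shows "cinner (\<pi> a x) y = cinner x (\<pi> (star a) y)"
  unfolding star_repD(6)[OF assms(1)]
  by (rule cinner_adjoint_op[OF assms(2,2) star_repD(1)[OF assms(1)] assms(3,4)])

lemma star_repI:
  assumes H: "hilbert H" and op: "\<And>a. \<pi> a \<in> bounded_ops H H"
    and "\<And>x. x \<in> H \<Longrightarrow> \<pi> 1 x = x"
    and "\<And>a b x. x \<in> H \<Longrightarrow> \<pi> (a + b) x = \<pi> a x + \<pi> b x"
    and "\<And>c a x. x \<in> H \<Longrightarrow> \<pi> (c *\<^sub>C a) x = c *\<^sub>C \<pi> a x"
    and "\<And>a b x. x \<in> H \<Longrightarrow> \<pi> (a * b) x = \<pi> a (\<pi> b x)"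
    and adj: "\<And>a x y. x \<in> H \<Longrightarrow> y \<in> H \<Longrightarrow> cinner (\<pi> a x) y = cinner x (\<pi> (star a) y)"
  shows "star_rep H \<pi>"
proof -
  have sub: "csubspace H" using H by (rule hilbert_csubspace)
  have "\<pi> 1 = id_op H"
    by (rule bounded_ops_eqI[OF op id_op_bounded_ops[OF sub]]) (simp add: id_op_def assms(3))
  moreover have "\<pi> (star a) = adjoint_op H H (\<pi> a)" for a
    by (rule adjoint_op_eqI[OF sub op adj, symmetric])
  ultimately show ?thesis using assms by (simp add: star_rep_def)
qed

text \<open>The GNS construction for \<open>\<langle>a, b\<rangle> = \<phi>(b\<^sup>*a)\<close>, with the real functional \<open>\<phi>\<close> made complex-linear. Left
  multiplication by \<open>a\<close> is bounded because \<open>x\<^sup>*((norm a)\<^sup>2 - a\<^sup>*a)x\<close> is positive, and \<open>1\<close> is a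
  separating vector because \<open>\<phi>\<close> is faithful.\<close>

lemma positive_functional_representation:
  fixes \<phi> :: "'a::unital_cstar_algebra \<Rightarrow> real" and d :: "nat \<Rightarrow> 'a"
  assumes dense: "\<And>x \<epsilon>. \<epsilon> > 0 \<Longrightarrow> \<exists>n. norm (x - d n) < \<epsilon>"
    and lin: "linear \<phi>" and bound: "\<And>x. \<bar>\<phi> x\<bar> \<le> B * norm x"
    and pos: "\<And>h. is_positive h \<Longrightarrow> 0 \<le> \<phi> h"
    and \<phi>star: "\<And>x. \<phi> (star x) = \<phi> x" and faithful: "\<And>a. a \<noteq> 0 \<Longrightarrow> 0 < \<phi> (star a * a)"
  obtains S :: "ell2 set" and \<sigma> :: "'a \<Rightarrow> ell2 \<Rightarrow> ell2" where "separable_hilbert S" "faithful_rep S \<sigma>"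
proof -
  note l = linear_add[OF lin] linear_diff[OF lin] linear_neg[OF lin] linear_scale[OF lin]
  define F where "F x = Complex (\<phi> x) (- \<phi> (\<i> *\<^sub>C x))" for x
  have Fadd: "F (x + y) = F x + F y" for x y
    by (simp add: F_def l scaleC_add_right complex_eq_iff)
  have Fscale: "F (c *\<^sub>C x) = c * F x" for c x
  proof -
    have c: "c *\<^sub>C x = Re c *\<^sub>R x + Im c *\<^sub>R (\<i> *\<^sub>C x)"
      by (simp add: scaleR_scaleC scaleC_scaleC scaleC_add_left[symmetric] complex_eq[symmetric] mult.commute)
    have ic: "\<i> *\<^sub>C c *\<^sub>C x = Re c *\<^sub>R (\<i> *\<^sub>C x) - Im c *\<^sub>R x"
      unfolding c scaleC_add_right scaleR_scaleC_commute[symmetric]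
      by (simp add: scaleC_scaleC scaleC_minus1_left)
    show ?thesis unfolding F_def ic by (simp add: c l complex_eq_iff)
  qed
  have Fstar: "F (star x) = cnj (F x)" for x
  proof -
    have "\<i> *\<^sub>C star x = - star (\<i> *\<^sub>C x)" by (simp add: star_scaleC scaleC_minus_left)
    then show ?thesis by (simp add: F_def \<phi>star l complex_eq_iff)
  qed
  define s where "s x y = F (star y * x)" for x y
  have sq: "Re (s x x) = \<phi> (star x * x)" for x by (simp add: s_def F_def)
  interpret semi_inner UNIV s
  proof
    fix x y z :: 'a and c
    show "s (x + y) z = s x z + s y z" by (simp add: s_def distrib_left Fadd)
    show "s (c *\<^sub>C x) y = c * s x y" by (simp add: s_def scaleC_mult_right Fscale)
    show "s x y = cnj (s y x)" unfolding s_def Fstar[symmetric] by (simp add: star_mult star_star)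
    show "0 \<le> Re (s x x)" unfolding sq by (rule pos[OF positive_star_mult])
  qed (rule csubspace_UNIV)
  have sqnorm: "sqnorm x = \<phi> (star x * x)" for x by (simp add: sqnorm_def sq)
  have sqnorm_le: "sqnorm x \<le> B * (norm x)\<^sup>2" for x
    using bound[of "star x * x"] by (simp add: sqnorm norm_star_mult)
  obtain J :: "'a \<Rightarrow> ell2" where Jadd: "\<And>x y. J (x + y) = J x + J y"
    and Jscale: "\<And>c x. J (c *\<^sub>C x) = c *\<^sub>C J x" and Js: "\<And>x y. cinner (J x) (J y) = s x y"
    and Jsep: "separable_hilbert (closure (range J))"
  proof (rule embedding_of_bounded_form[of UNIV s d B])
    show "Re (s x x) \<le> B * (norm x)\<^sup>2" for x using sqnorm_le[of x] by (simp add: sqnorm_def)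
    show "\<exists>n. norm (x - d n) < \<epsilon>" if "\<epsilon> > 0" for x \<epsilon> by (rule dense[OF that])
    fix J :: "'a \<Rightarrow> ell2"
    assume "\<And>x y. x \<in> UNIV \<Longrightarrow> y \<in> UNIV \<Longrightarrow> J (x + y) = J x + J y"
      "\<And>c x. x \<in> UNIV \<Longrightarrow> J (c *\<^sub>C x) = c *\<^sub>C J x"
      "\<And>x y. x \<in> UNIV \<Longrightarrow> y \<in> UNIV \<Longrightarrow> cinner (J x) (J y) = s x y"
      "separable_hilbert (closure (range J))"
    then show thesis by (intro that[of J]) simp_all
  qed (rule semi_inner_axioms, simp)
  have Jdiff: "J (x - y) = J x - J y" for x y
    using Jadd[of x "- y"] Jscale[of "-1" y] by (simp add: scaleC_minus1_left)
  have Jq: "(norm (J x))\<^sup>2 = sqnorm x" for x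
    using Js[of x x] s_self[of x] by (metis cinner_self of_real_eq_iff UNIV_I)
  have "x = y" if "J x = J y" for x y
  proof (rule ccontr)
    assume "x \<noteq> y"
    then have "0 < sqnorm (x - y)" using faithful[of "x - y"] by (simp add: sqnorm)
    then show False using Jq[of "x - y"] that by (simp add: Jdiff)
  qed
  then have inj: "inj J" by (rule injI)
  have sub: "csubspace (range J)"
    by (rule csubspace_linear_image[OF csubspace_UNIV]) (rule Jadd Jscale)+
  define S where "S = closure (range J)"
  have S: "hilbert S" unfolding S_def by (rule hilbert_closure[OF sub])
  have JS: "J x \<in> S" for x unfolding S_def by (rule subsetD[OF closure_subset]) simp
  have contract: "sqnorm (a * x) \<le> (norm a)\<^sup>2 * sqnorm x" for a x
  proof -
    have "is_positive (of_real ((norm a)\<^sup>2) - star a * a)"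
      using positive_norm_minus[of "star a * a"] by (simp add: star_mult star_star norm_star_mult)
    then obtain y where y: "is_positive y" "y * y = of_real ((norm a)\<^sup>2) - star a * a"
      using positive_sqrt by blast
    have "star (y * x) * (y * x) = star x * (y * y) * x"
      using y(1) by (simp add: star_mult positive_selfadjoint mult.assoc)
    also have "\<dots> = (norm a)\<^sup>2 *\<^sub>R (star x * x) - star (a * x) * (a * x)"
      unfolding y(2) by (simp add: right_diff_distrib left_diff_distrib star_mult mult.assoc of_real_def)
    finally have "0 \<le> \<phi> ((norm a)\<^sup>2 *\<^sub>R (star x * x) - star (a * x) * (a * x))"
      using pos[OF positive_star_mult, of "y * x"] by simp
    then show ?thesis by (simp add: sqnorm l)
  qed
  have "\<exists>T\<in>bounded_ops S S. \<forall>x. T (J x) = J (a * x)" for a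
  proof -
    have b: "norm (J (a * inv J y)) \<le> norm a * norm y" if "y \<in> range J" for y
    proof -
      obtain x where y: "y = J x" using \<open>y \<in> range J\<close> by blast
      have "(norm (J (a * x)))\<^sup>2 \<le> (norm a * norm (J x))\<^sup>2"
        using contract by (simp add: Jq power_mult_distrib)
      then have "norm (J (a * x)) \<le> norm a * norm (J x)" by (rule power2_le_imp_le) simp
      moreover have "inv J y = x" unfolding y by (rule inv_f_f[OF inj])
      ultimately show ?thesis by (simp add: y)
    qed
    have add: "J (a * inv J (x + y)) = J (a * inv J x) + J (a * inv J y)"
      if "x \<in> range J" "y \<in> range J" for x y
      using that inj by (auto simp: Jadd[symmetric] distrib_left)
    have scale: "J (a * inv J (c *\<^sub>C x)) = c *\<^sub>C J (a * inv J x)" if "x \<in> range J" for c x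
      using that inj by (auto simp: Jscale[symmetric] scaleC_mult_right)
    obtain T where "T \<in> bounded_ops (closure (range J)) S"
      and T: "\<And>y. y \<in> range J \<Longrightarrow> T y = J (a * inv J y)"
      using extend_bounded_op[OF sub S, of "\<lambda>y. J (a * inv J y)" "norm a", OF JS add scale b] by blast
    then have "T \<in> bounded_ops S S" by (simp add: S_def)
    moreover have "T (J x) = J (a * x)" for x using T[of "J x"] inv_f_f[OF inj] by simp
    ultimately show ?thesis by blast
  qed
  then obtain \<sigma> where \<sigma>: "\<And>a. \<sigma> a \<in> bounded_ops S S" "\<And>a x. \<sigma> a (J x) = J (a * x)" by metis
  have subS: "csubspace S" using S by (rule hilbert_csubspace)
  have eq: "T x = U x" if "T \<in> bounded_ops S S" "U \<in> bounded_ops S S" "\<And>x. T (J x) = U (J x)" "x \<in> S" for T U x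
    using operators_eq_on_closure[of T "range J" S U S x] that sub by (auto simp: S_def)
  have "star_rep S \<sigma>"
  proof (rule star_repI[OF S \<sigma>(1)])
    fix a b :: 'a and x y and c
    assume x: "x \<in> S"
    show "\<sigma> 1 x = x"
      using eq[OF \<sigma>(1) id_op_bounded_ops[OF subS], of 1 x] x by (simp add: \<sigma> id_op_def JS)
    show "\<sigma> (a + b) x = \<sigma> a x + \<sigma> b x"
      using eq[OF \<sigma>(1) add_bounded_ops[OF \<sigma>(1) \<sigma>(1) subS subS], of "a + b" a b x] x
      by (simp add: \<sigma> JS Jadd distrib_right)
    show "\<sigma> (c *\<^sub>C a) x = c *\<^sub>C \<sigma> a x"
      using eq[OF \<sigma>(1) scaleC_bounded_ops[OF \<sigma>(1) subS subS], of "c *\<^sub>C a" c a x] x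
      by (simp add: \<sigma> JS Jscale scaleC_mult_left)
    show "\<sigma> (a * b) x = \<sigma> a (\<sigma> b x)"
      using eq[OF \<sigma>(1) comp_bounded_ops[OF \<sigma>(1) \<sigma>(1) subS], of "a * b" a b x] x
      by (simp add: \<sigma> JS mult.assoc)
    assume y: "y \<in> S"
    note adj = adjoint_op_bounded_ops[OF S S \<sigma>(1), of a]
    have "adjoint_op S S (\<sigma> a) (J z) = \<sigma> (star a) (J z)" for z
    proof (rule cinner_left_eqI_closure[OF sub])
      show "cinner (adjoint_op S S (\<sigma> a) (J z)) v = cinner (\<sigma> (star a) (J z)) v" if "v \<in> range J" for v
        using that cinner_adjoint_op'[OF S S \<sigma>(1) JS JS, of a]
        by (auto simp: \<sigma> Js s_def star_mult star_star mult.assoc)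
    qed (use bounded_ops_maps[OF adj JS] bounded_ops_maps[OF \<sigma>(1) JS] in \<open>simp_all add: S_def\<close>)
    then have "adjoint_op S S (\<sigma> a) y = \<sigma> (star a) y" by (rule eq[OF adj \<sigma>(1) _ y])
    then show "cinner (\<sigma> a x) y = cinner x (\<sigma> (star a) y)"
      using cinner_adjoint_op[OF S S \<sigma>(1) x y, of a] by simp
  qed
  moreover have "inj \<sigma>"
  proof (rule injI)
    fix a b assume "\<sigma> a = \<sigma> b"
    then have "J (a * 1) = J (b * 1)" unfolding \<sigma>(2)[symmetric] by simp
    then show "a = b" using inj by (simp add: inj_eq)
  qed
  moreover have "separable_hilbert S" using Jsep by (simp add: S_def)
  ultimately show ?thesis using that by (simp add: faithful_rep_def)
qed

lemma faithful_representation_exists: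
  fixes G :: "'a::unital_cstar_algebra set"
  assumes "countable G" "generates G"
  obtains S :: "ell2 set" and \<sigma> :: "'a \<Rightarrow> ell2 \<Rightarrow> ell2" where "separable_hilbert S" "faithful_rep S \<sigma>"
proof -
  obtain d :: "nat \<Rightarrow> 'a" where d: "\<And>x \<epsilon>. \<epsilon> > 0 \<Longrightarrow> \<exists>n. norm (x - d n) < \<epsilon>"
    by (rule generates_dense_sequence[OF assms]) blast
  obtain \<phi> :: "'a \<Rightarrow> real" where \<phi>: "linear \<phi>" "\<And>x. \<bar>\<phi> x\<bar> \<le> 2 * norm x" "\<And>h. is_positive h \<Longrightarrow> 0 \<le> \<phi> h"
    "\<And>x. \<phi> (star x) = \<phi> x" "\<And>a. a \<noteq> 0 \<Longrightarrow> 0 < \<phi> (star a * a)"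
    by (rule faithful_positive_functional[OF d]) (assumption | rule that)+
  show ?thesis
    by (rule positive_functional_representation[OF d \<phi>]) (assumption | rule that)+
qed

section \<open>Direct sums and unitary equivalence\<close>

instantiation prod :: (complex_vector, complex_vector) complex_vector
begin

definition scaleC_prod_def: "c *\<^sub>C p = (c *\<^sub>C fst p, c *\<^sub>C snd p)"

instance
  by standard (auto simp: scaleC_prod_def scaleC_add_right scaleC_add_left scaleC_scaleC scaleC_one
      scaleR_prod_def scaleR_scaleC)

end

instance prod :: (complex_normed_vector, complex_normed_vector) complex_normed_vector
proof
  fix c :: complex and p :: "'a \<times> 'b"
  have "(cmod c * norm (fst p))\<^sup>2 + (cmod c * norm (snd p))\<^sup>2
      = (cmod c)\<^sup>2 * ((norm (fst p))\<^sup>2 + (norm (snd p))\<^sup>2)"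
    by (simp add: power_mult_distrib distrib_left)
  then show "norm (c *\<^sub>C p) = cmod c * norm p"
    by (simp add: norm_prod_def scaleC_prod_def norm_scaleC real_sqrt_mult)
qed

instantiation prod :: (complex_inner, complex_inner) complex_inner
begin

definition cinner_prod_def: "cinner p q = cinner (fst p) (fst q) + cinner (snd p) (snd q)"

instance
proof
  fix p q r :: "'a \<times> 'b" and c
  show "cinner p q = cnj (cinner q p)"
    using cinner_commute[of "fst p" "fst q"] cinner_commute[of "snd p" "snd q"]
    by (simp add: cinner_prod_def)
qed (simp_all add: cinner_prod_def cinner_add_left scaleC_prod_def cinner_scaleC_left
    cinner_self norm_prod_def algebra_simps)

end

instance prod :: (chilbert_space, chilbert_space) chilbert_space ..

lemma hilbert_Times: "hilbert H \<Longrightarrow> hilbert N \<Longrightarrow> hilbert (H \<times> N)"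
  by (auto simp: hilbert_def csubspace_def closed_Times scaleC_prod_def zero_prod_def)

lemma separable_hilbert_Times:
  assumes "separable_hilbert H" "separable_hilbert N"
  shows "separable_hilbert (H \<times> N)"
proof -
  obtain C D where C: "countable C" "C \<subseteq> H" "H \<subseteq> closure C"
    and D: "countable D" "D \<subseteq> N" "N \<subseteq> closure D"
    using assms by (metis separable_hilbertE)
  show ?thesis
  proof (rule separable_hilbertI)
    show "hilbert (H \<times> N)" using assms by (simp add: separable_hilbert_def hilbert_Times)
    show "countable (C \<times> D)" using C D by simp
    show "C \<times> D \<subseteq> H \<times> N" using C D by blast
    show "H \<times> N \<subseteq> closure (C \<times> D)" unfolding closure_Times using C D by blast
  qed
qed

definition direct_sum_rep ::
  "'h::chilbert_space set \<Rightarrow> 'k::chilbert_space set \<Rightarrow> ('a::unital_cstar_algebra \<Rightarrow> 'h \<Rightarrow> 'h) \<Rightarrow>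
    ('a \<Rightarrow> 'k \<Rightarrow> 'k) \<Rightarrow> 'a \<Rightarrow> 'h \<times> 'k \<Rightarrow> 'h \<times> 'k" where
  "direct_sum_rep H N \<pi> \<theta> a = (\<lambda>p\<in>H \<times> N. (\<pi> a (fst p), \<theta> a (snd p)))"

lemma star_rep_direct_sum:
  assumes \<pi>: "star_rep H \<pi>" "hilbert H" and \<theta>: "star_rep N \<theta>" "hilbert N"
  shows "star_rep (H \<times> N) (direct_sum_rep H N \<pi> \<theta>)"
proof (rule star_repI)
  fix a
  obtain C where C: "C \<ge> 0" "\<And>x. x \<in> H \<Longrightarrow> norm (\<pi> a x) \<le> C * norm x"
    using bounded_ops_bound[OF star_repD(1)[OF \<pi>(1)]] by blast
  obtain D where D: "D \<ge> 0" "\<And>x. x \<in> N \<Longrightarrow> norm (\<theta> a x) \<le> D * norm x"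
    using bounded_ops_bound[OF star_repD(1)[OF \<theta>(1)]] by blast
  have sub: "csubspace H" "csubspace N" using \<pi> \<theta> by (auto intro: hilbert_csubspace)
  note b = star_repD(1)[OF \<pi>(1)] star_repD(1)[OF \<theta>(1)]
  show "direct_sum_rep H N \<pi> \<theta> a \<in> bounded_ops (H \<times> N) (H \<times> N)"
  proof (rule bounded_opsI[where C = "C + D"])
    fix p assume p: "p \<in> H \<times> N"
    have "norm (\<pi> a (fst p), \<theta> a (snd p)) \<le> norm (\<pi> a (fst p)) + norm (\<theta> a (snd p))"
      using norm_Pair_le by blast
    also have "\<dots> \<le> C * norm (fst p) + D * norm (snd p)"
      using p by (intro add_mono C D) auto
    also have "\<dots> \<le> C * norm p + D * norm p"
      using C(1) D(1) norm_fst_le[of "fst p" "snd p"] norm_snd_le[of "snd p" "fst p"]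
      by (intro add_mono mult_left_mono) auto
    finally show "norm (direct_sum_rep H N \<pi> \<theta> a p) \<le> (C + D) * norm p"
      using p by (simp add: direct_sum_rep_def distrib_right)
  qed (use sub in \<open>auto simp: direct_sum_rep_def csubspace_add csubspace_scaleC scaleC_prod_def
      bounded_ops_add[OF b(1)] bounded_ops_add[OF b(2)] bounded_ops_scaleC[OF b(1)]
      bounded_ops_scaleC[OF b(2)] star_rep_maps[OF \<pi>(1)] star_rep_maps[OF \<theta>(1)]\<close>)
qed (use assms in \<open>auto simp: hilbert_Times direct_sum_rep_def star_repD(2) star_repD(3) star_repD(4)
    star_repD(5) id_op_def scaleC_prod_def cinner_prod_def star_rep_maps cinner_star_rep\<close>)

lemma inj_direct_sum_rep:
  assumes \<pi>: "star_rep H \<pi>" "hilbert H" and \<theta>: "star_rep N \<theta>" "hilbert N"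
    and inj: "inj \<pi> \<or> inj \<theta>"
  shows "inj (direct_sum_rep H N \<pi> \<theta>)"
proof (rule injI)
  fix a b assume eq: "direct_sum_rep H N \<pi> \<theta> a = direct_sum_rep H N \<pi> \<theta> b"
  have zero: "0 \<in> H" "0 \<in> N" using \<pi> \<theta> by (auto intro: csubspace_zero hilbert_csubspace)
  have "\<pi> a x = \<pi> b x" if "x \<in> H" for x
    using fun_cong[OF eq, of "(x, 0)"] that zero by (simp add: direct_sum_rep_def)
  then have "\<pi> a = \<pi> b" by (rule bounded_ops_eqI[OF star_repD(1)[OF \<pi>(1)] star_repD(1)[OF \<pi>(1)]])
  moreover have "\<theta> a x = \<theta> b x" if "x \<in> N" for x
    using fun_cong[OF eq, of "(0, x)"] that zero by (simp add: direct_sum_rep_def)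
  then have "\<theta> a = \<theta> b" by (rule bounded_ops_eqI[OF star_repD(1)[OF \<theta>(1)] star_repD(1)[OF \<theta>(1)]])
  ultimately show "a = b" using inj by (auto simp: inj_eq)
qed

lemma star_rep_character:
  assumes chi: "character chi" and E: "hilbert E"
  shows "star_rep E (\<lambda>a. \<lambda>x\<in>E. chi a *\<^sub>C x)"
proof (rule star_repI[OF E])
  have sub: "csubspace E" using E by (rule hilbert_csubspace)
  show "(\<lambda>x\<in>E. chi a *\<^sub>C x) \<in> bounded_ops E E" for a
    using sub
    by (intro bounded_opsI[where C = "cmod (chi a)"])
      (auto simp: csubspace_add csubspace_scaleC scaleC_add_right scaleC_scaleC norm_scaleC mult.commute)
qed (use chi hilbert_csubspace[OF E] in \<open>auto simp: character_def scaleC_one scaleC_add_left scaleC_scaleC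
    csubspace_scaleC cinner_scaleC_left cinner_scaleC_right\<close>)


text \<open>The inverse \<open>I\<close> of \<open>J\<close> is part of the relation, which makes it symmetric.\<close>

definition unitary_pair ::
  "'h::chilbert_space set \<Rightarrow> 'k::chilbert_space set \<Rightarrow> ('h \<Rightarrow> 'k) \<Rightarrow> ('k \<Rightarrow> 'h) \<Rightarrow> bool" where
  "unitary_pair W H J I \<longleftrightarrow> hilbert W \<and> hilbert H \<and>
     (\<forall>x\<in>W. J x \<in> H \<and> I (J x) = x) \<and> (\<forall>y\<in>H. I y \<in> W \<and> J (I y) = y) \<and>
     (\<forall>x\<in>W. \<forall>y\<in>W. J (x + y) = J x + J y \<and> cinner (J x) (J y) = cinner x y) \<and>
     (\<forall>c. \<forall>x\<in>W. J (c *\<^sub>C x) = c *\<^sub>C J x)"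

lemma unitary_pairD:
  assumes "unitary_pair W H J I"
  shows "hilbert W" "hilbert H" "csubspace W" "csubspace H"
    and "x \<in> W \<Longrightarrow> J x \<in> H" "x \<in> W \<Longrightarrow> I (J x) = x" "u \<in> H \<Longrightarrow> I u \<in> W" "u \<in> H \<Longrightarrow> J (I u) = u"
    and "x \<in> W \<Longrightarrow> y \<in> W \<Longrightarrow> J (x + y) = J x + J y"
    and "x \<in> W \<Longrightarrow> y \<in> W \<Longrightarrow> cinner (J x) (J y) = cinner x y"
    and "x \<in> W \<Longrightarrow> J (c *\<^sub>C x) = c *\<^sub>C J x"
  using assms hilbert_csubspace by (auto simp: unitary_pair_def)

lemma unitary_pair_sym:
  assumes p: "unitary_pair W H J I"
  shows "unitary_pair H W I J"
proof -
  note d = unitary_pairD[OF p]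
  have "I (u + v) = I u + I v" if "u \<in> H" "v \<in> H" for u v
    by (metis d(6-9) that csubspace_add[OF d(3)])
  moreover have "cinner (I u) (I v) = cinner u v" if "u \<in> H" "v \<in> H" for u v
    by (metis d(7,8,10) that)
  moreover have "I (c *\<^sub>C u) = c *\<^sub>C I u" if "u \<in> H" for c u
    by (metis d(6-8,11) that csubspace_scaleC[OF d(3)])
  ultimately show ?thesis using d by (simp add: unitary_pair_def)
qed

lemma unitary_pair_norm: "unitary_pair W H J I \<Longrightarrow> x \<in> W \<Longrightarrow> norm (J x) = norm x"
  using unitary_pairD(10)[of W H J I x x] by (simp add: cinner_self power2_eq_iff_nonneg flip: of_real_power)

definition conj_op :: "'k set \<Rightarrow> ('h \<Rightarrow> 'k) \<Rightarrow> ('k \<Rightarrow> 'h) \<Rightarrow> ('h \<Rightarrow> 'h) \<Rightarrow> 'k \<Rightarrow> 'k" where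
  "conj_op H J I T = (\<lambda>y\<in>H. J (T (I y)))"

context
  fixes W :: "'h::chilbert_space set" and H :: "'k::chilbert_space set" and J I
  assumes p: "unitary_pair W H J I"
begin

private lemmas d = unitary_pairD[OF p]
private lemmas e = unitary_pairD[OF unitary_pair_sym[OF p]]

lemma conj_op_bounded_ops:
  assumes T: "T \<in> bounded_ops W W"
  shows "conj_op H J I T \<in> bounded_ops H H"
proof -
  obtain C where C: "\<And>x. x \<in> W \<Longrightarrow> norm (T x) \<le> C * norm x"
    using bounded_ops_bound[OF T] by blast
  have "norm (J (T (I u))) \<le> C * norm u" if "u \<in> H" for u
    using C[OF d(7)[OF that]] unitary_pair_norm[OF unitary_pair_sym[OF p] that]
      unitary_pair_norm[OF p bounded_ops_maps[OF T d(7)[OF that]]] by simp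
  then show ?thesis
    by (intro bounded_opsI[where C = C])
      (simp_all add: conj_op_def csubspace_add[OF d(4)] csubspace_scaleC[OF d(4)] d(5,7) bounded_ops_maps[OF T]
        e(9,11) d(9,11) bounded_ops_add[OF T] bounded_ops_scaleC[OF T])
qed

lemma cinner_conj_op:
  "T \<in> bounded_ops W W \<Longrightarrow> u \<in> H \<Longrightarrow> v \<in> H \<Longrightarrow> cinner (conj_op H J I T u) v = cinner (T (I u)) (I v)"
  using d(10)[of "T (I u)" "I v"] by (simp add: conj_op_def d(7,8) bounded_ops_maps)

lemma star_rep_conj_op:
  assumes \<pi>: "star_rep W \<pi>"
  shows "star_rep H (\<lambda>a. conj_op H J I (\<pi> a))"
proof (rule star_repI[OF d(2)])
  show "conj_op H J I (\<pi> a) \<in> bounded_ops H H" for a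
    by (rule conj_op_bounded_ops[OF star_repD(1)[OF \<pi>]])
  fix a x y assume "x \<in> H" "y \<in> H"
  then show "cinner (conj_op H J I (\<pi> a) x) y = cinner x (conj_op H J I (\<pi> (star a)) y)"
    using cinner_star_rep[OF \<pi> d(1), of "I x" "I y" a] cinner_conj_op[OF star_repD(1)[OF \<pi>]]
    by (metis cinner_commute d(7))
qed (simp_all add: conj_op_def d star_repD(2)[OF \<pi>] star_repD(3-5)[OF \<pi>] id_op_def star_rep_maps[OF \<pi>])

lemma inj_conj_op:
  assumes \<pi>: "star_rep W \<pi>" and inj: "inj \<pi>"
  shows "inj (\<lambda>a. conj_op H J I (\<pi> a))"
proof (rule injI)
  fix a b assume eq: "conj_op H J I (\<pi> a) = conj_op H J I (\<pi> b)"
  have "I (conj_op H J I (\<pi> c) (J x)) = \<pi> c x" if "x \<in> W" for c x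
    using that by (simp add: conj_op_def d(5,6) star_rep_maps[OF \<pi>])
  then have "\<pi> a x = \<pi> b x" if "x \<in> W" for x using that eq by metis
  then have "\<pi> a = \<pi> b" by (rule bounded_ops_eqI[OF star_repD(1)[OF \<pi>] star_repD(1)[OF \<pi>]])
  then show "a = b" using inj by (simp add: inj_eq)
qed

end

text \<open>Preimages of a Cauchy sequence under an isometry are Cauchy, so the image is complete.\<close>

lemma hilbert_isometric_image:
  fixes T :: "'h::chilbert_space \<Rightarrow> 'k::chilbert_space"
  assumes W: "hilbert W" and add: "\<And>x y. x \<in> W \<Longrightarrow> y \<in> W \<Longrightarrow> T (x + y) = T x + T y"
    and scale: "\<And>c x. x \<in> W \<Longrightarrow> T (c *\<^sub>C x) = c *\<^sub>C T x"
    and iso: "\<And>x. x \<in> W \<Longrightarrow> norm (T x) = norm x"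
  shows "hilbert (T ` W)" "inj_on T W"
proof -
  have sub: "csubspace W" using W by (rule hilbert_csubspace)
  have diff: "T x - T y = T (x - y)" if "x \<in> W" "y \<in> W" for x y
    using add[OF that(1) csubspace_minus[OF sub that(2)]] scale[OF that(2), of "-1"]
    by (simp add: scaleC_minus1_left)
  show "inj_on T W"
  proof (rule inj_onI)
    fix x y assume xy: "x \<in> W" "y \<in> W" "T x = T y"
    then have "norm (x - y) = 0"
      using iso[OF csubspace_diff[OF sub xy(1,2)]] diff[OF xy(1,2)] by simp
    then show "x = y" by simp
  qed
  have "closed (T ` W)"
    unfolding closed_sequential_limits
  proof (intro allI impI, elim conjE)
    fix f l assume f: "\<forall>n. f n \<in> T ` W" "f \<longlonglongrightarrow> l"
    then have "\<forall>n. \<exists>x. x \<in> W \<and> f n = T x" by blast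
    then obtain g where g: "\<And>n. g n \<in> W" "\<And>n. f n = T (g n)" by metis
    have dist: "dist (f m) (f n) = dist (g m) (g n)" for m n
      by (simp add: dist_norm g diff iso csubspace_diff[OF sub])
    have "Cauchy f" using f(2) by (rule LIMSEQ_imp_Cauchy)
    then have "Cauchy g" by (simp add: Cauchy_def dist)
    then obtain x where x: "g \<longlonglongrightarrow> x" by (auto simp: Cauchy_convergent_iff convergent_def)
    have xW: "x \<in> W" by (rule closed_sequentially[OF hilbert_closed[OF W] g(1) x])
    have "(\<lambda>n. norm (f n - T x)) \<longlonglongrightarrow> 0"
    proof -
      have "norm (f n - T x) = norm (g n - x)" for n
        using g xW by (simp add: diff iso csubspace_diff[OF sub])
      then show ?thesis using tendsto_norm_zero[OF LIM_zero[OF x]] by simp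
    qed
    then have "f \<longlonglongrightarrow> T x" by (rule LIM_zero_cancel[OF tendsto_norm_zero_cancel])
    then show "l \<in> T ` W" using f(2) LIMSEQ_unique xW by blast
  qed
  moreover have "csubspace (T ` W)" by (rule csubspace_linear_image[OF sub add scale])
  ultimately show "hilbert (T ` W)" by (simp add: hilbert_def)
qed

lemma separable_hilbert_unitary_pair_ell2:
  fixes W :: "'w::chilbert_space set"
  assumes W: "separable_hilbert W"
  obtains H :: "ell2 set" and J I where "separable_hilbert H" "unitary_pair W H J I"
proof -
  have hW: "hilbert W" using W by (rule separable_hilbert_hilbert)
  obtain a :: "nat \<Rightarrow> 'w" where a: "\<And>n. a n \<in> W"
    "\<And>x \<epsilon>. x \<in> W \<Longrightarrow> \<epsilon> > 0 \<Longrightarrow> \<exists>n. norm (x - a n) < \<epsilon>"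
    by (rule separable_hilbert_sequence[OF W]) blast
  have "semi_inner W cinner"
    by (unfold_locales; (rule hilbert_csubspace[OF hW] cinner_add_left cinner_scaleC_left cinner_commute)?)
      (simp add: cinner_self)
  then obtain J :: "'w \<Rightarrow> ell2" where J: "\<And>x y. x \<in> W \<Longrightarrow> y \<in> W \<Longrightarrow> J (x + y) = J x + J y"
    "\<And>c x. x \<in> W \<Longrightarrow> J (c *\<^sub>C x) = c *\<^sub>C J x"
    "\<And>x y. x \<in> W \<Longrightarrow> y \<in> W \<Longrightarrow> cinner (J x) (J y) = cinner x y"
    and sep: "separable_hilbert (closure (J ` W))"
  proof (rule embedding_of_bounded_form[OF _ a, of cinner 1])
    show "Re (cinner x x) \<le> 1 * (norm x)\<^sup>2" for x :: 'w by (simp add: cinner_self)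
  qed (assumption | rule that)+
  have norm: "norm (J x) = norm x" if "x \<in> W" for x
    using J(3)[OF that that] by (simp add: cinner_self power2_eq_iff_nonneg flip: of_real_power)
  note im = hilbert_isometric_image[OF hW J(1,2) norm]
  have "separable_hilbert (J ` W)" using sep by (simp add: closure_closed[OF hilbert_closed[OF im(1)]])
  moreover have "unitary_pair W (J ` W) J (the_inv_into W J)"
    using hW im J by (auto simp: unitary_pair_def the_inv_into_f_f)
  ultimately show ?thesis by (rule that)
qed

section \<open>Hyperrigidity and the unique extension property\<close>

text \<open>Hyperrigidity for the constant sequence \<open>\<Phi>\<close>.\<close>

lemma hyperrigid_ucp_ell2:
  fixes H :: "ell2 set"
  assumes G: "hyperrigid G" and H: "separable_hilbert H" and \<pi>: "faithful_rep H \<pi>"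
    and \<Phi>: "ucp_map H \<Phi>" and fix_G: "\<And>g. g \<in> G \<Longrightarrow> \<Phi> (\<pi> g) = \<pi> g"
  shows "\<Phi> (\<pi> a) = \<pi> a"
proof -
  have op: "\<pi> a \<in> bounded_ops H H" for a using \<pi> by (simp add: faithful_rep_def star_repD(1))
  have \<Phi>op: "\<Phi> (\<pi> a) \<in> bounded_ops H H" for a using \<Phi> op by (simp add: ucp_map_def)
  have sub: "csubspace H" using H by (simp add: separable_hilbert_def hilbert_csubspace)
  have ne: "{x \<in> H. norm x \<le> 1} \<noteq> {}" using csubspace_zero[OF sub] by (auto intro!: exI[of _ 0])
  have "opnorm H (\<lambda>x. \<Phi> (\<pi> g) x - \<pi> g x) = 0" if "g \<in> G" for g
    using ne by (simp add: opnorm_def fix_G[OF that])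
  then have "(\<lambda>k::nat. opnorm H (\<lambda>x. \<Phi> (\<pi> a) x - \<pi> a x)) \<longlonglongrightarrow> 0"
    using G H \<pi> \<Phi> unfolding hyperrigid_def by (elim conjE allE[of _ H] allE[of _ \<pi>] allE[of _ "\<lambda>_. \<Phi>"]) simp
  then have zero: "opnorm H (\<lambda>x. \<Phi> (\<pi> a) x - \<pi> a x) = 0" using LIMSEQ_unique tendsto_const by blast
  obtain C where C: "C \<ge> 0" "\<And>x. x \<in> H \<Longrightarrow> norm (\<Phi> (\<pi> a) x) \<le> C * norm x"
    using bounded_ops_bound[OF \<Phi>op] by blast
  obtain D where D: "D \<ge> 0" "\<And>x. x \<in> H \<Longrightarrow> norm (\<pi> a x) \<le> D * norm x"
    using bounded_ops_bound[OF op] by blast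
  show ?thesis
  proof (rule bounded_ops_eqI[OF \<Phi>op op])
    fix x assume x: "x \<in> H"
    have "norm (\<Phi> (\<pi> a) x - \<pi> a x) \<le> opnorm H (\<lambda>x. \<Phi> (\<pi> a) x - \<pi> a x) * norm x"
    proof (rule norm_le_opnorm[OF sub _ _ x])
      fix y assume y: "y \<in> H"
      show "\<Phi> (\<pi> a) (c *\<^sub>C y) - \<pi> a (c *\<^sub>C y) = c *\<^sub>C (\<Phi> (\<pi> a) y - \<pi> a y)" for c
        by (simp add: bounded_ops_scaleC[OF \<Phi>op y] bounded_ops_scaleC[OF op y] scaleC_diff_right)
      show "norm (\<Phi> (\<pi> a) y - \<pi> a y) \<le> (C + D) * norm y"
        using C(2)[OF y] D(2)[OF y] norm_triangle_ineq4[of "\<Phi> (\<pi> a) y" "\<pi> a y"]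
        by (simp add: distrib_right)
    qed
    then show "\<Phi> (\<pi> a) x = \<pi> a x" by (simp add: zero)
  qed
qed

text \<open>Complete positivity is immediate for \<open>T \<mapsto> A\<^sup>*TA + B\<^sup>*TB\<close>: its positivity at \<open>x\<close> is that of \<open>T\<close>
  at \<open>Ax\<close> and at \<open>Bx\<close>.\<close>

lemma ucp_map_two_kraus_operators:
  assumes W: "hilbert W" and A: "A \<in> bounded_ops W W" and B: "B \<in> bounded_ops W W"
    and unital: "\<And>x y. x \<in> W \<Longrightarrow> y \<in> W \<Longrightarrow> cinner (A x) (A y) + cinner (B x) (B y) = cinner x y"
  shows "ucp_map W (\<lambda>T. \<lambda>x\<in>W. adjoint_op W W A (T (A x)) + adjoint_op W W B (T (B x)))"
    (is "ucp_map W ?\<Phi>")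
proof -
  have sub: "csubspace W" using W by (rule hilbert_csubspace)
  note Aop = adjoint_op_bounded_ops[OF W W A] and Bop = adjoint_op_bounded_ops[OF W W B]
  note maps = bounded_ops_maps[OF A] bounded_ops_maps[OF B] bounded_ops_maps[OF Aop] bounded_ops_maps[OF Bop]
  have op: "?\<Phi> T \<in> bounded_ops W W" if T: "T \<in> bounded_ops W W" for T
  proof -
    have "(\<lambda>x\<in>W. (\<lambda>x\<in>W. adjoint_op W W A ((\<lambda>x\<in>W. T (A x)) x)) x
        + (\<lambda>x\<in>W. adjoint_op W W B ((\<lambda>x\<in>W. T (B x)) x)) x) \<in> bounded_ops W W"
      by (intro add_bounded_ops comp_bounded_ops[OF Aop] comp_bounded_ops[OF Bop]
          comp_bounded_ops[OF T A] comp_bounded_ops[OF T B] sub)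
    then show ?thesis by (simp cong: restrict_cong)
  qed
  show ?thesis
    unfolding ucp_map_def
  proof (intro conjI ballI allI impI)
    show "?\<Phi> T \<in> bounded_ops W W" if "T \<in> bounded_ops W W" for T by (rule op[OF that])
    fix S T x assume S: "S \<in> bounded_ops W W" and T: "T \<in> bounded_ops W W" and x: "x \<in> W"
    show "?\<Phi> (\<lambda>y\<in>W. S y + T y) x = ?\<Phi> S x + ?\<Phi> T x"
      using x by (simp add: maps bounded_ops_maps[OF S] bounded_ops_maps[OF T]
          bounded_ops_add[OF Aop] bounded_ops_add[OF Bop])
  next
    fix c T x assume T: "T \<in> bounded_ops W W" and x: "x \<in> W"
    show "?\<Phi> (\<lambda>y\<in>W. c *\<^sub>C T y) x = c *\<^sub>C ?\<Phi> T x"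
      using x by (simp add: maps bounded_ops_maps[OF T] scaleC_add_right
          bounded_ops_scaleC[OF Aop] bounded_ops_scaleC[OF Bop])
  next
    show "?\<Phi> (id_op W) = id_op W"
    proof (rule bounded_ops_eqI[OF op id_op_bounded_ops[OF sub]])
      show "id_op W \<in> bounded_ops W W" by (rule id_op_bounded_ops[OF sub])
      fix x assume x: "x \<in> W"
      have "adjoint_op W W A (A x) + adjoint_op W W B (B x) = x"
        using x by (intro cinner_left_eqI[OF sub])
          (auto simp: cinner_add_left cinner_adjoint_op'[OF W W A] cinner_adjoint_op'[OF W W B] maps
            csubspace_add[OF sub] unital)
      then show "?\<Phi> (id_op W) x = id_op W x" using x by (simp add: id_op_def maps)
    qed
  next
    fix n T assume T: "positive_matrix W n T"
    have Top: "T i j \<in> bounded_ops W W" if "i < n" "j < n" for i j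
      using T that by (simp add: positive_matrix_def)
    have pos: "(\<Sum>i<n. \<Sum>j<n. cinner (T i j (x j)) (x i)) \<in> \<real>\<^sub>\<ge>\<^sub>0" if "\<forall>i<n. x i \<in> W" for x
      using T that by (simp add: positive_matrix_def)
    show "positive_matrix W n (\<lambda>i j. ?\<Phi> (T i j))"
      unfolding positive_matrix_def
    proof (intro conjI allI impI)
      show "?\<Phi> (T i j) \<in> bounded_ops W W" if "i < n" "j < n" for i j by (rule op[OF Top[OF that]])
      fix x assume x: "\<forall>i<n. x i \<in> W"
      have "(\<Sum>i<n. \<Sum>j<n. cinner (?\<Phi> (T i j) (x j)) (x i))
          = (\<Sum>i<n. \<Sum>j<n. cinner (T i j (A (x j))) (A (x i)) + cinner (T i j (B (x j))) (B (x i)))"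
        using x by (intro sum.cong refl)
          (simp add: cinner_add_left cinner_adjoint_op'[OF W W A] cinner_adjoint_op'[OF W W B] maps
            bounded_ops_maps[OF Top])
      also have "\<dots> = (\<Sum>i<n. \<Sum>j<n. cinner (T i j (A (x j))) (A (x i)))
          + (\<Sum>i<n. \<Sum>j<n. cinner (T i j (B (x j))) (B (x i)))" by (simp add: sum.distrib)
      also have "\<dots> \<in> \<real>\<^sub>\<ge>\<^sub>0" using x by (intro nonneg_Reals_add_I pos) (auto simp: maps)
      finally show "(\<Sum>i<n. \<Sum>j<n. cinner (?\<Phi> (T i j) (x j)) (x i)) \<in> \<real>\<^sub>\<ge>\<^sub>0" .
    qed
  qed
qed

lemma hyperrigid_kraus_ell2:
  fixes W :: "ell2 set"
  assumes G: "hyperrigid G" and W: "separable_hilbert W" and \<tau>: "faithful_rep W \<tau>"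
    and A: "A \<in> bounded_ops W W" and B: "B \<in> bounded_ops W W"
    and unital: "\<And>x y. x \<in> W \<Longrightarrow> y \<in> W \<Longrightarrow> cinner (A x) (A y) + cinner (B x) (B y) = cinner x y"
    and on_G: "\<And>g x y. g \<in> G \<Longrightarrow> x \<in> W \<Longrightarrow> y \<in> W \<Longrightarrow>
      cinner (\<tau> g (A x)) (A y) + cinner (\<tau> g (B x)) (B y) = cinner (\<tau> g x) y"
    and x: "x \<in> W" and y: "y \<in> W"
  shows "cinner (\<tau> a (A x)) (A y) + cinner (\<tau> a (B x)) (B y) = cinner (\<tau> a x) y"
proof -
  have hW: "hilbert W" using W by (rule separable_hilbert_hilbert)
  have op: "\<tau> a \<in> bounded_ops W W" for a using \<tau> by (simp add: faithful_rep_def star_repD(1))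
  let ?\<Phi> = "\<lambda>T. \<lambda>x\<in>W. adjoint_op W W A (T (A x)) + adjoint_op W W B (T (B x))"
  have \<Phi>: "ucp_map W ?\<Phi>" by (rule ucp_map_two_kraus_operators[OF hW A B unital])
  then have \<Phi>op: "?\<Phi> (\<tau> a) \<in> bounded_ops W W" for a using op by (simp add: ucp_map_def)
  have form: "cinner (?\<Phi> (\<tau> a) x) y = cinner (\<tau> a (A x)) (A y) + cinner (\<tau> a (B x)) (B y)"
    if "x \<in> W" "y \<in> W" for a x y
    using that by (simp add: cinner_add_left cinner_adjoint_op'[OF hW hW A] cinner_adjoint_op'[OF hW hW B]
        bounded_ops_maps[OF A] bounded_ops_maps[OF B] bounded_ops_maps[OF op])
  have "?\<Phi> (\<tau> g) = \<tau> g" if g: "g \<in> G" for g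
    using form on_G[OF g] bounded_ops_maps[OF \<Phi>op] bounded_ops_maps[OF op]
    by (intro bounded_ops_eqI[OF \<Phi>op op] cinner_left_eqI[OF hilbert_csubspace[OF hW]]) metis+
  then have "?\<Phi> (\<tau> a) = \<tau> a" by (rule hyperrigid_ucp_ell2[OF G W \<tau> \<Phi>])
  then show ?thesis using form[OF x y, of a] by simp
qed

text \<open>Only inner products occur here, so that a unitary equivalence with a subspace of \<open>\<ell>\<^sup>2\<close> transports
  the statement.\<close>

lemma hyperrigid_kraus:
  assumes G: "hyperrigid G" and W: "separable_hilbert W" and \<tau>: "faithful_rep W \<tau>"
    and A: "A \<in> bounded_ops W W" and B: "B \<in> bounded_ops W W"
    and unital: "\<And>x y. x \<in> W \<Longrightarrow> y \<in> W \<Longrightarrow> cinner (A x) (A y) + cinner (B x) (B y) = cinner x y"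
    and on_G: "\<And>g x y. g \<in> G \<Longrightarrow> x \<in> W \<Longrightarrow> y \<in> W \<Longrightarrow>
      cinner (\<tau> g (A x)) (A y) + cinner (\<tau> g (B x)) (B y) = cinner (\<tau> g x) y"
    and x: "x \<in> W" and y: "y \<in> W"
  shows "cinner (\<tau> a (A x)) (A y) + cinner (\<tau> a (B x)) (B y) = cinner (\<tau> a x) y"
proof -
  obtain H :: "ell2 set" and J I where H: "separable_hilbert H" and p: "unitary_pair W H J I"
    using separable_hilbert_unitary_pair_ell2[OF W] by blast
  note d = unitary_pairD[OF p]
  have rep: "star_rep W \<tau>" "inj \<tau>" using \<tau> by (simp_all add: faithful_rep_def)
  note op = star_repD(1)[OF rep(1)]
  have sub: "csubspace W" by (rule d(3))
  let ?c = "conj_op H J I"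
  have faith: "faithful_rep H (\<lambda>a. ?c (\<tau> a))"
    using star_rep_conj_op[OF p rep(1)] inj_conj_op[OF p rep] by (simp add: faithful_rep_def)
  have c: "?c T \<in> bounded_ops H H" if "T \<in> bounded_ops W W" for T by (rule conj_op_bounded_ops[OF p that])
  have form: "cinner (?c (\<tau> b) (?c T u)) (?c T v) = cinner (\<tau> b (T (I u))) (T (I v))"
    and form1: "cinner (?c T u) (?c T v) = cinner (T (I u)) (T (I v))"
    if T: "T \<in> bounded_ops W W" and uv: "u \<in> H" "v \<in> H" for b T u v
    using uv d(10) by (simp_all add: conj_op_def d(5-7) bounded_ops_maps[OF T] bounded_ops_maps[OF op])
  have form2: "cinner (?c (\<tau> b) u) v = cinner (\<tau> b (I u)) (I v)" if "u \<in> H" "v \<in> H" for b u v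
    by (rule cinner_conj_op[OF p op that])
  have "cinner (?c (\<tau> a) (?c A (J x))) (?c A (J y)) + cinner (?c (\<tau> a) (?c B (J x))) (?c B (J y))
      = cinner (?c (\<tau> a) (J x)) (J y)"
  proof (rule hyperrigid_kraus_ell2[OF G H faith c[OF A] c[OF B]])
    show "cinner (?c A u) (?c A v) + cinner (?c B u) (?c B v) = cinner u v" if "u \<in> H" "v \<in> H" for u v
      using that d(8,10) by (simp add: form1 A B unital d(7)) (metis d(7,8,10))
    show "cinner (?c (\<tau> g) (?c A u)) (?c A v) + cinner (?c (\<tau> g) (?c B u)) (?c B v) = cinner (?c (\<tau> g) u) v"
      if "g \<in> G" "u \<in> H" "v \<in> H" for g u v
      using that by (simp add: form form2 A B on_G d(7))
  qed (use x y d(5) in auto)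
  then show ?thesis using x y by (simp add: form form2 A B d(5,6))
qed

text \<open>On \<open>H \<oplus> N\<close> with the faithful representation \<open>\<pi> \<oplus> \<theta>\<close> consider the operators \<open>A(x, y) = (0, Vx)\<close> and
  \<open>B(x, y) = (0, y)\<close>. The unital completely positive map \<open>T \<mapsto> A\<^sup>*TA + B\<^sup>*TB\<close> sends \<open>\<pi>(a) \<oplus> \<theta>(a)\<close> to
  \<open>V\<^sup>*\<theta>(a)V \<oplus> \<theta>(a)\<close>. It is defined on all operators, as hyperrigidity demands, and it fixes the images
  of the generators. The second conclusion follows
  from multiplicativity: \<open>\<langle>\<theta>(a\<^sup>*a)Vx, Vx\<rangle> = \<langle>\<pi>(a\<^sup>*a)x, x\<rangle>\<close> says that the compression of \<open>\<theta>(a)Vx\<close> to the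
  range of \<open>V\<close> loses no norm.\<close>

lemma hyperrigid_unique_extension:
  assumes G: "hyperrigid G"
    and H: "separable_hilbert H" and \<pi>: "star_rep H \<pi>"
    and N: "separable_hilbert N" and \<theta>: "faithful_rep N \<theta>"
    and V: "V \<in> bounded_ops H N" and iso: "\<And>x y. x \<in> H \<Longrightarrow> y \<in> H \<Longrightarrow> cinner (V x) (V y) = cinner x y"
    and on_G: "\<And>g x y. g \<in> G \<Longrightarrow> x \<in> H \<Longrightarrow> y \<in> H \<Longrightarrow> cinner (\<theta> g (V x)) (V y) = cinner (\<pi> g x) y"
  shows hyperrigid_compression: "x \<in> H \<Longrightarrow> y \<in> H \<Longrightarrow> cinner (\<theta> a (V x)) (V y) = cinner (\<pi> a x) y"
    and hyperrigid_intertwining: "x \<in> H \<Longrightarrow> \<theta> a (V x) = V (\<pi> a x)"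
proof -
  have hH: "hilbert H" and hN: "hilbert N" using H N by (simp_all add: separable_hilbert_hilbert)
  have sub: "csubspace H" "csubspace N" using hH hN by (auto intro: hilbert_csubspace)
  have z: "0 \<in> H" "0 \<in> N" using sub by (simp_all add: csubspace_zero)
  have rep: "star_rep N \<theta>" "inj \<theta>" using \<theta> by (simp_all add: faithful_rep_def)
  let ?W = "H \<times> N" and ?\<tau> = "direct_sum_rep H N \<pi> \<theta>"
  have \<tau>: "faithful_rep ?W ?\<tau>"
    using star_rep_direct_sum[OF \<pi> hH rep(1) hN] inj_direct_sum_rep[OF \<pi> hH rep(1) hN] rep(2)
    by (simp add: faithful_rep_def)
  define A where "A = (\<lambda>p\<in>?W. (0 :: 'b, V (fst p)))"
  define B where "B = (\<lambda>p\<in>?W. (0 :: 'b, snd p))"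
  obtain C where C: "C \<ge> 0" "\<And>x. x \<in> H \<Longrightarrow> norm (V x) \<le> C * norm x"
    using bounded_ops_bound[OF V] by blast
  have "norm (V (fst p)) \<le> C * norm p" if "p \<in> ?W" for p
    using C(2)[of "fst p"] that mult_left_mono[OF norm_fst_le[of "fst p" "snd p"] C(1)] by auto
  then have A: "A \<in> bounded_ops ?W ?W"
    using sub z unfolding A_def
    by (intro bounded_opsI[where C = C])
      (auto simp: bounded_ops_maps[OF V] bounded_ops_add[OF V] bounded_ops_scaleC[OF V]
        norm_Pair scaleC_prod_def csubspace_add csubspace_scaleC)
  have B: "B \<in> bounded_ops ?W ?W"
    using sub z norm_snd_le unfolding B_def
    by (intro bounded_opsI[where C = 1])
      (auto simp: norm_Pair scaleC_prod_def csubspace_add csubspace_scaleC)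
  have \<theta>z: "\<theta> b 0 = 0" and \<pi>z: "\<pi> b 0 = 0" for b
    using bounded_ops_zero[OF star_repD(1)[OF rep(1)] z(2)] bounded_ops_zero[OF star_repD(1)[OF \<pi>] z(1)] by auto
  show ext: "cinner (\<theta> a (V x)) (V y) = cinner (\<pi> a x) y" if x: "x \<in> H" and y: "y \<in> H" for a x y
  proof -
    have "cinner (?\<tau> a (A (x, 0))) (A (y, 0)) + cinner (?\<tau> a (B (x, 0))) (B (y, 0))
        = cinner (?\<tau> a (x, 0)) (y, 0)"
      by (rule hyperrigid_kraus[OF G separable_hilbert_Times[OF H N] \<tau> A B])
        (use x y z in \<open>auto simp: A_def B_def direct_sum_rep_def cinner_prod_def iso on_G bounded_ops_maps[OF V] \<pi>z\<close>)
    then show ?thesis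
      using x y z by (simp add: A_def B_def direct_sum_rep_def cinner_prod_def bounded_ops_maps[OF V] \<theta>z \<pi>z)
  qed
  show "\<theta> a (V x) = V (\<pi> a x)" if x: "x \<in> H"
  proof -
    have Vx: "V x \<in> N" by (rule bounded_ops_maps[OF V x])
    have px: "\<pi> a x \<in> H" by (rule star_rep_maps[OF \<pi> x])
    let ?p = "cinner (\<pi> a x) (\<pi> a x)"
    have 1: "cinner (\<theta> a (V x)) (\<theta> a (V x)) = ?p"
    proof -
      have "cinner (\<theta> a (V x)) (\<theta> a (V x)) = cinner (V x) (\<theta> (star a * a) (V x))"
        using cinner_star_rep[OF rep(1) hN Vx star_rep_maps[OF rep(1) Vx]] star_repD(5)[OF rep(1) Vx] by simp
      also have "\<dots> = cinner x (\<pi> (star a * a) x)"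
        using ext[OF x x, of "star a * a"] by (metis cinner_commute)
      also have "\<dots> = ?p"
        using cinner_star_rep[OF \<pi> hH x star_rep_maps[OF \<pi> x]] star_repD(5)[OF \<pi> x] by simp
      finally show ?thesis .
    qed
    have 2: "cinner (\<theta> a (V x)) (V (\<pi> a x)) = ?p" by (rule ext[OF x px])
    then have 3: "cinner (V (\<pi> a x)) (\<theta> a (V x)) = ?p" by (metis cinner_commute)
    have 4: "cinner (V (\<pi> a x)) (V (\<pi> a x)) = ?p" by (rule iso[OF px px])
    have "cinner (\<theta> a (V x) - V (\<pi> a x)) (\<theta> a (V x) - V (\<pi> a x)) = 0"
      by (simp add: cinner_diff_left cinner_diff_right 1 2 3 4)
    then show ?thesis by simp
  qed
qed

section \<open>Contractions that compress a representation on the generators\<close>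

lemma contraction_norm_le:
  assumes R: "contraction H K R" and H: "csubspace H" and x: "x \<in> H"
  shows "norm (R x) \<le> norm x"
proof -
  have Rop: "R \<in> bounded_ops H K" using R by (simp add: contraction_def)
  obtain C where C: "\<And>x. x \<in> H \<Longrightarrow> norm (R x) \<le> C * norm x"
    using bounded_ops_bound[OF Rop] by blast
  have "norm (R x) \<le> opnorm H R * norm x"
    by (rule norm_le_opnorm[OF H bounded_ops_scaleC[OF Rop] C x])
  also have "\<dots> \<le> 1 * norm x" using R by (intro mult_right_mono) (simp_all add: contraction_def)
  finally show ?thesis by simp
qed

lemma defect_op_bounded_ops:
  assumes H: "hilbert H" and K: "hilbert K" and R: "R \<in> bounded_ops H K"
  shows "defect_op H K R \<in> bounded_ops H H"
proof -
  have sub: "csubspace H" using H by (rule hilbert_csubspace)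
  note adj = comp_bounded_ops[OF adjoint_op_bounded_ops[OF H K R] R sub]
  have "(\<lambda>x\<in>H. id_op H x + (\<lambda>x\<in>H. (-1) *\<^sub>C (\<lambda>x\<in>H. adjoint_op H K R (R x)) x) x) \<in> bounded_ops H H"
    by (intro add_bounded_ops id_op_bounded_ops scaleC_bounded_ops[OF adj] sub)
  then show ?thesis
    by (simp add: defect_op_def id_op_def scaleC_minus1_left cong: restrict_cong)
qed

lemma cinner_defect_op:
  assumes "hilbert H" "hilbert K" "R \<in> bounded_ops H K" "x \<in> H" "y \<in> H"
  shows "cinner (defect_op H K R x) y = cinner x y - cinner (R x) (R y)"
  using assms by (simp add: defect_op_def cinner_diff_left cinner_adjoint_op' bounded_ops_maps)

lemma defect_op_selfadjoint:
  assumes "hilbert H" "hilbert K" "R \<in> bounded_ops H K" "x \<in> H" "y \<in> H"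
  shows "cinner (defect_op H K R x) y = cinner x (defect_op H K R y)"
  using cinner_defect_op[OF assms] cinner_defect_op[OF assms(1-3,5,4)]
  by (metis cinner_commute complex_cnj_diff)

text \<open>If \<open>norm (Rx) = norm x\<close>, then \<open>(norm (x - R\<^sup>*Rx))\<^sup>2 = (norm (R\<^sup>*Rx))\<^sup>2 - (norm x)\<^sup>2\<close>, which is at
  most \<open>0\<close> as \<open>R\<^sup>*\<close> does not increase norms.\<close>

lemma defect_op_eq_zero_iff:
  assumes H: "hilbert H" and K: "hilbert K" and R: "contraction H K R" and x: "x \<in> H"
  shows "defect_op H K R x = 0 \<longleftrightarrow> norm (R x) = norm x"
proof
  have Rop: "R \<in> bounded_ops H K" using R by (simp add: contraction_def)
  have sub: "csubspace H" using H by (rule hilbert_csubspace)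
  let ?S = "adjoint_op H K R"
  have Rx: "R x \<in> K" and Sx: "?S (R x) \<in> H"
    using x bounded_ops_maps[OF Rop] bounded_ops_maps[OF adjoint_op_bounded_ops[OF H K Rop]] by auto
  {
    assume "defect_op H K R x = 0"
    then have "(norm (R x))\<^sup>2 = (norm x)\<^sup>2"
      using cinner_defect_op[OF H K Rop x x] by (simp add: cinner_self flip: of_real_power)
    then show "norm (R x) = norm x" by (simp add: power2_eq_iff_nonneg)
  next
    assume eq: "norm (R x) = norm x"
    have "(norm (?S (R x)))\<^sup>2 = Re (cinner (R (?S (R x))) (R x))"
      using cinner_adjoint_op[OF H K Rop Sx Rx] by (simp add: cinner_self)
    also have "\<dots> \<le> norm (R (?S (R x))) * norm (R x)"
      using complex_Re_le_cmod complex_cauchy_schwarz by (rule order_trans)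
    also have "\<dots> \<le> norm (?S (R x)) * norm (R x)"
      by (intro mult_right_mono contraction_norm_le[OF R sub Sx]) simp
    finally have "norm (?S (R x)) \<le> norm (R x)"
      by (cases "?S (R x) = 0") (auto simp: power2_eq_square)
    then have le: "(norm (?S (R x)))\<^sup>2 \<le> (norm x)\<^sup>2" by (simp add: eq power_mono)
    have "Re (cinner x (?S (R x))) = (norm x)\<^sup>2"
      using cinner_adjoint_op[OF H K Rop x Rx] by (metis cinner_self eq Re_complex_of_real)
    then have "(norm (x - ?S (R x)))\<^sup>2 \<le> 0" using le by (simp add: norm_diff_squared)
    then show "defect_op H K R x = 0" using x by (simp add: defect_op_def)
  }
qed

text \<open>Complete \<open>R\<close> to an isometry \<open>V = (R, 0, J)\<close> with \<open>J\<^sup>*J = I - R\<^sup>*R\<close>. As \<open>chi\<close> vanishes on \<open>G\<close>,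
  the compression of \<open>\<rho> \<oplus> \<sigma> \<oplus> chi\<close> to the range of \<open>V\<close> still agrees with \<open>\<pi>\<close> on \<open>G\<close>, for any faithful
  \<open>\<sigma>\<close>. So \<open>V\<close> intertwines, and one reads off its components.\<close>

theorem contraction_intertwines:
  assumes G: "hyperrigid G" and chi: "character chi" and G_chi: "G \<subseteq> {a. chi a = 0}"
    and H: "separable_hilbert H" and K: "separable_hilbert K"
    and \<pi>: "star_rep H \<pi>" and \<rho>: "star_rep K \<rho>" and R: "contraction H K R"
    and on_G: "\<forall>g\<in>G. \<forall>x\<in>H. \<pi> g x = adjoint_op H K R (\<rho> g (R x))" and x: "x \<in> H"
  shows "\<rho> a (R x) = R (\<pi> a x)" (is ?thesis1)
    and "defect_op H K R (\<pi> a x) = chi a *\<^sub>C defect_op H K R x" (is ?thesis2)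
proof -
  have hH: "hilbert H" and hK: "hilbert K" using H K by (simp_all add: separable_hilbert_hilbert)
  have sub: "csubspace H" using hH by (rule hilbert_csubspace)
  have Rop: "R \<in> bounded_ops H K" using R by (simp add: contraction_def)
  note Rmaps = bounded_ops_maps[OF Rop]
  note Dop = defect_op_bounded_ops[OF hH hK Rop]
  obtain S :: "ell2 set" and \<sigma> :: "'a \<Rightarrow> ell2 \<Rightarrow> ell2" where S: "separable_hilbert S" "faithful_rep S \<sigma>"
    using faithful_representation_exists G unfolding hyperrigid_def by metis
  have hS: "hilbert S" using S(1) by (rule separable_hilbert_hilbert)
  have zS: "0 \<in> S" by (rule csubspace_zero[OF hilbert_csubspace[OF hS]])
  have \<sigma>: "star_rep S \<sigma>" "inj \<sigma>" using S(2) by (simp_all add: faithful_rep_def)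
  define s where "s x y = cinner x y - cinner (R x) (R y)" for x y
  have s: "semi_inner H s"
  proof
    fix x y assume "x \<in> H" "y \<in> H"
    show "s x y = cnj (s y x)"
      unfolding s_def complex_cnj_diff cinner_commute[symmetric] ..
  next
    fix x assume x: "x \<in> H"
    have "(norm (R x))\<^sup>2 \<le> (norm x)\<^sup>2" by (intro power_mono contraction_norm_le[OF R sub x]) simp
    then show "0 \<le> Re (s x x)" by (simp add: s_def cinner_self)
  qed (simp_all add: sub s_def cinner_add_left cinner_scaleC_left bounded_ops_add[OF Rop]
      bounded_ops_scaleC[OF Rop] algebra_simps)
  have s_bound: "Re (s x x) \<le> 1 * (norm x)\<^sup>2" for x by (simp add: s_def cinner_self)
  obtain d :: "nat \<Rightarrow> 'b" where d: "\<And>n. d n \<in> H"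
    "\<And>x \<epsilon>. x \<in> H \<Longrightarrow> \<epsilon> > 0 \<Longrightarrow> \<exists>n. norm (x - d n) < \<epsilon>"
    by (rule separable_hilbert_sequence[OF H]) blast
  obtain J :: "'b \<Rightarrow> ell2" where J: "\<And>x y. x \<in> H \<Longrightarrow> y \<in> H \<Longrightarrow> J (x + y) = J x + J y"
    "\<And>c x. x \<in> H \<Longrightarrow> J (c *\<^sub>C x) = c *\<^sub>C J x"
    "\<And>x y. x \<in> H \<Longrightarrow> y \<in> H \<Longrightarrow> cinner (J x) (J y) = s x y"
    and Jsep: "separable_hilbert (closure (J ` H))"
    by (rule embedding_of_bounded_form[OF s d s_bound]) (assumption | rule that)+
  have normJ: "norm (J x) \<le> norm x" if "x \<in> H" for x
  proof (rule power2_le_imp_le)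
    have "(norm (J x))\<^sup>2 = Re (s x x)" using J(3)[OF that that] by (metis cinner_self Re_complex_of_real)
    then show "(norm (J x))\<^sup>2 \<le> (norm x)\<^sup>2" using s_bound[of x] by simp
  qed simp
  define E where "E = closure (J ` H)"
  have E: "separable_hilbert E" unfolding E_def by (rule Jsep)
  then have hE: "hilbert E" by (rule separable_hilbert_hilbert)
  have JE: "J x \<in> E" if "x \<in> H" for x
    unfolding E_def using that by (intro subsetD[OF closure_subset]) simp
  define \<kappa> where "\<kappa> a = (\<lambda>x\<in>E. chi a *\<^sub>C x)" for a
  have \<kappa>: "star_rep E \<kappa>" unfolding \<kappa>_def by (rule star_rep_character[OF chi hE])
  define \<theta>' where "\<theta>' = direct_sum_rep S E \<sigma> \<kappa>"
  define \<theta> where "\<theta> = direct_sum_rep K (S \<times> E) \<rho> \<theta>'"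
  have \<theta>': "star_rep (S \<times> E) \<theta>'" "inj \<theta>'"
    unfolding \<theta>'_def using star_rep_direct_sum[OF \<sigma>(1) hS \<kappa> hE] inj_direct_sum_rep[OF \<sigma>(1) hS \<kappa> hE] \<sigma>(2)
    by simp_all
  have \<theta>: "faithful_rep (K \<times> (S \<times> E)) \<theta>"
    unfolding \<theta>_def faithful_rep_def
    using star_rep_direct_sum[OF \<rho> hK \<theta>'(1) hilbert_Times[OF hS hE]]
      inj_direct_sum_rep[OF \<rho> hK \<theta>'(1) hilbert_Times[OF hS hE]] \<theta>'(2) by simp
  have N: "separable_hilbert (K \<times> (S \<times> E))" by (intro separable_hilbert_Times K S(1) E)
  define V where "V = (\<lambda>x\<in>H. (R x, 0 :: ell2, J x))"
  have V: "V \<in> bounded_ops H (K \<times> (S \<times> E))"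
  proof (rule bounded_opsI[where C = 2])
    fix x assume x: "x \<in> H"
    have "norm (R x, 0 :: ell2, J x) \<le> norm (R x) + norm (0 :: ell2, J x)" by (rule norm_Pair_le)
    also have "norm (0 :: ell2, J x) = norm (J x)" by (simp add: norm_Pair)
    finally show "norm (V x) \<le> 2 * norm x"
      using x normJ[OF x] contraction_norm_le[OF R sub x] by (simp add: V_def)
  qed (use sub zS in \<open>auto simp: V_def Rmaps JE J csubspace_add csubspace_scaleC scaleC_prod_def
      bounded_ops_add[OF Rop] bounded_ops_scaleC[OF Rop]\<close>)
  have V_iso: "cinner (V x) (V y) = cinner x y" if "x \<in> H" "y \<in> H" for x y
    using that by (simp add: V_def cinner_prod_def J(3) s_def)
  have \<theta>V: "\<theta> a (V x) = (\<rho> a (R x), 0, chi a *\<^sub>C J x)" if "x \<in> H" for a x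
  proof -
    have "\<sigma> a 0 = 0" by (rule bounded_ops_zero[OF star_repD(1)[OF \<sigma>(1)] zS])
    then show ?thesis
      using that by (simp add: \<theta>_def \<theta>'_def direct_sum_rep_def V_def Rmaps JE zS \<kappa>_def)
  qed
  have on_G': "cinner (\<theta> g (V x)) (V y) = cinner (\<pi> g x) y" if "g \<in> G" "x \<in> H" "y \<in> H" for g x y
  proof -
    have "chi g = 0" using G_chi that(1) by blast
    then have "cinner (\<theta> g (V x)) (V y) = cinner (\<rho> g (R x)) (R y)"
      using that by (simp add: \<theta>V, simp add: V_def cinner_prod_def)
    also have "\<dots> = cinner (adjoint_op H K R (\<rho> g (R x))) y"
      using that by (simp add: cinner_adjoint_op'[OF hH hK Rop] star_rep_maps[OF \<rho>] Rmaps)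
    finally show ?thesis using on_G that by simp
  qed
  have main: "\<theta> a (V x) = V (\<pi> a x)"
    by (rule hyperrigid_intertwining[OF G H \<pi> N \<theta> V _ _ x]) (fact V_iso on_G')+
  have px: "\<pi> a x \<in> H" by (rule star_rep_maps[OF \<pi> x])
  from main show ?thesis1 using x px by (simp add: \<theta>V, simp add: V_def)
  have JJ: "J (\<pi> a x) = chi a *\<^sub>C J x" using main x px by (simp add: \<theta>V, simp add: V_def)
  show ?thesis2
  proof (rule cinner_left_eqI[OF sub bounded_ops_maps[OF Dop px]
        csubspace_scaleC[OF sub bounded_ops_maps[OF Dop x]]])
    fix y assume y: "y \<in> H"
    have "cinner (defect_op H K R (\<pi> a x)) y = cinner (J (\<pi> a x)) (J y)"
      by (simp add: cinner_defect_op[OF hH hK Rop px y] J(3)[OF px y] s_def)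
    also have "\<dots> = chi a * cinner (J x) (J y)" by (simp add: JJ cinner_scaleC_left)
    also have "\<dots> = cinner (chi a *\<^sub>C defect_op H K R x) y"
      by (simp add: cinner_scaleC_left cinner_defect_op[OF hH hK Rop x y] J(3)[OF x y] s_def)
    finally show "cinner (defect_op H K R (\<pi> a x)) y = cinner (chi a *\<^sub>C defect_op H K R x) y" .
  qed
qed


section \<open>The decomposition\<close>

lemma mem_char_space:
  "x \<in> char_space H chi \<pi> \<longleftrightarrow> x \<in> H \<and> (\<forall>a. \<pi> a x = chi a *\<^sub>C x)"
  by (auto simp: char_space_def op_ker_def)

lemma hilbert_char_space:
  assumes H: "hilbert H" and \<pi>: "star_rep H \<pi>"
  shows "hilbert (char_space H chi \<pi>)"
proof -
  have sub: "csubspace H" using H by (rule hilbert_csubspace)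
  have "closed (op_ker H (\<lambda>x. \<pi> a x - chi a *\<^sub>C x))" for a
  proof -
    have "continuous_on H (\<lambda>x. \<pi> a x - chi a *\<^sub>C x)"
      by (intro continuous_intros bounded_ops_continuous[OF star_repD(1)[OF \<pi>] sub])
    then show ?thesis
      unfolding op_ker_def by (rule continuous_closed_preimage_constant[OF _ hilbert_closed[OF H]])
  qed
  then have "closed (char_space H chi \<pi>)" unfolding char_space_def by (intro closed_INT) blast
  moreover have "csubspace (char_space H chi \<pi>)"
    using sub bounded_ops_zero[OF star_repD(1)[OF \<pi>] csubspace_zero[OF sub]]
    by (simp add: csubspace_def[of "char_space H chi \<pi>"] mem_char_space csubspace_zero csubspace_add
        csubspace_scaleC bounded_ops_add[OF star_repD(1)[OF \<pi>]]
        bounded_ops_scaleC[OF star_repD(1)[OF \<pi>]] scaleC_add_right scaleC_scaleC mult.commute)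
  ultimately show ?thesis by (simp add: hilbert_def)
qed

lemma character_star: "character chi \<Longrightarrow> chi (star a) = cnj (chi a)"
  by (simp add: character_def)

text \<open>On such a subspace every \<open>\<pi>(a)\<close> acts as a scalar, and the family is closed under adjoints.\<close>

lemma reduces_rep_subset_char_space:
  assumes H: "hilbert H" and \<pi>: "star_rep H \<pi>" and chi: "character chi"
    and N: "hilbert N" "N \<subseteq> char_space H chi \<pi>"
  shows "reduces_rep H N \<pi>"
  unfolding reduces_rep_def reduces_op_def
proof (intro allI conjI)
  fix a
  have scalar: "\<pi> b y = chi b *\<^sub>C y" and mem: "y \<in> H" if "y \<in> N" for b y
    using N(2) that by (auto simp: mem_char_space)
  show "hilbert N" "N \<subseteq> H" using N mem by auto
  show "\<pi> a ` N \<subseteq> N" using scalar csubspace_scaleC[OF hilbert_csubspace[OF N(1)]] by auto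
  show "\<pi> a ` ortho_compl H N \<subseteq> ortho_compl H N"
  proof
    fix z assume "z \<in> \<pi> a ` ortho_compl H N"
    then obtain x where x: "z = \<pi> a x" "x \<in> H" "\<And>y. y \<in> N \<Longrightarrow> cinner x y = 0"
      by (auto simp: ortho_compl_def)
    have "cinner (\<pi> a x) y = 0" if "y \<in> N" for y
      using cinner_star_rep[OF \<pi> H x(2) mem[OF that], of a] x(3)[OF that] scalar[OF that, of "star a"]
      by (simp add: cinner_scaleC_right)
    then show "z \<in> ortho_compl H N" using x star_rep_maps[OF \<pi>] by (simp add: ortho_compl_def)
  qed
qed

lemma reduces_rep_ortho_compl:
  assumes H: "hilbert H" and N: "reduces_rep H N \<pi>"
  shows "reduces_rep H (ortho_compl H N) \<pi>"
proof -
  have "hilbert N" "N \<subseteq> H" using N by (auto simp: reduces_rep_def reduces_op_def)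
  then have "ortho_compl H (ortho_compl H N) = N" by (rule ortho_compl_ortho_compl[OF H])
  then show ?thesis
    using N hilbert_ortho_compl[OF H, of N] by (auto simp: reduces_rep_def reduces_op_def ortho_compl_def)
qed

lemma ortho_compl_antimono: "M \<subseteq> N \<Longrightarrow> ortho_compl H N \<subseteq> ortho_compl H M"
  by (auto simp: ortho_compl_def)

text \<open>The component in \<open>M\<close> of a vector of \<open>I\<close> stays in \<open>I\<close>, because the other component does.\<close>

lemma ortho_sum_within:
  assumes H: "hilbert H" and M: "hilbert M" "M \<subseteq> H" and I: "hilbert I" "I \<subseteq> H"
    and sub: "ortho_compl H M \<subseteq> I"
  shows "ortho_sum I (ortho_compl H M) (I \<inter> M)"
  unfolding ortho_sum_def
proof (intro conjI)
  have sI: "csubspace I" using I(1) by (rule hilbert_csubspace)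
  show "I = {x + y |x y. x \<in> ortho_compl H M \<and> y \<in> I \<inter> M}"
  proof (intro equalityI subsetI)
    fix x assume x: "x \<in> I"
    then have "x \<in> H" using I(2) by blast
    then obtain u m where um: "x = u + m" "u \<in> ortho_compl H M" "m \<in> M"
      using ortho_sum_ortho_compl[OF H M] unfolding ortho_sum_def by blast
    have "m = x - u" by (simp add: um(1))
    then have "m \<in> I" using csubspace_diff[OF sI x] um(2) sub by blast
    then show "x \<in> {x + y |x y. x \<in> ortho_compl H M \<and> y \<in> I \<inter> M}" using um by blast
  qed (use sub csubspace_add[OF sI] in blast)
qed (use hilbert_ortho_compl[OF H] hilbert_Int[OF I(1) M(1)] in \<open>auto simp: ortho_compl_def\<close>)

lemma csubspace_image:
  assumes T: "T \<in> bounded_ops H K" and M: "csubspace M" "M \<subseteq> H"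
  shows "csubspace (T ` M)"
  by (rule csubspace_linear_image[OF M(1)])
    (use M(2) in \<open>simp_all add: bounded_ops_add[OF T] bounded_ops_scaleC[OF T] subset_iff\<close>)

lemma adjoint_op_isometry:
  assumes H: "hilbert H" and K: "hilbert K" and V: "V \<in> bounded_ops H K"
    and iso: "\<And>x y. x \<in> H \<Longrightarrow> y \<in> H \<Longrightarrow> cinner (V x) (V y) = cinner x y"
  shows "x \<in> H \<Longrightarrow> adjoint_op H K V (V x) = x"
  using bounded_ops_maps[OF V] bounded_ops_maps[OF adjoint_op_bounded_ops[OF H K V]]
  by (intro cinner_left_eqI[OF hilbert_csubspace[OF H]]) (auto simp: cinner_adjoint_op'[OF H K V] iso)

lemma op_ker_selfadjoint:
  assumes H: "csubspace H" and T: "T \<in> bounded_ops H H"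
    and sa: "\<And>x y. x \<in> H \<Longrightarrow> y \<in> H \<Longrightarrow> cinner (T x) y = cinner x (T y)"
  shows "op_ker H T = ortho_compl H (closure (T ` H))"
  unfolding ortho_compl_closure
proof (intro equalityI subsetI)
  fix x assume "x \<in> op_ker H T"
  then show "x \<in> ortho_compl H (T ` H)" using sa[of x] by (auto simp: op_ker_def ortho_compl_def sa[symmetric])
next
  fix x assume x: "x \<in> ortho_compl H (T ` H)"
  then have "x \<in> H" "cinner x (T (T x)) = 0" using bounded_ops_maps[OF T] by (auto simp: ortho_compl_def)
  then have "cinner (T x) (T x) = 0" using sa[of x "T x"] bounded_ops_maps[OF T] by simp
  then show "x \<in> op_ker H T" using \<open>x \<in> H\<close> by (simp add: op_ker_def)
qed

theorem corollary2p9: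
  fixes G :: "'a::unital_cstar_algebra set"
    and chi :: "'a \<Rightarrow> complex"
    and H :: "'h::chilbert_space set" and K :: "'k::chilbert_space set"
    and \<pi> :: "'a \<Rightarrow> 'h \<Rightarrow> 'h" and \<rho> :: "'a \<Rightarrow> 'k \<Rightarrow> 'k"
    and R :: "'h \<Rightarrow> 'k"
    and L_chi :: "'k set"
    and H\<^sub>I H\<^sub>U H\<^sub>S H\<^sub>P\<^sub>C :: "'h set" and K\<^sub>I K\<^sub>U K\<^sub>S K\<^sub>P\<^sub>C :: "'k set"
  assumes "hyperrigid G"
    and "character chi" and "G \<subseteq> {a. chi a = 0}"
    and "separable_hilbert H" and "separable_hilbert K"
    and "star_rep H \<pi>" and "star_rep K \<rho>"
    and "contraction H K R"
    and "\<forall>g\<in>G. \<forall>x\<in>H. \<pi> g x = adjoint_op H K R (\<rho> g (R x))"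
    and "K = closed_cspan (\<Union>a. \<rho> a ` R ` H)"
    and "L_chi = closed_cspan (\<Union>a. \<rho> a ` R ` char_space H chi \<pi>)"
    and "H\<^sub>I = op_ker H (defect_op H K R)"
    and "H\<^sub>U = ortho_compl H (char_space H chi \<pi>)"
    and "H\<^sub>S = op_ker H (defect_op H K R) \<inter> char_space H chi \<pi>"
    and "H\<^sub>P\<^sub>C = closure (defect_op H K R ` H)"
    and "K\<^sub>I = ortho_compl K (closure (R ` defect_op H K R ` H))"
    and "K\<^sub>U = ortho_compl K L_chi"
    and "K\<^sub>S = ortho_compl K (closure (R ` defect_op H K R ` H)) \<inter> L_chi"
    and "K\<^sub>P\<^sub>C = closure (R ` defect_op H K R ` H)"
  shows
    "\<comment> \<open>(i)\<close> ortho_sum H H\<^sub>I H\<^sub>P\<^sub>C \<and> ortho_sum H\<^sub>I H\<^sub>U H\<^sub>S \<and>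
     \<comment> \<open>(ii)\<close> ortho_sum K K\<^sub>I K\<^sub>P\<^sub>C \<and> ortho_sum K\<^sub>I K\<^sub>U K\<^sub>S \<and>
     \<comment> \<open>(iii)\<close> reduces_rep H H\<^sub>U \<pi> \<and> reduces_rep H H\<^sub>S \<pi> \<and> reduces_rep H H\<^sub>P\<^sub>C \<pi> \<and>
       (\<forall>a. \<forall>x\<in>ortho_compl H H\<^sub>U. \<pi> a x = chi a *\<^sub>C x) \<and>
     \<comment> \<open>(iv)\<close> reduces_rep K K\<^sub>U \<rho> \<and> reduces_rep K K\<^sub>S \<rho> \<and> reduces_rep K K\<^sub>P\<^sub>C \<rho> \<and>
       (\<forall>a. \<forall>y\<in>ortho_compl K K\<^sub>U. \<rho> a y = chi a *\<^sub>C y) \<and>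
     (\<exists>R\<^sub>I R\<^sub>U R\<^sub>S R\<^sub>P\<^sub>C.
       \<comment> \<open>(v)\<close> op_ortho_sum H\<^sub>I H\<^sub>P\<^sub>C K\<^sub>I K\<^sub>P\<^sub>C R R\<^sub>I R\<^sub>P\<^sub>C \<and>
         op_ortho_sum H\<^sub>U H\<^sub>S K\<^sub>U K\<^sub>S R\<^sub>I R\<^sub>U R\<^sub>S \<and>
       \<comment> \<open>(vi)\<close> unitary_op H\<^sub>U K\<^sub>U R\<^sub>U \<and> isometry_op H\<^sub>S K\<^sub>S R\<^sub>S \<and>
         pure_contraction H\<^sub>P\<^sub>C K\<^sub>P\<^sub>C R\<^sub>P\<^sub>C \<and>
       \<comment> \<open>(vii)\<close> (\<forall>a. \<forall>x\<in>H\<^sub>U. \<pi> a x = adjoint_op H\<^sub>U K\<^sub>U R\<^sub>U (\<rho> a (R\<^sub>U x))) \<and>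
       \<comment> \<open>(viii)\<close> defect_space H\<^sub>I K\<^sub>I R\<^sub>I = defect_space H\<^sub>S K\<^sub>S R\<^sub>S \<and>
         defect_space H\<^sub>S K\<^sub>S R\<^sub>S = op_ker K (adjoint_op H K R))"
proof -
  define M where "M = char_space H chi \<pi>"
  define D where "D = defect_op H K R"
  note defs = assms(11-19)[folded M_def D_def]
  have hH: "hilbert H" and hK: "hilbert K" using assms(4,5) by (simp_all add: separable_hilbert_hilbert)
  have sH: "csubspace H" and sK: "csubspace K" using hH hK by (simp_all add: hilbert_csubspace)
  have R: "R \<in> bounded_ops H K" using assms(8) by (simp add: contraction_def)
  note Rmaps = bounded_ops_maps[OF R]
  have D: "D \<in> bounded_ops H H" unfolding D_def by (rule defect_op_bounded_ops[OF hH hK R])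
  note Dmaps = bounded_ops_maps[OF D]
  have D_form: "cinner (D x) y = cinner x y - cinner (R x) (R y)" if "x \<in> H" "y \<in> H" for x y
    unfolding D_def by (rule cinner_defect_op[OF hH hK R that])
  have D_sa: "cinner (D x) y = cinner x (D y)" if "x \<in> H" "y \<in> H" for x y
    unfolding D_def by (rule defect_op_selfadjoint[OF hH hK R that])
  have \<rho>R: "\<rho> a (R x) = R (\<pi> a x)" and D\<pi>: "D (\<pi> a x) = chi a *\<^sub>C D x" if "x \<in> H" for a x
    unfolding D_def by (rule contraction_intertwines[OF assms(1-9) that])+
  have M: "hilbert M" unfolding M_def by (rule hilbert_char_space[OF hH assms(6)])
  have M\<pi>: "\<pi> a x = chi a *\<^sub>C x" if "x \<in> M" for a x
    using that by (auto simp: M_def mem_char_space)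
  have MH: "M \<subseteq> H" by (auto simp: M_def mem_char_space)
  \<comment> \<open>The adjoint of the relation \<open>D\<pi>(a\<^sup>*) = chi(a\<^sup>*)D\<close>.\<close>
  have DM: "D x \<in> M" if x: "x \<in> H" for x
    unfolding M_def mem_char_space
  proof (intro conjI allI)
    show "D x \<in> H" by (rule Dmaps[OF x])
    fix a
    show "\<pi> a (D x) = chi a *\<^sub>C D x"
    proof (rule cinner_left_eqI[OF sH])
      fix y assume y: "y \<in> H"
      have "cinner (\<pi> a (D x)) y = cinner x (D (\<pi> (star a) y))"
        using x y by (simp add: cinner_star_rep[OF assms(6) hH] Dmaps D_sa star_rep_maps[OF assms(6)])
      then show "cinner (\<pi> a (D x)) y = cinner (chi a *\<^sub>C D x) y"
        using x y by (simp add: D\<pi> character_star[OF assms(2)] cinner_scaleC_right cinner_scaleC_left D_sa)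
    qed (use x Dmaps star_rep_maps[OF assms(6)] csubspace_scaleC[OF sH] in auto)
  qed
  have HPC: "hilbert H\<^sub>P\<^sub>C" "H\<^sub>P\<^sub>C \<subseteq> M"
    unfolding defs
    by (rule hilbert_closure[OF csubspace_image[OF D sH order_refl]],
        rule closure_minimal[OF image_subsetI[OF DM] hilbert_closed[OF M]])
  have HI: "H\<^sub>I = ortho_compl H H\<^sub>P\<^sub>C"
    unfolding defs by (rule op_ker_selfadjoint[OF sH D D_sa])
  have hHI: "hilbert H\<^sub>I" "H\<^sub>I \<subseteq> H" unfolding HI using hilbert_ortho_compl[OF hH] by (auto simp: ortho_compl_def)
  have HU: "H\<^sub>U = ortho_compl H M" by (simp add: defs)
  have HU_HI: "H\<^sub>U \<subseteq> H\<^sub>I" unfolding HU HI by (rule ortho_compl_antimono[OF HPC(2)])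
  have HS: "H\<^sub>S = H\<^sub>I \<inter> M" by (simp add: defs)
  have sum_H: "ortho_sum H H\<^sub>I H\<^sub>P\<^sub>C" unfolding HI using HPC MH by (intro ortho_sum_ortho_compl[OF hH]) auto
  have sum_HI: "ortho_sum H\<^sub>I H\<^sub>U H\<^sub>S"
    unfolding HS HU by (rule ortho_sum_within[OF hH M MH hHI HU_HI[unfolded HU]])
  have hHU: "hilbert H\<^sub>U" and hHS: "hilbert H\<^sub>S" using sum_HI by (simp_all add: ortho_sum_def)

  \<comment> \<open>As \<open>R\<close> intertwines, the span over all \<open>\<rho>(a)\<close> of the image of an invariant subspace adds nothing.\<close>
  have span: "closed_cspan (\<Union>a. \<rho> a ` R ` N) = closure (R ` N)"
    if N: "csubspace N" "N \<subseteq> H" "\<And>a. \<pi> a ` N \<subseteq> N" for N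
  proof (rule antisym)
    have "\<rho> a ` R ` N \<subseteq> R ` N" for a
      using N(2) N(3)[of a] by (auto simp: \<rho>R subset_iff image_iff)
    then show "closed_cspan (\<Union>a. \<rho> a ` R ` N) \<subseteq> closure (R ` N)"
      using closure_subset[of "R ` N"]
      by (intro closed_cspan_least hilbert_closure csubspace_image[OF R N(1,2)]) blast
    have "\<rho> 1 ` R ` N = R ` N"
      using N(2) Rmaps by (force simp: star_repD(2)[OF assms(7)] id_op_def)
    then have "R ` N \<subseteq> (\<Union>a. \<rho> a ` R ` N)" using UN_upper[OF UNIV_I, of "\<lambda>a. \<rho> a ` R ` N" 1] by simp
    then have "R ` N \<subseteq> closed_cspan (\<Union>a. \<rho> a ` R ` N)" by (rule subset_trans[OF _ subset_closed_cspan])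
    then show "closure (R ` N) \<subseteq> closed_cspan (\<Union>a. \<rho> a ` R ` N)"
      by (intro closure_minimal hilbert_closed[OF hilbert_closed_cspan])
  qed
  have K: "K = closure (R ` H)"
    using assms(10) span[OF sH order_refl] star_rep_maps[OF assms(6)] by auto
  have sM: "csubspace M" using M by (rule hilbert_csubspace)
  have L: "L_chi = closure (R ` M)"
    unfolding defs(1) by (rule span[OF sM MH]) (auto simp: M\<pi> csubspace_scaleC[OF sM])
  have ran_dense: "y = 0" if "y \<in> K" "\<And>x. x \<in> H \<Longrightarrow> cinner y (R x) = 0" for y
  proof -
    have "y \<in> ortho_compl K (closure (R ` H))" unfolding ortho_compl_closure using that by (auto simp: ortho_compl_def)
    then have "cinner y y = 0" unfolding K[symmetric] by (simp add: ortho_compl_def)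
    then show ?thesis by simp
  qed
  have hL: "hilbert L_chi" unfolding L by (rule hilbert_closure[OF csubspace_image[OF R sM MH]])
  have LK: "L_chi \<subseteq> char_space K chi \<rho>"
    unfolding L
  proof (rule closure_minimal[OF _ hilbert_closed[OF hilbert_char_space[OF hK assms(7)]]])
    show "R ` M \<subseteq> char_space K chi \<rho>"
      using MH by (auto simp: mem_char_space Rmaps \<rho>R M\<pi> bounded_ops_scaleC[OF R] subset_iff)
  qed
  then have LK': "L_chi \<subseteq> K" by (auto simp: mem_char_space)
  have DH: "csubspace (D ` H)" "D ` H \<subseteq> H" using csubspace_image[OF D sH] Dmaps by auto
  have KPC: "hilbert K\<^sub>P\<^sub>C" "K\<^sub>P\<^sub>C \<subseteq> L_chi"
    unfolding defs(9) L
    by (rule hilbert_closure[OF csubspace_image[OF R DH]],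
        rule closure_mono[OF image_mono[OF image_subsetI[OF DM]]])
  have KI: "K\<^sub>I = ortho_compl K K\<^sub>P\<^sub>C" by (simp add: defs)
  have hKI: "hilbert K\<^sub>I" "K\<^sub>I \<subseteq> K" unfolding KI using hilbert_ortho_compl[OF hK] by (auto simp: ortho_compl_def)
  have KU: "K\<^sub>U = ortho_compl K L_chi" by (simp add: defs)
  have KU_KI: "K\<^sub>U \<subseteq> K\<^sub>I" unfolding KU KI by (rule ortho_compl_antimono[OF KPC(2)])
  have KS: "K\<^sub>S = K\<^sub>I \<inter> L_chi" by (simp add: defs)
  have sum_K: "ortho_sum K K\<^sub>I K\<^sub>P\<^sub>C" unfolding KI using KPC LK' by (intro ortho_sum_ortho_compl[OF hK]) auto
  have sum_KI: "ortho_sum K\<^sub>I K\<^sub>U K\<^sub>S"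
    unfolding KS KU by (rule ortho_sum_within[OF hK hL LK' hKI KU_KI[unfolded KU]])
  have hKU: "hilbert K\<^sub>U" and hKS: "hilbert K\<^sub>S" using sum_KI by (simp_all add: ortho_sum_def)

  have reduce_H: "reduces_rep H N \<pi>" if "hilbert N" "N \<subseteq> M" for N
    using reduces_rep_subset_char_space[OF hH assms(6,2) that(1)] that(2) by (simp add: M_def)
  have reduce_K: "reduces_rep K N \<rho>" if "hilbert N" "N \<subseteq> L_chi" for N
    using reduces_rep_subset_char_space[OF hK assms(7,2) that(1)] that(2) LK by blast
  have red_HU: "reduces_rep H H\<^sub>U \<pi>"
    unfolding HU by (rule reduces_rep_ortho_compl[OF hH reduce_H[OF M order_refl]])
  have red_KU: "reduces_rep K K\<^sub>U \<rho>"
    unfolding KU by (rule reduces_rep_ortho_compl[OF hK reduce_K[OF hL order_refl]])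
  have scalar_H: "\<forall>a. \<forall>x\<in>ortho_compl H H\<^sub>U. \<pi> a x = chi a *\<^sub>C x"
    unfolding HU ortho_compl_ortho_compl[OF hH M MH] by (simp add: M\<pi>)
  have scalar_K: "\<forall>a. \<forall>y\<in>ortho_compl K K\<^sub>U. \<rho> a y = chi a *\<^sub>C y"
    unfolding KU ortho_compl_ortho_compl[OF hK hL LK'] using LK by (auto simp: mem_char_space)

  have HI_D: "D x = 0" and HI_H: "x \<in> H" if "x \<in> H\<^sub>I" for x using that by (simp_all add: defs op_ker_def)
  have iso: "cinner (R x) (R y) = cinner x y" if "x \<in> H\<^sub>I" "y \<in> H" for x y
    using D_form[OF HI_H[OF that(1)] that(2)] HI_D[OF that(1)] by simp
  have R_HI: "R x \<in> K\<^sub>I" if x: "x \<in> H\<^sub>I" for x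
  proof -
    have "cinner (R x) (R (D y)) = 0" if y: "y \<in> H" for y
      using iso[OF x Dmaps[OF y]] D_sa[OF HI_H[OF x] y] HI_D[OF x] by simp
    then show ?thesis unfolding KI defs ortho_compl_closure using Rmaps[OF HI_H[OF x]] by (auto simp: ortho_compl_def)
  qed
  have R_HU: "R x \<in> K\<^sub>U" if x: "x \<in> H\<^sub>U" for x
  proof -
    have "cinner (R x) (R m) = 0" if "m \<in> M" for m
      using iso[of x m] x that HU_HI MH by (auto simp: HU ortho_compl_def)
    then show ?thesis unfolding KU L ortho_compl_closure
      using Rmaps[OF HI_H] x HU_HI by (auto simp: ortho_compl_def)
  qed
  have R_HS: "R x \<in> K\<^sub>S" if "x \<in> H\<^sub>S" for x
    using that R_HI[of x] closure_subset[of "R ` M"] by (auto simp: HS KS L)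
  have R_HPC: "R ` H\<^sub>P\<^sub>C \<subseteq> K\<^sub>P\<^sub>C"
    unfolding defs
  proof (rule image_closure_subset)
    show "continuous_on (closure (D ` H)) R"
      using HPC MH by (intro continuous_on_subset[OF bounded_ops_continuous[OF R sH]]) (auto simp: defs)
  qed (rule closed_closure, rule closure_subset)

  define RI where "RI = restrict R H\<^sub>I"
  define RU where "RU = restrict R H\<^sub>U"
  define RS where "RS = restrict R H\<^sub>S"
  define RPC where "RPC = restrict R H\<^sub>P\<^sub>C"
  have HU_H: "H\<^sub>U \<subseteq> H" and HS_HI: "H\<^sub>S \<subseteq> H\<^sub>I" and HPC_H: "H\<^sub>P\<^sub>C \<subseteq> H"
    using HU_HI hHI HS HPC MH by auto
  have RI: "RI \<in> bounded_ops H\<^sub>I K\<^sub>I"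
    unfolding RI_def by (rule restrict_bounded_ops[OF R hilbert_csubspace[OF hHI(1)] hHI(2)]) (use R_HI in auto)
  have RU: "RU \<in> bounded_ops H\<^sub>U K\<^sub>U"
    unfolding RU_def by (rule restrict_bounded_ops[OF R hilbert_csubspace[OF hHU] HU_H]) (use R_HU in auto)
  have RS: "RS \<in> bounded_ops H\<^sub>S K\<^sub>S"
    unfolding RS_def
    by (rule restrict_bounded_ops[OF R hilbert_csubspace[OF hHS]]) (use R_HS HS_HI hHI in auto)
  have RPC: "RPC \<in> bounded_ops H\<^sub>P\<^sub>C K\<^sub>P\<^sub>C"
    unfolding RPC_def by (rule restrict_bounded_ops[OF R hilbert_csubspace[OF HPC(1)] HPC_H R_HPC])
  have sum_R: "op_ortho_sum H\<^sub>I H\<^sub>P\<^sub>C K\<^sub>I K\<^sub>P\<^sub>C R RI RPC"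
    using RI RPC hHI(2) HPC_H by (auto simp: op_ortho_sum_def RI_def RPC_def bounded_ops_add[OF R] subset_iff)
  have sum_RI: "op_ortho_sum H\<^sub>U H\<^sub>S K\<^sub>U K\<^sub>S RI RU RS"
    using RU RS HU_HI HS_HI hHI csubspace_add[OF hilbert_csubspace[OF hHI(1)]]
    by (auto simp: op_ortho_sum_def RI_def RU_def RS_def bounded_ops_add[OF R] subset_iff)

  have adj_U: "adjoint_op H\<^sub>U K\<^sub>U RU (RU x) = x" if "x \<in> H\<^sub>U" for x
    using iso HU_HI HU_H that by (intro adjoint_op_isometry[OF hHU hKU RU]) (auto simp: RU_def subset_iff)
  have adj_S: "adjoint_op H\<^sub>S K\<^sub>S RS (RS x) = x" if "x \<in> H\<^sub>S" for x
    using iso HS_HI hHI(2) that by (intro adjoint_op_isometry[OF hHS hKS RS]) (auto simp: RS_def subset_iff)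
  have ortho_R: "cinner y (R x) = 0"
    if x: "x \<in> H" and y: "\<And>u. u \<in> H\<^sub>U \<Longrightarrow> cinner y (R u) = 0" "\<And>m. m \<in> M \<Longrightarrow> cinner y (R m) = 0" for x y
  proof -
    obtain u m where um: "x = u + m" "u \<in> H\<^sub>U" "m \<in> M"
      using ortho_sum_ortho_compl[OF hH M MH] x unfolding ortho_sum_def HU by blast
    then have "R x = R u + R m" using HU_H MH by (auto simp: bounded_ops_add[OF R] subset_iff)
    then show ?thesis using y um by (simp add: cinner_add_right)
  qed
  have surj_U: "R ` H\<^sub>U = K\<^sub>U"
  proof (rule ortho_compl_trivial_imp_eq[OF hKU])
    have "norm (R x) = norm x" if "x \<in> H\<^sub>U" for x
      using iso[of x x] that HU_HI HU_H
      by (simp add: subset_iff cinner_self power2_eq_iff_nonneg flip: of_real_power)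
    then show "hilbert (R ` H\<^sub>U)"
      using HU_H by (intro hilbert_isometric_image[OF hHU])
        (auto simp: bounded_ops_add[OF R] bounded_ops_scaleC[OF R] subset_iff)
    show "R ` H\<^sub>U \<subseteq> K\<^sub>U" using R_HU by blast
    show "ortho_compl K\<^sub>U (R ` H\<^sub>U) \<subseteq> {0}"
    proof
      fix y assume y: "y \<in> ortho_compl K\<^sub>U (R ` H\<^sub>U)"
      then have "y \<in> K" "\<And>m. m \<in> M \<Longrightarrow> cinner y (R m) = 0" "\<And>u. u \<in> H\<^sub>U \<Longrightarrow> cinner y (R u) = 0"
        unfolding KU L ortho_compl_closure by (auto simp: ortho_compl_def)
      then show "y \<in> {0}" using ran_dense[of y] ortho_R[of _ y] by simp
    qed
  qed
  have unitary: "unitary_op H\<^sub>U K\<^sub>U RU"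
    unfolding unitary_op_def
  proof (intro conjI ballI)
    fix y assume "y \<in> K\<^sub>U"
    then obtain x where "x \<in> H\<^sub>U" "y = RU x" using surj_U by (auto simp: RU_def)
    then show "RU (adjoint_op H\<^sub>U K\<^sub>U RU y) = y" by (simp add: adj_U)
  qed (use RU adj_U in auto)
  have isometry: "isometry_op H\<^sub>S K\<^sub>S RS" using RS adj_S by (simp add: isometry_op_def)
  have pure: "pure_contraction H\<^sub>P\<^sub>C K\<^sub>P\<^sub>C RPC"
    unfolding pure_contraction_def
  proof (intro conjI ballI impI)
    fix h assume h: "h \<in> H\<^sub>P\<^sub>C" "h \<noteq> 0"
    then have hh: "h \<in> H" using HPC_H by blast
    have "norm (R h) \<noteq> norm h"
    proof
      assume "norm (R h) = norm h"
      then have "h \<in> H\<^sub>I"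
        using defect_op_eq_zero_iff[OF hH hK assms(8) hh] hh by (simp add: defs op_ker_def D_def)
      then have "cinner h h = 0" using h(1) by (simp add: HI ortho_compl_def)
      then show False using h(2) by simp
    qed
    then show "norm (RPC h) < norm h"
      using contraction_norm_le[OF assms(8) sH hh] h(1) by (simp add: RPC_def)
  qed (rule RPC)

  have conj: "\<forall>a. \<forall>x\<in>H\<^sub>U. \<pi> a x = adjoint_op H\<^sub>U K\<^sub>U RU (\<rho> a (RU x))"
  proof (intro allI ballI)
    fix a x assume x: "x \<in> H\<^sub>U"
    have px: "\<pi> a x \<in> H\<^sub>U" using red_HU x by (auto simp: reduces_rep_def reduces_op_def)
    have "\<rho> a (RU x) = RU (\<pi> a x)" using x px HU_H by (simp add: RU_def \<rho>R subset_iff)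
    then show "\<pi> a x = adjoint_op H\<^sub>U K\<^sub>U RU (\<rho> a (RU x))" by (simp add: adj_U[OF px])
  qed

  \<comment> \<open>The range of \<open>R\<close> is dense, and all three spaces in the last claim are orthogonal to it.\<close>
  have ran_D: "cinner y (R h) = 0" if "y \<in> K\<^sub>I" "h \<in> H\<^sub>P\<^sub>C" for y h
    using that R_HPC by (auto simp: KI ortho_compl_def)
  have split_H: "\<exists>u h. x = u + h \<and> u \<in> H\<^sub>I \<and> h \<in> H\<^sub>P\<^sub>C" if "x \<in> H" for x
    using sum_H that unfolding ortho_sum_def by blast
  have KI_zero: "y = 0" if "y \<in> K\<^sub>I" "\<And>u. u \<in> H\<^sub>I \<Longrightarrow> cinner y (R u) = 0" for y
  proof (rule ran_dense)
    fix x assume "x \<in> H"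
    then obtain u h where uh: "x = u + h" "u \<in> H\<^sub>I" "h \<in> H\<^sub>P\<^sub>C" using split_H by blast
    then have "R x = R u + R h" using hHI(2) HPC_H by (auto simp: bounded_ops_add[OF R] subset_iff)
    then show "cinner y (R x) = 0" using that ran_D uh by (simp add: cinner_add_right)
  qed (use that(1) hKI(2) in blast)
  have "defect_space H\<^sub>I K\<^sub>I RI = {0}"
    using KI_zero csubspace_zero[OF hilbert_csubspace[OF hKI(1)]]
    by (auto simp: defect_space_def ortho_compl_def RI_def)
  moreover have "defect_space H\<^sub>S K\<^sub>S RS = {0}"
  proof (intro equalityI subsetI)
    fix y assume "y \<in> defect_space H\<^sub>S K\<^sub>S RS"
    then have y: "y \<in> K\<^sub>S" "\<And>v. v \<in> H\<^sub>S \<Longrightarrow> cinner y (R v) = 0"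
      by (auto simp: defect_space_def ortho_compl_def RS_def)
    have "cinner y (R x) = 0" if x: "x \<in> H\<^sub>I" for x
    proof -
      obtain u v where uv: "x = u + v" "u \<in> H\<^sub>U" "v \<in> H\<^sub>S"
        using sum_HI x unfolding ortho_sum_def by blast
      have "cinner (R u) y = 0" using sum_KI R_HU[OF uv(2)] y(1) by (simp add: ortho_sum_def)
      then have "cinner y (R u) = 0" by (simp add: cinner_eq_zero_commute)
      moreover have "R x = R u + R v"
        using uv HU_H HS_HI hHI(2) by (auto simp: bounded_ops_add[OF R] subset_iff)
      ultimately show ?thesis using y(2) uv by (simp add: cinner_add_right)
    qed
    then have "y = 0" using y(1) KS by (intro KI_zero) auto
    then show "y \<in> {0}" by simp
  next
    fix y :: 'k assume "y \<in> {0}"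
    then show "y \<in> defect_space H\<^sub>S K\<^sub>S RS"
      using csubspace_zero[OF hilbert_csubspace[OF hKS]] by (simp add: defect_space_def ortho_compl_def)
  qed
  moreover have "op_ker K (adjoint_op H K R) = {0}"
  proof (intro equalityI subsetI)
    fix y assume "y \<in> op_ker K (adjoint_op H K R)"
    then have y: "y \<in> K" "adjoint_op H K R y = 0" by (simp_all add: op_ker_def)
    have "cinner y (R x) = 0" if "x \<in> H" for x
      using cinner_adjoint_op'[OF hH hK R that y(1)] y(2) by simp
    then show "y \<in> {0}" using ran_dense[OF y(1)] by simp
  next
    fix y :: 'k assume "y \<in> {0}"
    then show "y \<in> op_ker K (adjoint_op H K R)"
      using bounded_ops_zero[OF adjoint_op_bounded_ops[OF hH hK R] csubspace_zero[OF sK]] csubspace_zero[OF sK]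
      by (simp add: op_ker_def)
  qed
  ultimately have defect: "defect_space H\<^sub>I K\<^sub>I RI = defect_space H\<^sub>S K\<^sub>S RS"
    "defect_space H\<^sub>S K\<^sub>S RS = op_ker K (adjoint_op H K R)" by simp_all

  have HS_M: "H\<^sub>S \<subseteq> M" and KS_L: "K\<^sub>S \<subseteq> L_chi" by (auto simp: HS KS)
  show ?thesis
    by (intro conjI exI[of _ RI] exI[of _ RU] exI[of _ RS] exI[of _ RPC] sum_H sum_HI sum_K sum_KI
        red_HU reduce_H[OF hHS HS_M] reduce_H[OF HPC] scalar_H red_KU reduce_K[OF hKS KS_L]
        reduce_K[OF KPC] scalar_K sum_R sum_RI unitary isometry pure conj defect)
qed

end
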